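(* Assume the Hardy–Littlewood conjecture on prime values of quadratic polynomials. Let $D \in \mathbb{Z}$ be such that $D$ is neither a square nor a cube in $\mathbb{Q}(\sqrt{-3})$ and $D \ne 80 d^6$ for every $d \in \mathbb{Z}[(1+\sqrt{-3})/2]$. Then there are infinitely many elliptic Korselt numbers of Type I for the elliptic curve $E : y^2 = x^3 + D$ over $\mathbb{Q}$.
   Context: Hardy–Littlewood conjecture (Conjecture F): let $a,b,c$ be integers with $a > 0$, $\gcd(a,b,c) = 1$, $a+b$ and $c$ not both even, and $\Delta = b^2 - 4ac$ not a perfect square. Then there are infinitely many primes of the form $am^2+bm+c$ with $m$ a nonnegative integer, and the number $P(X)$ of primes $\le X$ of this form satisfies, as $X \to \infty$, $$P(X) \sim \frac{\varepsilon\, C\, \sqrt{X}}{\sqrt{a}\,\log X} \prod_{\substack{p > 2\\ p \mid \gcd(a,b)}} \frac{p}{p-1},$$ where $p$ denotes primes, $\varepsilon = 1$ if $a+b$ is odd, $\varepsilon = 2$ if $a+b$ is even, and $C = \prod_{p > 2,\ p \nmid a}\left(1 - \frac{1}{p-1}\left(\frac{\Delta}{p}\right)\right)$ with $\left(\frac{\cdot}{p}\right)$ the Legendre symbol. For an elliptic curve $E/\mathbb{Q}$ and a prime $p$ of good reduction, $a_p = p + 1 - \#E(\mathbb{F}_p)$ (computed from a minimal Weierstrass model). For a positive integer $n$, $a_n$ is the $n$-th coefficient of the $L$-series $L(E/\mathbb{Q},s) = \sum_{n\ge1} a_n n^{-s}$; thus $a_1 = 1$, $a_{mn} = a_m a_n$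 for coprime $m,n$, and $a_{p^{k+1}} = a_p a_{p^k} - p\,a_{p^{k-1}}$ for $p$ of good reduction and $k \ge 1$. $\operatorname{ord}_p(k)$ is the exponent of $p$ in $k$, with $\operatorname{ord}_p(0) = \infty$. A positive integer $n$ is an elliptic Korselt number of Type I for $E$ if $n$ has at least two distinct prime factors and for every prime $p$ dividing $n$: (i) $E$ has good reduction at $p$; (ii) $p + 1 - a_p$ divides $n + 1 - a_n$; (iii) $\operatorname{ord}_p(a_n - 1) \ge \operatorname{ord}_p(n) - \delta_p$, where $\delta_p = 1$ if $a_p \not\equiv 1 \pmod p$ and $\delta_p = 0$ if $a_p \equiv 1 \pmod p$. *)

theory Defs
  imports
    "HOL-Analysis.Infinite_Products"
    "HOL-Number_Theory.Number_Theory"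
    "HOL-Library.Landau_Symbols"
    "HOL-Library.Extended_Nat"
begin

section \<open>The Hardy--Littlewood conjecture on prime values of quadratic polynomials\<close>

definition quadratic_primes :: "int \<Rightarrow> int \<Rightarrow> int \<Rightarrow> nat set" where
  "quadratic_primes a b c =
     {p. prime p \<and> (\<exists>m::nat. int p = a * (int m)\<^sup>2 + b * int m + c)}"

text \<open>
  The infinite product over the odd primes not dividing \<open>a\<close> converges only conditionally;
  \<^const>\<open>prodinf\<close> is the limit of the partial products taken in increasing order.
\<close>

definition hl_constant :: "int \<Rightarrow> int \<Rightarrow> int \<Rightarrow> real" where
  "hl_constant a b c =
     (\<Prod>p. if prime p \<and> p > 2 \<and> \<not> int p dvd a
           then 1 - 1 / (real p - 1) * real_of_int (Legendre (b\<^sup>2 - 4 * a * c) (int p))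
           else 1)"

definition hl_main_term :: "int \<Rightarrow> int \<Rightarrow> int \<Rightarrow> real \<Rightarrow> real" where
  "hl_main_term a b c X =
     (if odd (a + b) then 1 else 2) * hl_constant a b c * sqrt X / (sqrt (of_int a) * ln X)
       * (\<Prod>p | prime p \<and> p > 2 \<and> int p dvd gcd a b. real p / (real p - 1))"

definition hardy_littlewood_conjecture :: bool where
  "hardy_littlewood_conjecture \<longleftrightarrow>
     (\<forall>a b c :: int.
        a > 0 \<longrightarrow> Gcd {a, b, c} = 1 \<longrightarrow> \<not> (even (a + b) \<and> even c) \<longrightarrow>
        \<not> (\<exists>k::int. b\<^sup>2 - 4 * a * c = k\<^sup>2) \<longrightarrow>
        infinite (quadratic_primes a b c) \<and>
        asymp_equiv (\<lambda>X::real. real (card {p \<in> quadratic_primes a b c. real p \<le> X})) at_top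
                    (hl_main_term a b c))"


section \<open>Weierstrass equations\<close>

text \<open>The equation \<open>y\<^sup>2 + a\<^sub>1 x y + a\<^sub>3 y = x\<^sup>3 + a\<^sub>2 x\<^sup>2 + a\<^sub>4 x + a\<^sub>6\<close>.\<close>

datatype 'a weierstrass =
  Weierstrass (wa1: 'a) (wa2: 'a) (wa3: 'a) (wa4: 'a) (wa6: 'a)

definition wdisc :: "'a::comm_ring_1 weierstrass \<Rightarrow> 'a" where
  "wdisc W =
     (let b2 = (wa1 W)\<^sup>2 + 4 * wa2 W;
          b4 = 2 * wa4 W + wa1 W * wa3 W;
          b6 = (wa3 W)\<^sup>2 + 4 * wa6 W;
          b8 = (wa1 W)\<^sup>2 * wa6 W + 4 * wa2 W * wa6 W - wa1 W * wa3 W * wa4 W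
               + wa2 W * (wa3 W)\<^sup>2 - (wa4 W)\<^sup>2
      in - b2\<^sup>2 * b8 - 8 * b4 ^ 3 - 27 * b6\<^sup>2 + 9 * b2 * b4 * b6)"

text \<open>
  \<open>change_vars u r s t W\<close> is the equation obtained from \<open>W\<close> by the substitution
  \<open>x = u\<^sup>2 x' + r\<close>, \<open>y = u\<^sup>3 y' + s u\<^sup>2 x' + t\<close> (for \<open>u \<noteq> 0\<close>), after division by \<open>u\<^sup>6\<close>.
\<close>

definition change_vars ::
    "'a::field \<Rightarrow> 'a \<Rightarrow> 'a \<Rightarrow> 'a \<Rightarrow> 'a weierstrass \<Rightarrow> 'a weierstrass" where
  "change_vars u r s t W = Weierstrass
     ((wa1 W + 2 * s) / u)
     ((wa2 W - s * wa1 W + 3 * r - s\<^sup>2) / u\<^sup>2)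
     ((wa3 W + r * wa1 W + 2 * t) / u ^ 3)
     ((wa4 W - s * wa3 W + 2 * r * wa2 W - (t + r * s) * wa1 W + 3 * r\<^sup>2 - 2 * s * t) / u ^ 4)
     ((wa6 W + r * wa4 W + r\<^sup>2 * wa2 W + r ^ 3 - t * wa3 W - t\<^sup>2 - r * t * wa1 W) / u ^ 6)"

text \<open>
  An elliptic curve over \<open>\<rat>\<close> is given by some \<open>E :: rat weierstrass\<close> with \<open>wdisc E \<noteq> 0\<close>;
  all notions below are meant for such \<open>E\<close>.
\<close>

definition integral_model :: "rat weierstrass \<Rightarrow> int weierstrass \<Rightarrow> bool" where
  "integral_model E W \<longleftrightarrow>
     (\<exists>u r s t. u \<noteq> 0 \<and> map_weierstrass of_int W = change_vars u r s t E)"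

text \<open>
  A model that is minimal at \<open>p\<close>. All choices have the same valuation of the discriminant at
  \<open>p\<close>, isomorphic reductions modulo \<open>p\<close>, and every global minimal model is such a choice.
\<close>

definition minimal_model :: "rat weierstrass \<Rightarrow> nat \<Rightarrow> int weierstrass" where
  "minimal_model E p =
     arg_min (\<lambda>W. multiplicity (int p) (wdisc W)) (integral_model E)"

definition good_reduction :: "rat weierstrass \<Rightarrow> nat \<Rightarrow> bool" where
  "good_reduction E p \<longleftrightarrow> \<not> int p dvd wdisc (minimal_model E p)"

definition affine_points_mod :: "nat \<Rightarrow> int weierstrass \<Rightarrow> (int \<times> int) set" where
  "affine_points_mod p W =
     {(x, y). x \<in> {0..<int p} \<and> y \<in> {0..<int p} \<and>
        [y\<^sup>2 + wa1 W * x * y + wa3 W * y = x ^ 3 + wa2 W * x\<^sup>2 + wa4 W * x + wa6 W] (mod int p)}"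

text \<open>The additional \<open>1\<close> is the point at infinity.\<close>

definition num_points :: "rat weierstrass \<Rightarrow> nat \<Rightarrow> nat" where
  "num_points E p = card (affine_points_mod p (minimal_model E p)) + 1"

text \<open>
  At a prime of bad reduction the singular point of the reduced curve is counted as well, so that
  this gives the usual values \<open>1\<close>, \<open>-1\<close>, \<open>0\<close> for split multiplicative, nonsplit multiplicative
  and additive reduction.
\<close>

definition trace_frob :: "rat weierstrass \<Rightarrow> nat \<Rightarrow> int" where
  "trace_frob E p = int p + 1 - int (num_points E p)"

text \<open>
  Coefficients of the expansion of the Euler factor \<open>1 / (1 - a\<^sub>p T + e p T\<^sup>2)\<close> of the
  \<open>L\<close>-series, with \<open>e = 1\<close> for good and \<open>e = 0\<close> for bad reduction.
\<close>

fun euler_coeff :: "rat weierstrass \<Rightarrow> nat \<Rightarrow> nat \<Rightarrow> int" where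
  "euler_coeff E p 0 = 1"
| "euler_coeff E p (Suc 0) = trace_frob E p"
| "euler_coeff E p (Suc (Suc k)) =
     trace_frob E p * euler_coeff E p (Suc k)
       - (if good_reduction E p then int p else 0) * euler_coeff E p k"

definition L_coeff :: "rat weierstrass \<Rightarrow> nat \<Rightarrow> int" where
  "L_coeff E n = (\<Prod>p\<in>prime_factors n. euler_coeff E p (multiplicity p n))"


section \<open>Elliptic Korselt numbers of Type I\<close>

text \<open>Unlike \<^const>\<open>multiplicity\<close>, this has value \<open>\<infinity>\<close> at \<open>0\<close>.\<close>

definition ord_at :: "nat \<Rightarrow> int \<Rightarrow> enat" where
  "ord_at p k = (if k = 0 then \<infinity> else enat (multiplicity (int p) k))"

text \<open>
  The subtraction in \<^typ>\<open>enat\<close> does not truncate here, since \<open>ord_at p (int n) \<ge> 1\<close>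
  for a prime divisor \<open>p\<close> of \<open>n\<close>.
\<close>

definition elliptic_korselt_I :: "rat weierstrass \<Rightarrow> nat \<Rightarrow> bool" where
  "elliptic_korselt_I E n \<longleftrightarrow>
     n > 0 \<and> card (prime_factors n) \<ge> 2 \<and>
     (\<forall>p. prime p \<and> p dvd n \<longrightarrow>
        good_reduction E p \<and>
        (int p + 1 - L_coeff E p) dvd (int n + 1 - L_coeff E n) \<and>
        ord_at p (L_coeff E n - 1) \<ge>
          ord_at p (int n) - (if [L_coeff E p = 1] (mod int p) then 0 else 1))"


section \<open>The field \<open>\<rat>(\<surd>-3)\<close> and its ring of integers\<close>

definition Q_sqrt_minus3 :: "complex set" where
  "Q_sqrt_minus3 = {of_rat x + of_rat y * csqrt (-3) | x y. True}"

definition Eisenstein_integers :: "complex set" where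
  "Eisenstein_integers = {of_int x + of_int y * ((1 + csqrt (-3)) / 2) | x y. True}"

end

theory Submission
  imports Defs "HOL-Computational_Algebra.Polynomial"
begin

text \<open>
  A product of two distinct anomalous primes (good primes with \<open>a\<^sub>p = 1\<close>) is an elliptic Korselt
  number of Type I. The primes \<open>p = 3 m\<^sup>2 + 3 m + 1\<close> are the norms of the Eisenstein integers
  \<open>\<pi> = (m + 1) + (2 m + 1) \<omega>\<close> of trace \<open>1\<close>, and for them \<open>a\<^sub>p = 1\<close> as soon as \<open>D\<close> is a quadratic
  nonresidue and the cubic residue symbol of \<open>4 D\<close> modulo \<open>\<pi>\<close> has a value determined by \<open>m\<close> modulo \<open>3\<close>.
  By quadratic and cubic reciprocity (the latter via Gauss sums in \<open>\<int>[\<omega>][\<int>/p]\<close>) these conditions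
  depend only on \<open>m\<close> modulo a fixed integer, so that the Hardy--Littlewood conjecture provides
  infinitely many such primes in a suitable residue class of \<open>m\<close>.

  A residue class is not available for \<open>D = 80 d\<^sup>6\<close>, but neither for \<open>D = - 16 \<sdot> 7\<^sup>5 d\<^sup>6\<close>, where
  no prime \<open>3 m\<^sup>2 + 3 m + 1\<close> is anomalous although the hypotheses hold. In this case \<open>a\<^sub>1\<^sub>3 = 7\<close>, and
  \<open>n = 13 p\<close> is an elliptic Korselt number whenever \<open>p \<equiv> 1\<close> modulo \<open>7\<close> and \<open>a\<^sub>p = 2\<close>; the primes
  \<open>p = 3 (42 k)\<^sup>2 + 1\<close> have these properties.
\<close>

section \<open>Congruences modulo an ideal with two generators\<close>

text \<open>For \<open>p = 6 n + 1\<close> the character sum of \<open>t ^ 3 + D\<close> is, modulo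
  \<open>p\<close>, the conjugate Jacobi sum times \<open>(4 * D) ^ n\<close>. The Jacobi sum is a
  unit times any generator of its prime; if that generator has trace 1, its conjugate reduces to 1
  and only a sixth root of unity is left. The quadratic character of \<open>D\<close> fixes its
  sign, the cubic character of \<open>4 D\<close> the rest, and the trivial bound on the sum turns
  the congruence into an equality. Trace 1 is also the obstacle. Modulo a prime
  \<open>q >= 5\<close> an element of Z[om] can be rescaled to some \<open>zeta m\<close> only if
  its trace is prime to \<open>q\<close>. This rules out a single combination, nonresidue norm with
  trivial cubic character, and only at 5 and 7, where all such elements have trace zero. When a sign
  is demanded and 5 or 7 is the only prime that can supply it, this leaves, up to sign and sixth
  powers, the patterns 2^4 * 5 and 2^4 * 7^5, each with a twin multiplied by -27, the sixth power of
  sqrt(-3).\<close>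

definition idcong :: "'a::comm_ring_1 \<Rightarrow> 'a \<Rightarrow> 'a \<Rightarrow> 'a \<Rightarrow> bool" where
  "idcong n m a b \<longleftrightarrow> (\<exists>u w. a - b = n * u + m * w)"

lemma idcong_refl [simp]: "idcong n m a a"
  unfolding idcong_def by (rule exI[of _ 0], rule exI[of _ 0]) simp

lemma idcong_sym: "idcong n m a b \<Longrightarrow> idcong n m b a"
  unfolding idcong_def
proof (elim exE)
  fix u w assume "a - b = n * u + m * w"
  then have "b - a = n * (- u) + m * (- w)" by (simp add: algebra_simps)
  then show "\<exists>u w. b - a = n * u + m * w" by blast
qed

lemma idcong_trans [trans]:
  assumes "idcong n m a b" "idcong n m b c" shows "idcong n m a c"
proof -
  obtain u w u' w' where "a - b = n * u + m * w" "b - c = n * u' + m * w'"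
    using assms unfolding idcong_def by blast
  then have "a - c = n * (u + u') + m * (w + w')" by (simp add: algebra_simps)
  then show ?thesis unfolding idcong_def by blast
qed

lemma idcong_add:
  assumes "idcong n m a b" "idcong n m c d" shows "idcong n m (a + c) (b + d)"
proof -
  obtain u w u' w' where "a - b = n * u + m * w" "c - d = n * u' + m * w'"
    using assms unfolding idcong_def by blast
  then have "(a + c) - (b + d) = n * (u + u') + m * (w + w')" by (simp add: algebra_simps)
  then show ?thesis unfolding idcong_def by blast
qed

lemma idcong_mult:
  assumes "idcong n m a b" "idcong n m c d" shows "idcong n m (a * c) (b * d)"
proof -
  obtain u w u' w' where *: "a - b = n * u + m * w" "c - d = n * u' + m * w'"
    using assms unfolding idcong_def by blast
  have "a * c - b * d = (a - b) * c + b * (c - d)" by (simp add: algebra_simps)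
  also have "\<dots> = n * (u * c + b * u') + m * (w * c + b * w')"
    unfolding * by (simp add: algebra_simps)
  finally show ?thesis unfolding idcong_def by blast
qed

lemma idcong_scale: "idcong n m a b \<Longrightarrow> idcong n m (c * a) (c * b)"
  by (rule idcong_mult) simp_all

lemma idcong_uminus: "idcong n m a b \<Longrightarrow> idcong n m (- a) (- b)"
  using idcong_scale[of n m a b "-1"] by simp

lemma idcong_power: "idcong n m a b \<Longrightarrow> idcong n m (a ^ k) (b ^ k)"
  by (induction k) (auto intro: idcong_mult)

lemma idcong_sum:
  "(\<And>x. x \<in> A \<Longrightarrow> idcong n m (f x) (g x)) \<Longrightarrow> idcong n m (sum f A) (sum g A)"
  by (induction A rule: infinite_finite_induct) (auto intro: idcong_add)

lemma idcong_dvd: "m dvd a - b \<Longrightarrow> idcong n m a b"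
  unfolding idcong_def dvd_def by (rule exI[of _ 0]) auto

lemma idcong_zero_iff: "idcong n 0 a b \<longleftrightarrow> n dvd a - b"
  by (auto simp: idcong_def dvd_def)

text \<open>Additivity of Frobenius, stated for an arbitrary second generator so that it serves both
  in the group ring (\<open>m = cyc p\<close>) and in Z[om] (\<open>m = 0\<close>).\<close>

lemma prime_power_add_idcong:
  fixes a b :: "'a::comm_ring_1"
  assumes q: "prime q"
  shows "idcong (of_nat q) m ((a + b) ^ q) (a ^ q + b ^ q)"
proof -
  have q0: "q > 0" using q prime_gt_0_nat by blast
  have "(a + b) ^ q = (\<Sum>k\<le>q. of_nat (q choose k) * a ^ k * b ^ (q - k))"
    by (rule binomial_ring)
  also have "{..q} = insert 0 (insert q {0<..<q})" using q0 by auto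
  also have "(\<Sum>k\<in>insert 0 (insert q {0<..<q}). of_nat (q choose k) * a ^ k * b ^ (q - k))
      = b ^ q + (a ^ q + (\<Sum>k\<in>{0<..<q}. of_nat (q choose k) * a ^ k * b ^ (q - k)))"
    using q0 by (subst sum.insert; simp)
  finally have *: "(a + b) ^ q - (a ^ q + b ^ q)
      = (\<Sum>k\<in>{0<..<q}. of_nat (q choose k) * a ^ k * b ^ (q - k))" by simp
  have "(of_nat q :: 'a) dvd (\<Sum>k\<in>{0<..<q}. of_nat (q choose k) * a ^ k * b ^ (q - k))"
  proof (rule dvd_sum)
    fix k assume "k \<in> {0<..<q}"
    then have "q dvd (q choose k)" using q by (intro dvd_choose_prime) auto
    then have "(of_nat q :: 'a) dvd of_nat (q choose k)" by (metis dvd_def of_nat_mult)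
    then show "(of_nat q :: 'a) dvd of_nat (q choose k) * a ^ k * b ^ (q - k)"
      by (intro dvd_mult2)
  qed
  then obtain u where "(a + b) ^ q - (a ^ q + b ^ q) = of_nat q * u + m * 0"
    unfolding * by auto
  then show ?thesis unfolding idcong_def by blast
qed

lemma prime_power_sum_idcong:
  fixes f :: "'b \<Rightarrow> 'a::comm_ring_1"
  assumes q: "prime q"
  shows "idcong (of_nat q) m ((\<Sum>x\<in>A. f x) ^ q) (\<Sum>x\<in>A. f x ^ q)"
proof (induction A rule: infinite_finite_induct)
  case (insert x F)
  then have "(\<Sum>x\<in>insert x F. f x) ^ q = (f x + (\<Sum>x\<in>F. f x)) ^ q" by simp
  also have "idcong (of_nat q) m \<dots> (f x ^ q + (\<Sum>x\<in>F. f x) ^ q)"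
    by (rule prime_power_add_idcong[OF q])
  also have "idcong (of_nat q) m \<dots> (f x ^ q + (\<Sum>x\<in>F. f x ^ q))"
    by (rule idcong_add[OF idcong_refl insert.IH])
  finally show ?case using insert by simp
qed (use q prime_gt_0_nat[of q] in \<open>auto simp: zero_power\<close>)

section \<open>The Eisenstein integers\<close>

text \<open>\<open>Eis x y\<close> stands for \<open>x + y \<omega>\<close>, where \<open>\<omega>\<close> is a primitive cube root of unity.\<close>

datatype eis = Eis (ere: int) (eim: int)

instantiation eis :: comm_ring_1
begin
definition "0 = Eis 0 0"
definition "1 = Eis 1 0"
definition "a + b = Eis (ere a + ere b) (eim a + eim b)"
definition "a - b = Eis (ere a - ere b) (eim a - eim b)"
definition "- a = Eis (- ere a) (- eim a)"
definition "a * b = Eis (ere a * ere b - eim a * eim b)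
                        (ere a * eim b + eim a * ere b - eim a * eim b)"
instance
proof
  fix a b c :: eis
  note defs = zero_eis_def one_eis_def plus_eis_def minus_eis_def uminus_eis_def times_eis_def
  show "a * b * c = a * (b * c)"
    unfolding times_eis_def eis.sel eis.inject by (simp add: algebra_simps)
  show "(a + b) * c = a * c + b * c"
    unfolding times_eis_def plus_eis_def eis.sel eis.inject by (simp add: algebra_simps)
  show "a * b = b * a"
    unfolding times_eis_def eis.sel eis.inject by (simp add: algebra_simps)
  show "a + b + c = a + (b + c)" "a + b = b + a"
    unfolding plus_eis_def by simp_all
  show "0 + a = a" "- a + a = 0"
    unfolding plus_eis_def zero_eis_def uminus_eis_def by simp_all
  show "a - b = a + - b"
    unfolding plus_eis_def minus_eis_def uminus_eis_def by simp
  show "1 * a = a" "(0::eis) \<noteq> 1"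
    unfolding times_eis_def zero_eis_def one_eis_def by simp_all
qed
end

lemma ere_simps [simp]:
  "ere 0 = 0" "ere 1 = 1" "ere (a + b) = ere a + ere b" "ere (a - b) = ere a - ere b"
  "ere (- a) = - ere a" "ere (a * b) = ere a * ere b - eim a * eim b"
  by (simp_all add: zero_eis_def one_eis_def plus_eis_def minus_eis_def uminus_eis_def times_eis_def)

lemma eim_simps [simp]:
  "eim 0 = 0" "eim 1 = 0" "eim (a + b) = eim a + eim b" "eim (a - b) = eim a - eim b"
  "eim (- a) = - eim a" "eim (a * b) = ere a * eim b + eim a * ere b - eim a * eim b"
  by (simp_all add: zero_eis_def one_eis_def plus_eis_def minus_eis_def uminus_eis_def times_eis_def)

lemma of_nat_eis [simp]: "ere (of_nat n) = int n" "eim (of_nat n) = 0"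
  by (induction n) auto

lemma of_int_eis [simp]: "ere (of_int n) = n" "eim (of_int n) = 0"
  by (cases n; simp)+

lemma numeral_eis [simp]: "ere (numeral n) = numeral n" "eim (numeral n) = 0"
  using of_nat_eis[of "numeral n"] by simp_all

lemma eis_eqI: "ere a = ere b \<Longrightarrow> eim a = eim b \<Longrightarrow> a = b"
  by (rule eis.expand) simp

lemma eis_eq_iff: "a = b \<longleftrightarrow> ere a = ere b \<and> eim a = eim b"
  by (auto intro: eis_eqI)

lemma of_int_dvd_eis_iff: "of_int n dvd z \<longleftrightarrow> n dvd ere z \<and> n dvd eim z"
proof
  assume "n dvd ere z \<and> n dvd eim z"
  then obtain a b where "ere z = n * a" "eim z = n * b" by (auto simp: dvd_def)
  then have "z = of_int n * Eis a b" by (intro eis_eqI) auto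
  then show "of_int n dvd z" by simp
qed (auto simp: dvd_def)

text \<open>Complex conjugation: it sends \<open>om\<close> to its other conjugate -1 - om.\<close>

definition econj :: "eis \<Rightarrow> eis" where "econj z = Eis (ere z - eim z) (- eim z)"

definition enorm :: "eis \<Rightarrow> int" where "enorm z = (ere z)\<^sup>2 - ere z * eim z + (eim z)\<^sup>2"

definition om :: eis where "om = Eis 0 1"

lemma om_simps [simp]: "ere om = 0" "eim om = 1" by (simp_all add: om_def)

lemma econj_simps [simp]:
  "ere (econj z) = ere z - eim z" "eim (econj z) = - eim z"
  by (simp_all add: econj_def)

lemma econj_hom:
  "econj 0 = 0" "econj 1 = 1" "econj (a + b) = econj a + econj b" "econj (a * b) = econj a * econj b"
  "econj (econj a) = a" "econj (of_int k) = of_int k"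
  by (auto intro!: eis_eqI simp: algebra_simps)

lemma econj_sum: "econj (sum f A) = (\<Sum>x\<in>A. econj (f x))"
  by (induction A rule: infinite_finite_induct) (auto simp: econj_hom)

lemma econj_power: "econj (a ^ n) = econj a ^ n"
  by (induction n) (auto simp: econj_hom)

lemma mult_econj: "z * econj z = of_int (enorm z)"
  by (rule eis_eqI) (auto simp: enorm_def algebra_simps power2_eq_square)

lemma enorm_mult: "enorm (a * b) = enorm a * enorm b"
  by (simp add: enorm_def algebra_simps power2_eq_square)

lemma enorm_power: "enorm (a ^ n) = enorm a ^ n"
  by (induction n) (auto simp: enorm_mult, simp add: enorm_def)

lemma enorm_of_int [simp]: "enorm (of_int k) = k\<^sup>2" by (simp add: enorm_def)

lemma om_cube [simp]: "om ^ 3 = 1"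
  by (rule eis_eqI) (auto simp: power3_eq_cube)

lemma om_square: "om ^ 2 = Eis (-1) (-1)"
  by (rule eis_eqI) (auto simp: power2_eq_square)

lemma om_power_mod: "om ^ n = om ^ (n mod 3)"
proof -
  have "om ^ n = om ^ (3 * (n div 3) + n mod 3)" by simp
  also have "\<dots> = om ^ (n mod 3)" unfolding power_add power_mult by simp
  finally show ?thesis .
qed

lemma om_power_cases: "om ^ n \<in> {1, om, om ^ 2}"
proof -
  have "n mod 3 = 0 \<or> n mod 3 = 1 \<or> n mod 3 = 2" by auto
  then show ?thesis by (subst om_power_mod) (auto simp: power2_eq_square)
qed

text \<open>The difference of two distinct cube roots of unity has a coordinate 1 or -1, so only
  units divide it. This reads a cubic character off a congruence modulo \<open>q\<close>; with
  \<open>k = 0\<close> it gives equality.\<close>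

lemma om_power_idcong:
  assumes "idcong (of_int k) 0 (om ^ i) (om ^ j)" "\<not> k dvd 1"
  shows "[i = j] (mod 3)"
proof -
  have k: "of_int k dvd om ^ (i mod 3) - om ^ (j mod 3)"
    using assms(1) unfolding idcong_zero_iff by (metis om_power_mod)
  have ij: "i mod 3 = 0 \<or> i mod 3 = 1 \<or> i mod 3 = 2" "j mod 3 = 0 \<or> j mod 3 = 1 \<or> j mod 3 = 2"
    by auto
  have "i mod 3 = j mod 3"
    using k ij assms(2)
    by (auto simp: of_int_dvd_eis_iff power2_eq_square)
  then show ?thesis by (simp add: cong_def)
qed

lemma om_power_eq_iff: "om ^ i = om ^ j \<longleftrightarrow> [i = j] (mod 3)"
proof
  assume "[i = j] (mod 3)"
  then show "om ^ i = om ^ j" unfolding cong_def by (metis om_power_mod)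
qed (use om_power_idcong[of 0 i j] in simp)

lemma idcong_of_int: "[a = b] (mod n) \<Longrightarrow> idcong (of_int n) 0 (of_int a :: 'a::comm_ring_1) (of_int b)"
  unfolding idcong_zero_iff cong_iff_dvd_diff by (metis dvd_def of_int_diff of_int_mult)

lemma enorm_idcong:
  assumes "idcong (of_int n) 0 a b" shows "[enorm a = enorm b] (mod n)"
proof -
  have "[ere a = ere b] (mod n)" "[eim a = eim b] (mod n)"
    using assms by (auto simp: idcong_zero_iff of_int_dvd_eis_iff cong_iff_dvd_diff)
  then show ?thesis unfolding enorm_def by (intro cong_add cong_diff cong_mult cong_pow)
qed

lemma eis_idcong_iff:
  "idcong (of_int n) 0 a b \<longleftrightarrow> [ere a = ere b] (mod n) \<and> [eim a = eim b] (mod n)"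
  by (auto simp: idcong_zero_iff of_int_dvd_eis_iff cong_iff_dvd_diff)

text \<open>The reduction \<open>\<int>[\<omega>] \<rightarrow> \<int>/p\<close> sending \<open>\<omega>\<close> to a root \<open>w\<close> of \<open>X\<^sup>2 + X + 1\<close>.\<close>

definition ered :: "int \<Rightarrow> eis \<Rightarrow> int" where "ered w z = ere z + eim z * w"

lemma ered_hom [simp]:
  "ered w 0 = 0" "ered w 1 = 1" "ered w (a + b) = ered w a + ered w b"
  "ered w (a - b) = ered w a - ered w b" "ered w (- a) = - ered w a"
  "ered w (of_int k) = k" "ered w om = w"
  by (simp_all add: ered_def algebra_simps)

lemma ered_sum: "ered w (sum f A) = (\<Sum>x\<in>A. ered w (f x))"
  by (induction A rule: infinite_finite_induct) auto

lemma ered_mult: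
  assumes "[w\<^sup>2 + w + 1 = 0] (mod p)"
  shows "[ered w (a * b) = ered w a * ered w b] (mod p)"
proof -
  have "ered w a * ered w b - ered w (a * b) = eim a * eim b * (w\<^sup>2 + w + 1)"
    by (simp add: ered_def algebra_simps power2_eq_square)
  then have "p dvd ered w a * ered w b - ered w (a * b)"
    using assms by (auto simp: cong_0_iff)
  then show ?thesis by (meson cong_iff_dvd_diff cong_sym)
qed

lemma ered_power:
  assumes "[w\<^sup>2 + w + 1 = 0] (mod p)"
  shows "[ered w (a ^ n) = ered w a ^ n] (mod p)"
proof (induction n)
  case (Suc n)
  have "[ered w (a ^ Suc n) = ered w a * ered w (a ^ n)] (mod p)"
    using ered_mult[OF assms] by simp
  also have "[ered w a * ered w (a ^ n) = ered w a * ered w a ^ n] (mod p)"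
    using Suc by (rule cong_scalar_left)
  finally show ?case by simp
qed simp

section \<open>The group ring of a cyclic group\<close>

text \<open>Elements of \<open>\<int>[\<omega>][\<int>/p]\<close> are represented by polynomials, modulo \<open>X\<^sup>p - 1\<close>.\<close>

definition cyc :: "nat \<Rightarrow> eis poly" where "cyc p = monom 1 p - 1"

definition gr :: "nat \<Rightarrow> (int \<Rightarrow> eis) \<Rightarrow> eis poly" where
  "gr p f = (\<Sum>t\<in>{0..<int p}. monom (f t) (nat t))"

text \<open>Functions on Z/p are represented by periodic functions on the integers, so that
  arguments such as \<open>u - s\<close> need no reduction.\<close>

definition periodic :: "nat \<Rightarrow> (int \<Rightarrow> 'a) \<Rightarrow> bool" where
  "periodic p f \<longleftrightarrow> (\<forall>x. f (x mod int p) = f x)"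

lemma periodicD: "periodic p f \<Longrightarrow> [x = y] (mod int p) \<Longrightarrow> f x = f y"
  unfolding periodic_def cong_def by metis

lemma bij_betw_affine_mod:
  assumes "coprime a (int p)" "p > 0"
  shows "bij_betw (\<lambda>t. (a * t + c) mod int p) {0..<int p} {0..<int p}"
proof (rule bij_betwI')
  fix x y assume xy: "x \<in> {0..<int p}" "y \<in> {0..<int p}"
  show "((a * x + c) mod int p = (a * y + c) mod int p) = (x = y)"
  proof
    assume "(a * x + c) mod int p = (a * y + c) mod int p"
    then have "[a * x = a * y] (mod int p)"
      by (metis cong_add_rcancel cong_def)
    then have "[x = y] (mod int p)" using assms(1) by (simp add: cong_mult_lcancel)
    then show "x = y" using xy by (auto simp: cong_def)
  qed simp
next
  fix y assume y: "y \<in> {0..<int p}"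
  obtain b where b: "[a * b = 1] (mod int p)" using assms cong_solve_coprime_int by blast
  have "[a * (b * (y - c)) + c = y] (mod int p)"
  proof -
    have "[a * b * (y - c) + c = 1 * (y - c) + c] (mod int p)"
      by (intro cong_add cong_mult b cong_refl)
    then show ?thesis by (simp add: mult.assoc)
  qed
  moreover have "[a * ((b * (y - c)) mod int p) + c = a * (b * (y - c)) + c] (mod int p)"
    by (intro cong_add cong_mult) (simp_all add: cong_def)
  ultimately have "[a * ((b * (y - c)) mod int p) + c = y] (mod int p)"
    using cong_trans by blast
  then show "\<exists>x\<in>{0..<int p}. y = (a * x + c) mod int p"
    using y assms(2) by (intro bexI[of _ "(b * (y - c)) mod int p"]) (auto simp: cong_def)
qed (use assms in auto)

lemma periodic_sum_affine:
  assumes "periodic p f" "coprime a (int p)" "p > 0"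
  shows "(\<Sum>t\<in>{0..<int p}. f (a * t + c)) = (\<Sum>t\<in>{0..<int p}. f t)"
proof -
  have "(\<Sum>t\<in>{0..<int p}. f (a * t + c)) = (\<Sum>t\<in>{0..<int p}. f ((a * t + c) mod int p))"
    using assms(1) by (simp add: periodic_def)
  also have "\<dots> = (\<Sum>t\<in>{0..<int p}. f t)"
    by (rule sum.reindex_bij_betw[OF bij_betw_affine_mod[OF assms(2,3)]])
  finally show ?thesis .
qed

lemma monom_idcong_mod: "idcong n (cyc p) (monom c k) (monom c (k mod p))"
proof -
  have "idcong n (cyc p) (monom 1 p) 1" by (rule idcong_dvd) (simp add: cyc_def)
  then have "idcong n (cyc p) (monom 1 p ^ (k div p) * monom c (k mod p)) (1 ^ (k div p) * monom c (k mod p))"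
    by (intro idcong_mult idcong_power) simp_all
  then show ?thesis by (simp add: monom_power mult_monom)
qed

lemma monom_idcong_periodic:
  assumes "[int k = x] (mod int p)" "p > 0"
  shows "idcong n (cyc p) (monom c k) (monom c (nat (x mod int p)))"
proof -
  have "nat (x mod int p) = k mod p" using assms by (metis cong_def nat_int zmod_int)
  then show ?thesis using monom_idcong_mod by simp
qed

definition conv :: "nat \<Rightarrow> (int \<Rightarrow> eis) \<Rightarrow> (int \<Rightarrow> eis) \<Rightarrow> int \<Rightarrow> eis" where
  "conv p f h u = (\<Sum>s\<in>{0..<int p}. f s * h (u - s))"

lemma gr_mult:
  assumes "periodic p h" "p > 0"
  shows "idcong n (cyc p) (gr p f * gr p h) (gr p (conv p f h))"
proof -
  let ?R = "{0..<int p}"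
  have "gr p f * gr p h = (\<Sum>s\<in>?R. \<Sum>t\<in>?R. monom (f s * h t) (nat s + nat t))"
    unfolding gr_def sum_product by (simp add: mult_monom)
  also have "idcong n (cyc p) \<dots> (\<Sum>s\<in>?R. \<Sum>t\<in>?R. monom (f s * h t) (nat ((s + t) mod int p)))"
    by (intro idcong_sum monom_idcong_periodic) (use assms in auto)
  also have "(\<Sum>s\<in>?R. \<Sum>t\<in>?R. monom (f s * h t) (nat ((s + t) mod int p)))
      = (\<Sum>s\<in>?R. \<Sum>t\<in>?R. monom (f s * h (t - s)) (nat t))"
  proof (rule sum.cong[OF refl])
    fix s assume "s \<in> ?R"
    have "[(1 * t + s) mod int p - s = (1 * t + s) - s] (mod int p)" for t
      by (intro cong_diff) (simp_all add: cong_def)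
    then have "h ((1 * t + s) mod int p - s) = h t" for t
      by (intro periodicD[OF assms(1)]) simp
    then have "(\<Sum>t\<in>?R. monom (f s * h t) (nat ((s + t) mod int p)))
        = (\<Sum>t\<in>?R. monom (f s * h ((1 * t + s) mod int p - s)) (nat ((1 * t + s) mod int p)))"
      by (simp add: add.commute)
    also have "\<dots> = (\<Sum>t\<in>?R. monom (f s * h (t - s)) (nat t))"
      by (rule sum.reindex_bij_betw[OF bij_betw_affine_mod]) (use assms in auto)
    finally show "(\<Sum>t\<in>?R. monom (f s * h t) (nat ((s + t) mod int p)))
        = (\<Sum>t\<in>?R. monom (f s * h (t - s)) (nat t))" .
  qed
  also have "\<dots> = (\<Sum>t\<in>?R. \<Sum>s\<in>?R. monom (f s * h (t - s)) (nat t))" by (rule sum.swap)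
  also have "\<dots> = gr p (conv p f h)"
    unfolding gr_def conv_def monom_sum ..
  finally show ?thesis .
qed

lemma gr_scale: "gr p (\<lambda>t. c * f t) = [:c:] * gr p f"
  unfolding gr_def by (simp add: sum_distrib_left smult_monom)

lemma gr_cong: "(\<And>t. 0 \<le> t \<Longrightarrow> t < int p \<Longrightarrow> f t = h t) \<Longrightarrow> gr p f = gr p h"
  unfolding gr_def by (intro sum.cong) auto

lemma gr_diff: "gr p f - gr p h = gr p (\<lambda>t. f t - h t)"
  unfolding gr_def by (simp add: diff_monom flip: sum_subtractf)

lemma coeff_gr: "coeff (gr p f) k = (if k < p then f (int k) else 0)"
proof -
  have "coeff (gr p f) k = (\<Sum>t\<in>{0..<int p}. if t = int k then f t else 0)"
    unfolding gr_def coeff_sum by (intro sum.cong) (auto simp: nat_eq_iff)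
  then show ?thesis by (simp add: sum.delta)
qed

text \<open>The sum of the coefficients in positions congruent to \<open>t\<close> modulo \<open>p\<close> vanishes on the
  ideal generated by \<open>X\<^sup>p - 1\<close>.\<close>

lemma gr_inject:
  assumes "idcong (of_int n) (cyc p) (gr p f) (gr p h)" "t < p"
  shows "idcong (of_int n) 0 (f (int t)) (h (int t))"
proof -
  obtain u w where uw: "gr p (\<lambda>t. f t - h t) = of_int n * u + cyc p * w"
    using assms(1) unfolding idcong_def gr_diff by blast
  \<comment> \<open>With this \<open>N\<close> the telescoping sum over the positions t, t + p, t +
    2p, ... ends beyond the degree of \<open>w\<close>.\<close>
  define N where "N = degree w + 1"
  have p: "p > 0" using assms(2) by simp
  have c: "coeff (cyc p * w) (t + k * p)
      = (if k = 0 then 0 else coeff w (t + (k - 1) * p)) - coeff w (t + k * p)" for k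
    unfolding cyc_def using assms(2)
    by (cases k) (simp_all add: left_diff_distrib coeff_monom_mult)
  have tel: "(\<Sum>k\<le>m. coeff (cyc p * w) (t + k * p)) = - coeff w (t + m * p)" for m
    by (induction m) (use c[of 0] in \<open>simp_all add: c\<close>)
  have "degree w < t + N * p" using p unfolding N_def
    by (cases p) auto
  then have "(\<Sum>k\<le>N. coeff (cyc p * w) (t + k * p)) = 0"
    unfolding tel by (simp add: coeff_eq_0)
  moreover have "coeff (of_int n * u) j = of_int n * coeff u j" for j
    by (simp add: of_int_poly)
  moreover have "(\<Sum>k\<le>N. coeff (gr p (\<lambda>t. f t - h t)) (t + k * p)) = f (int t) - h (int t)"
  proof -
    have "(\<Sum>k\<le>N. coeff (gr p (\<lambda>t. f t - h t)) (t + k * p))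
        = (\<Sum>k\<le>N. if k = 0 then f (int t) - h (int t) else 0)"
    proof (intro sum.cong refl)
      fix k assume "k \<in> {..N}"
      show "coeff (gr p (\<lambda>t. f t - h t)) (t + k * p) = (if k = 0 then f (int t) - h (int t) else 0)"
        using assms(2) by (cases k) (auto simp: coeff_gr)
    qed
    then show ?thesis by simp
  qed
  ultimately have "f (int t) - h (int t) = of_int n * (\<Sum>k\<le>N. coeff u (t + k * p))"
    unfolding uw coeff_add sum.distrib by (simp add: sum_distrib_left)
  then show ?thesis unfolding idcong_zero_iff by simp
qed

section \<open>Cubic Gauss and Jacobi sums\<close>

lemma of_int_mult_eis_eq_0: "of_int k * (z :: eis) = 0 \<Longrightarrow> k \<noteq> 0 \<Longrightarrow> z = 0"
  by (simp add: eis_eq_iff)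

lemma econj_om_power: "econj (om ^ i) = (om ^ i) ^ 2"
proof -
  have "econj om = om ^ 2" by (simp add: eis_eq_iff power2_eq_square)
  then have "econj (om ^ i) = om ^ (2 * i)" by (simp add: econj_power power_mult)
  then show ?thesis by (simp only: power_mult[symmetric] mult.commute)
qed

locale cubic_character =
  fixes p :: nat and chi :: "int \<Rightarrow> eis"
  assumes p: "prime p" and p_not_3: "p \<noteq> 3"
    and chi_periodic: "periodic p chi"
    and chi_mult: "chi (x * y) = chi x * chi y"
    and chi_0: "chi 0 = 0"
    and chi_values: "\<not> int p dvd x \<Longrightarrow> \<exists>i. chi x = om ^ i"
    and chi_nontrivial: "\<exists>x. \<not> int p dvd x \<and> chi x \<noteq> 1"
begin

lemma p_pos: "p > 0" using p prime_gt_0_nat by blast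

lemma coprime_p: "\<not> int p dvd x \<Longrightarrow> coprime x (int p)"
  using p by (metis coprime_commute prime_imp_coprime prime_nat_int_transfer)

lemma chi_dvd: "int p dvd x \<Longrightarrow> chi x = 0"
  using periodicD[OF chi_periodic, of x 0] chi_0 by (simp add: cong_0_iff)

lemma chi_cube: "\<not> int p dvd x \<Longrightarrow> chi x ^ 3 = 1"
proof -
  assume "\<not> int p dvd x"
  then obtain i where "chi x = om ^ i" using chi_values by blast
  then have "chi x ^ 3 = (om ^ 3) ^ i" by (simp only: power_mult[symmetric] mult.commute)
  then show ?thesis by simp
qed

lemma econj_chi: "econj (chi x) = chi x ^ 2"
  using chi_values[of x] chi_dvd[of x] econj_om_power
  by (cases "int p dvd x") (auto simp: econj_hom)

lemma chi_1: "chi 1 = 1"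
proof -
  have n: "\<not> int p dvd 1" using p by (simp add: prime_nat_iff)
  have "chi 1 = chi 1 ^ 3" using chi_mult[of 1 1] by (simp add: power3_eq_cube)
  then show ?thesis using chi_cube[OF n] by simp
qed

lemma chi_power: "chi (x ^ n) = chi x ^ n"
  by (induction n) (auto simp: chi_1 chi_mult)

lemma chi_minus: "chi (- x) = chi x"
proof -
  have n: "\<not> int p dvd - 1" using p by (simp add: prime_nat_iff)
  have "chi (- 1) * chi (- 1) = 1" using chi_mult[of "-1" "-1"] chi_1 by simp
  then have "chi (- 1) = chi (- 1) ^ 3" by (simp add: power3_eq_cube)
  then have "chi (- 1) = 1" using chi_cube[OF n] by simp
  then show ?thesis using chi_mult[of "-1" x] by simp
qed

lemma sum_chi: "(\<Sum>t\<in>{0..<int p}. chi t) = 0"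
proof -
  obtain x where x: "\<not> int p dvd x" "chi x \<noteq> 1" using chi_nontrivial by blast
  then obtain i where i: "chi x = om ^ i" using chi_values by blast
  let ?S = "\<Sum>t\<in>{0..<int p}. chi t"
  have "chi x * ?S = (\<Sum>t\<in>{0..<int p}. chi (x * t + 0))"
    by (simp add: sum_distrib_left chi_mult)
  also have "\<dots> = ?S"
    by (rule periodic_sum_affine[OF chi_periodic coprime_p[OF x(1)] p_pos])
  finally have *: "(chi x - 1) * ?S = 0" by (simp add: algebra_simps)
  \<comment> \<open>In place of a cancellation law for \<open>eis\<close>: multiplying by the
    conjugate turns the nonzero factor \<open>chi x - 1\<close> into its norm 3, and an integer
    cancels coordinatewise.\<close>
  have "chi x \<in> {1, om, om ^ 2}" using om_power_cases[of i] i by simp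
  then have "enorm (chi x - 1) = 3"
    using x(2) by (auto simp: enorm_def power2_eq_square)
  then have "of_int 3 * ?S = (chi x - 1) * econj (chi x - 1) * ?S"
    using mult_econj[of "chi x - 1"] by simp
  also have "\<dots> = econj (chi x - 1) * ((chi x - 1) * ?S)" by (simp only: ac_simps)
  finally have "of_int 3 * ?S = econj (chi x - 1) * ((chi x - 1) * ?S)" .
  then have "of_int 3 * ?S = 0" unfolding * by simp
  then show ?thesis by (rule of_int_mult_eis_eq_0) simp
qed

lemma sum_chi_square: "(\<Sum>t\<in>{0..<int p}. chi t ^ 2) = 0"
  using arg_cong[OF sum_chi, of econj] by (simp add: econj_sum econj_chi econj_hom)

definition jac :: eis where "jac = (\<Sum>t\<in>{0..<int p}. chi t * chi (1 - t))"

text \<open>The Gauss sum of \<open>chi\<close> with the variable X of the group ring in the role of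
  the root of unity; \<open>gauss'\<close> is the one of the conjugate character.\<close>

definition gauss :: "eis poly" where "gauss = gr p chi"

definition gauss' :: "eis poly" where "gauss' = gr p (\<lambda>x. chi x ^ 2)"

lemma chi2_periodic: "periodic p (\<lambda>x. chi x ^ 2)"
  using chi_periodic by (auto simp: periodic_def)

lemma shift_periodic: "periodic p f \<Longrightarrow> periodic p (\<lambda>s. f (u - s))"
  unfolding periodic_def[of p "\<lambda>s. f (u - s)"]
proof (intro allI)
  fix x assume f: "periodic p f"
  show "f (u - x mod int p) = f (u - x)"
    by (rule periodicD[OF f]) (intro cong_diff, simp_all add: cong_def)
qed

lemma conv_chi_chi: "conv p chi chi u = jac * chi u ^ 2"
proof (cases "int p dvd u")
  case True
  have "chi (u - s) = chi s" for s
  proof -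
    have "chi (u - s) = chi (- s)"
      by (rule periodicD[OF chi_periodic]) (use True in \<open>simp add: cong_iff_dvd_diff\<close>)
    then show ?thesis by (simp add: chi_minus)
  qed
  then show ?thesis using sum_chi_square chi_dvd[OF True]
    by (simp add: conv_def power2_eq_square)
next
  case False
  have per: "periodic p (\<lambda>s. chi s * chi (u - s))"
    using chi_periodic shift_periodic[OF chi_periodic, of u] by (simp add: periodic_def)
  have "conv p chi chi u = (\<Sum>t\<in>{0..<int p}. chi (u * t + 0) * chi (u - (u * t + 0)))"
    unfolding conv_def by (rule periodic_sum_affine[OF per coprime_p[OF False] p_pos, symmetric])
  also have "\<dots> = (\<Sum>t\<in>{0..<int p}. (chi t * chi (1 - t)) * chi u ^ 2)"
  proof (rule sum.cong[OF refl])
    fix t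
    have "u - (u * t + 0) = u * (1 - t)" by (simp add: algebra_simps)
    then show "chi (u * t + 0) * chi (u - (u * t + 0)) = (chi t * chi (1 - t)) * chi u ^ 2"
      by (simp add: chi_mult power2_eq_square)
  qed
  finally show ?thesis by (simp add: jac_def sum_distrib_right)
qed

text \<open>Group ring form of the product of conjugate Gauss sums. Scaling shows that the
  convolution has one value \<open>K\<close> off 0; its total over all \<open>u\<close> is a product
  of two vanishing character sums, which forces \<open>K = - 1\<close>.\<close>

lemma conv_chi_chi2:
  assumes "u \<in> {0..<int p}"
  shows "conv p chi (\<lambda>x. chi x ^ 2) u = (if u = 0 then of_int (int p - 1) else - 1)"
proof -
  let ?R = "{0..<int p}" and ?c = "conv p chi (\<lambda>x. chi x ^ 2)"
  have c0: "?c 0 = of_int (int p - 1)"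
  proof -
    have "?c 0 = (\<Sum>s\<in>?R. chi s ^ 3)"
      by (simp add: conv_def chi_minus power3_eq_cube power2_eq_square mult.assoc)
    also have "\<dots> = (\<Sum>s\<in>?R. if s = 0 then 0 else 1)"
      using chi_cube chi_0 by (intro sum.cong) (auto simp: zdvd_not_zless)
    also have "\<dots> = (\<Sum>s\<in>?R - {0}. 1)" by (intro sum.mono_neutral_cong_right) auto
    also have "\<dots> = of_int (int p - 1)" using p_pos by (simp add: eis_eq_iff)
    finally show ?thesis .
  qed
  define K where "K = (\<Sum>t\<in>?R. chi t * chi (1 - t) ^ 2)"
  have cK: "?c u = K" if "u \<in> ?R" "u \<noteq> 0" for u
  proof -
    have u: "\<not> int p dvd u" using that by (auto simp: zdvd_not_zless)
    have per: "periodic p (\<lambda>s. chi s * chi (u - s) ^ 2)"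
      using chi_periodic shift_periodic[OF chi_periodic, of u] by (simp add: periodic_def)
    have "?c u = (\<Sum>t\<in>?R. chi (u * t + 0) * chi (u - (u * t + 0)) ^ 2)"
      unfolding conv_def by (rule periodic_sum_affine[OF per coprime_p[OF u] p_pos, symmetric])
    also have "\<dots> = (\<Sum>t\<in>?R. chi t * chi (1 - t) ^ 2)"
    proof (rule sum.cong[OF refl])
      fix t
      have "u - (u * t + 0) = u * (1 - t)" by (simp add: algebra_simps)
      then have "chi (u * t + 0) * chi (u - (u * t + 0)) ^ 2 = chi u ^ 3 * (chi t * chi (1 - t) ^ 2)"
        by (simp add: chi_mult power2_eq_square power3_eq_cube ac_simps)
      then show "chi (u * t + 0) * chi (u - (u * t + 0)) ^ 2 = chi t * chi (1 - t) ^ 2"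
        using chi_cube[OF u] by simp
    qed
    finally show ?thesis by (simp add: K_def)
  qed
  have "(\<Sum>u\<in>?R. ?c u) = (\<Sum>s\<in>?R. \<Sum>u\<in>?R. chi s * chi (u - s) ^ 2)"
    unfolding conv_def by (rule sum.swap)
  also have "\<dots> = (\<Sum>s\<in>?R. chi s * (\<Sum>u\<in>?R. chi (1 * u + (- s)) ^ 2))"
    by (simp add: sum_distrib_left)
  also have "\<dots> = 0"
    using periodic_sum_affine[OF chi2_periodic, of 1 "- s" for s] p_pos sum_chi_square by simp
  finally have "?c 0 + (\<Sum>u\<in>?R - {0}. ?c u) = 0"
    using p_pos by (simp add: sum.remove[of ?R 0])
  also have "(\<Sum>u\<in>?R - {0}. ?c u) = (\<Sum>u\<in>?R - {0}. K)" by (intro sum.cong cK) auto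
  also have "\<dots> = of_int (int p - 1) * K" using p_pos by (simp add: of_nat_diff)
  finally have "of_int (int p - 1) * (1 + K) = 0" unfolding c0 by (simp add: algebra_simps)
  moreover have "int p - 1 \<noteq> 0" using prime_gt_1_nat[OF p] by simp
  ultimately have "1 + K = 0" by (rule of_int_mult_eis_eq_0)
  then have "K = - 1" by (simp add: add_eq_0_iff)
  then show ?thesis using c0 cK assms by auto
qed

section \<open>Relations between Gauss and Jacobi sums in the group ring\<close>

abbreviation gcong :: "int \<Rightarrow> eis poly \<Rightarrow> eis poly \<Rightarrow> bool" where
  "gcong n \<equiv> idcong (of_int n) (cyc p)"

lemma gauss_square: "gcong n (gauss * gauss) ([:jac:] * gauss')"
proof -
  have "gcong n (gauss * gauss) (gr p (conv p chi chi))"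
    unfolding gauss_def by (rule gr_mult[OF chi_periodic p_pos])
  then show ?thesis by (simp add: conv_chi_chi gauss'_def gr_scale cong: gr_cong)
qed

lemma gauss_gauss': "gcong n (gauss * gauss') (gr p (\<lambda>u. if u = 0 then of_int (int p - 1) else - 1))"
proof -
  have "gcong n (gauss * gauss') (gr p (conv p chi (\<lambda>x. chi x ^ 2)))"
    unfolding gauss_def gauss'_def by (rule gr_mult[OF chi2_periodic p_pos])
  moreover have "gr p (conv p chi (\<lambda>x. chi x ^ 2))
      = gr p (\<lambda>u. if u = 0 then of_int (int p - 1) else - 1)"
    by (intro gr_cong) (simp add: conv_chi_chi2)
  ultimately show ?thesis by simp
qed

text \<open>The product \<open>gauss * gauss'\<close> is p minus the sum of all group elements, not
  p itself. The unwanted sum is annihilated by a further factor \<open>gauss\<close>, because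
  \<open>chi\<close> sums to 0. For this reason all identities below carry a spare factor
  \<open>gauss\<close>: the classical g^3 = p J appears as a formula for g^4.\<close>

lemma gauss_square_gauss': "gcong n (gauss * gauss' * gauss) ([:of_int (int p):] * gauss)"
proof -
  define h where "h = (\<lambda>u::int. if u = 0 then of_int (int p - 1) else - 1 :: eis)"
  have "gcong n (gauss * gauss' * gauss) (gr p h * gauss)"
    using gauss_gauss' idcong_mult idcong_refl unfolding h_def by blast
  also have "gcong n \<dots> (gr p (conv p h chi))"
    unfolding gauss_def by (rule gr_mult[OF chi_periodic p_pos])
  also have "conv p h chi u = of_int (int p) * chi u" for u
  proof -
    have "conv p h chi u = (\<Sum>s\<in>{0..<int p}. (if s = 0 then of_int (int p) * chi u else 0) - chi (- 1 * s + u))"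
      unfolding conv_def h_def by (intro sum.cong) (auto simp: algebra_simps)
    also have "\<dots> = of_int (int p) * chi u - (\<Sum>s\<in>{0..<int p}. chi (- 1 * s + u))"
      unfolding sum_subtractf using p_pos by simp
    also have "(\<Sum>s\<in>{0..<int p}. chi (- 1 * s + u)) = 0"
      using periodic_sum_affine[OF chi_periodic _ p_pos, of "-1" u] sum_chi by simp
    finally show ?thesis by simp
  qed
  then have "gr p (conv p h chi) = [:of_int (int p):] * gauss"
    by (simp add: gauss_def gr_scale cong: gr_cong)
  finally show ?thesis by simp
qed

lemma gauss_power4: "gcong n (gauss ^ 4) ([:of_int (int p) * jac:] * gauss)"
proof -
  have "gauss ^ 4 = gauss * gauss * (gauss * gauss)" by (simp add: power4_eq_xxxx mult.assoc)
  also have "gcong n \<dots> (([:jac:] * gauss') * (gauss * gauss))"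
    by (intro idcong_mult gauss_square idcong_refl)
  also have "([:jac:] * gauss') * (gauss * gauss) = [:jac:] * (gauss * gauss' * gauss)"
    by (simp only: ac_simps)
  also have "gcong n \<dots> ([:jac:] * ([:of_int (int p):] * gauss))"
    by (intro idcong_scale gauss_square_gauss')
  also have "[:jac:] * ([:of_int (int p):] * gauss) = [:of_int (int p) * jac:] * gauss"
    by (simp add: mult.commute)
  finally show ?thesis .
qed

lemma gauss'_square: "gcong n (gauss' * gauss') ([:econj jac:] * gauss)"
proof -
  have "conv p (\<lambda>x. chi x ^ 2) (\<lambda>x. chi x ^ 2) u = econj jac * chi u" for u
  proof -
    have "conv p (\<lambda>x. chi x ^ 2) (\<lambda>x. chi x ^ 2) u = econj (conv p chi chi u)"
      by (simp add: conv_def econj_sum econj_hom econj_chi)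
    also have "\<dots> = econj jac * econj (econj (chi u))"
      unfolding conv_chi_chi by (simp add: econj_hom econj_chi)
    finally show ?thesis by (simp add: econj_hom)
  qed
  then show ?thesis
    using gr_mult[OF chi2_periodic p_pos, of "of_int n" "\<lambda>x. chi x ^ 2"]
    by (simp add: gauss'_def gauss_def gr_scale cong: gr_cong)
qed

text \<open>Removes the spare factor: the coefficient of \<open>gauss\<close> at X^1 is
  \<open>chi 1 = 1\<close>.\<close>

lemma gauss_coeff_cong:
  assumes "gcong n ([:a:] * gauss) ([:b:] * gauss)"
  shows "idcong (of_int n) 0 a b"
proof -
  have "idcong (of_int n) 0 (a * chi (int 1)) (b * chi (int 1))"
    using assms prime_gt_1_nat[OF p] unfolding gauss_def
    by (intro gr_inject[of n p "\<lambda>t. a * chi t" "\<lambda>t. b * chi t" 1]) (auto simp: gr_scale)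
  then show ?thesis by (simp add: chi_1)
qed

theorem enorm_jac: "enorm jac = int p"
proof -
  \<comment> \<open>A congruence modulo 0 is an exact identity modulo X^p - 1.\<close>
  have "gcong 0 ([:of_int (int p):] * gauss) (gauss * gauss' * gauss)"
    by (rule idcong_sym[OF gauss_square_gauss'])
  also have "gauss * gauss' * gauss = gauss * gauss * gauss'" by (simp only: ac_simps)
  also have "gcong 0 \<dots> ([:jac:] * gauss' * gauss')" by (intro idcong_mult gauss_square idcong_refl)
  also have "[:jac:] * gauss' * gauss' = [:jac:] * (gauss' * gauss')" by (simp only: ac_simps)
  also have "gcong 0 \<dots> ([:jac:] * ([:econj jac:] * gauss))" by (intro idcong_scale gauss'_square)
  also have "[:jac:] * ([:econj jac:] * gauss) = [:jac * econj jac:] * gauss"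
    by (simp add: mult.commute)
  finally have "idcong (of_int 0) 0 (of_int (int p)) (jac * econj jac)" by (rule gauss_coeff_cong)
  then have "of_int (int p) = (of_int (enorm jac) :: eis)"
    by (simp add: idcong_zero_iff mult_econj)
  then show ?thesis by (simp add: eis_eq_iff)
qed

lemma gauss_frobenius:
  assumes q: "prime q"
  shows "gcong (int q) (gr p f ^ q) (\<Sum>t\<in>{0..<int p}. monom (f t ^ q) (q * nat t))"
proof -
  have "gcong (int q) (gr p f ^ q) (\<Sum>t\<in>{0..<int p}. monom (f t) (nat t) ^ q)"
    using prime_power_sum_idcong[OF q, where 'a = "eis poly"] unfolding gr_def by simp
  then show ?thesis by (simp add: monom_power mult.commute)
qed

text \<open>The cube of the Gauss sum is computed in two ways modulo 3. Frobenius turns it into the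
  sum of all X^t with t nonzero, since 3 is invertible modulo \<open>p\<close>; the Gauss sum
  relations give \<open>jac\<close> times the function with value -1 off 0. Comparing coefficients
  at X^1 gives the claim, which later singles out one of six associates.\<close>

theorem jac_mod_3: "idcong (of_int 3) 0 jac (- 1)"
proof -
  define h where "h = (\<lambda>u::int. if u = 0 then of_int (int p - 1) else - 1 :: eis)"
  have "gcong 3 (gauss ^ 3) (\<Sum>t\<in>{0..<int p}. monom (chi t ^ 3) (3 * nat t))"
    unfolding gauss_def using gauss_frobenius[of 3 chi] by simp
  also have "(\<Sum>t\<in>{0..<int p}. monom (chi t ^ 3) (3 * nat t))
      = (\<Sum>t\<in>{0..<int p}. monom (if t = 0 then 0 else 1) (3 * nat t))"
    using chi_cube chi_0 by (intro sum.cong) (auto simp: zdvd_not_zless)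
  finally have 1: "gcong 3 (gauss ^ 3) (\<Sum>t\<in>{0..<int p}. monom (if t = 0 then 0 else 1) (3 * nat t))" .
  have "gauss ^ 3 = gauss * gauss * gauss" by (simp add: power3_eq_cube)
  also have "gcong 3 \<dots> ([:jac:] * gauss' * gauss)" by (intro idcong_mult gauss_square idcong_refl)
  also have "[:jac:] * gauss' * gauss = [:jac:] * (gauss * gauss')" by (simp only: ac_simps)
  also have "gcong 3 \<dots> ([:jac:] * gr p h)"
    unfolding h_def by (intro idcong_scale gauss_gauss')
  finally have 2: "gcong 3 (gauss ^ 3) ([:jac:] * gr p h)" .
  have c: "coprime 3 (int p)"
  proof -
    have "coprime 3 p" using p p_not_3 by (intro primes_coprime) auto
    then show ?thesis by (metis coprime_int_iff of_nat_numeral)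
  qed
    have "gcong 3 (\<Sum>t\<in>{0..<int p}. monom (if t = 0 then 0 else 1) (3 * nat t))
       (\<Sum>t\<in>{0..<int p}. monom (if t = 0 then 0 else 1) (nat ((3 * t + 0) mod int p)))"
      by (intro idcong_sum monom_idcong_periodic) (use p_pos in auto)
    also have "(\<Sum>t\<in>{0..<int p}. monom (if t = 0 then 0 else 1) (nat ((3 * t + 0) mod int p)))
       = (\<Sum>t\<in>{0..<int p}. monom (if (3 * t + 0) mod int p = 0 then 0 else 1 :: eis) (nat ((3 * t + 0) mod int p)))"
    proof (intro sum.cong refl arg_cong2[where f = monom] if_cong)
      fix t assume "t \<in> {0..<int p}"
      moreover have "int p dvd 3 * t \<longleftrightarrow> int p dvd t"
        using c by (simp add: coprime_commute coprime_dvd_mult_right_iff)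
      ultimately show "t = 0 \<longleftrightarrow> (3 * t + 0) mod int p = 0"
        by (cases "t = 0") (auto simp: mod_eq_0_iff_dvd zdvd_not_zless)
    qed
    also have "\<dots> = gr p (\<lambda>t. if t = 0 then 0 else 1)"
      unfolding gr_def by (rule sum.reindex_bij_betw[OF bij_betw_affine_mod[OF c p_pos]])
    finally have "gcong 3 ([:jac:] * gr p h) (gr p (\<lambda>t. if t = 0 then 0 else 1))"
      using idcong_trans[OF idcong_sym[OF 2] idcong_trans[OF 1]] by blast
    then have "gcong 3 (gr p (\<lambda>t. jac * h t)) (gr p (\<lambda>t. if t = 0 then 0 else 1))"
      by (simp only: gr_scale)
    then have "idcong (of_int 3) 0 (jac * h (int 1)) (if int 1 = 0 then 0 else 1)"
      by (rule gr_inject) (rule prime_gt_1_nat[OF p])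
    then have "idcong (of_int 3) 0 (- jac) 1" by (simp add: h_def)
    then show ?thesis using idcong_uminus[of "of_int 3" 0 "- jac" 1] by simp
qed

text \<open>Cubic reciprocity from g^(q^2) modulo \<open>q\<close>. Applying Frobenius twice moves
  the term at t to q^2 t and keeps its coefficient, because q^2 is 1 modulo 3; as chi(t) = chi(q)^3
  chi(t) = chi(q) chi(q^2 t), the result is \<open>chi (int q)\<close> times g. On the other side,
  writing q^2 = 3k + 1, the relation for g^4 gives (p J)^k times g.\<close>

theorem jac_reciprocity:
  assumes q: "prime q" "q \<noteq> 3" "q \<noteq> p"
  shows "idcong (of_int (int q)) 0 ((of_int (int p) * jac) ^ ((q\<^sup>2 - 1) div 3)) (chi (int q))"
proof -
  let ?R = "{0..<int p}"
  define k where "k = (q\<^sup>2 - 1) div 3"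
  have q1: "q > 1" using q prime_gt_1_nat by blast
  have "\<not> 3 dvd q" using q primes_dvd_imp_eq[of 3 q] by auto
  then have "q mod 3 = 1 \<or> q mod 3 = 2" by presburger
  then have "q\<^sup>2 mod 3 = 1" by (auto simp: power2_eq_square mod_mult_eq[of q 3 q, symmetric])
  then have K: "q\<^sup>2 = 3 * k + 1" unfolding k_def by presburger
  have cq: "\<not> int p dvd int q" using q p primes_dvd_imp_eq[of p q] by auto
  have chi_q2: "chi t ^ q\<^sup>2 = chi t" for t
    by (cases "int p dvd t") (simp_all add: chi_dvd K power_mult chi_cube)
  have "gcong (int q) (gauss ^ q\<^sup>2) ((\<Sum>t\<in>?R. monom (chi t ^ q) (q * nat t)) ^ q)"
    unfolding power2_eq_square power_mult gauss_def by (intro idcong_power gauss_frobenius q)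
  also have "gcong (int q) \<dots> (\<Sum>t\<in>?R. monom (chi t ^ q) (q * nat t) ^ q)"
    using prime_power_sum_idcong[OF q(1), where 'a = "eis poly"] by simp
  also have "(\<Sum>t\<in>?R. monom (chi t ^ q) (q * nat t) ^ q) = (\<Sum>t\<in>?R. monom (chi t) (q\<^sup>2 * nat t))"
    using chi_q2 by (simp add: monom_power power2_eq_square ac_simps flip: power_mult)
  also have "gcong (int q) \<dots> (\<Sum>t\<in>?R. monom (chi t) (nat (((int q)\<^sup>2 * t + 0) mod int p)))"
    by (intro idcong_sum monom_idcong_periodic) (use p_pos in auto)
  also have "(\<Sum>t\<in>?R. monom (chi t) (nat (((int q)\<^sup>2 * t + 0) mod int p)))
      = (\<Sum>t\<in>?R. monom (chi (int q) * chi (((int q)\<^sup>2 * t + 0) mod int p)) (nat (((int q)\<^sup>2 * t + 0) mod int p)))"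
  proof (intro sum.cong refl arg_cong2[where f = monom])
    fix t
    have "chi (int q) * chi (((int q)\<^sup>2 * t + 0) mod int p) = chi (int q) * chi ((int q)\<^sup>2 * t)"
      using chi_periodic by (simp add: periodic_def)
    also have "\<dots> = chi (int q) ^ 3 * chi t"
      by (simp add: chi_mult power2_eq_square power3_eq_cube mult.assoc)
    finally show "chi t = chi (int q) * chi (((int q)\<^sup>2 * t + 0) mod int p)"
      by (simp add: chi_cube[OF cq])
  qed
  also have "\<dots> = gr p (\<lambda>t. chi (int q) * chi t)"
    unfolding gr_def
    by (rule sum.reindex_bij_betw[OF bij_betw_affine_mod[OF _ p_pos]])
       (use coprime_p[OF cq] in simp)
  also have "\<dots> = [:chi (int q):] * gauss" by (simp add: gauss_def gr_scale)
  finally have 1: "gcong (int q) (gauss ^ q\<^sup>2) ([:chi (int q):] * gauss)" .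
  have "gcong (int q) (gauss ^ (3 * k + 1)) ([:(of_int (int p) * jac) ^ k:] * gauss)" for k
  proof (induction k)
    case (Suc k)
    have "gauss ^ (3 * Suc k + 1) = gauss ^ 3 * gauss ^ (3 * k + 1)"
      unfolding power_add[symmetric] by (rule arg_cong[where f = "power gauss"]) simp
    also have "gcong (int q) \<dots> (gauss ^ 3 * ([:(of_int (int p) * jac) ^ k:] * gauss))"
      using Suc.IH by (rule idcong_scale)
    also have "gauss ^ 3 * ([:(of_int (int p) * jac) ^ k:] * gauss)
        = [:(of_int (int p) * jac) ^ k:] * gauss ^ 4"
      by (simp add: power4_eq_xxxx power3_eq_cube)
    also have "gcong (int q) \<dots> ([:(of_int (int p) * jac) ^ k:] * ([:of_int (int p) * jac:] * gauss))"
      by (rule idcong_scale[OF gauss_power4])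
    also have "[:(of_int (int p) * jac) ^ k:] * ([:of_int (int p) * jac:] * gauss)
        = [:(of_int (int p) * jac) ^ Suc k:] * gauss"
      by (simp add: mult.commute)
    finally show ?case .
  qed (simp flip: one_pCons)
  then have "gcong (int q) (gauss ^ q\<^sup>2) ([:(of_int (int p) * jac) ^ k:] * gauss)"
    unfolding K .
  then have "gcong (int q) ([:(of_int (int p) * jac) ^ k:] * gauss) ([:chi (int q):] * gauss)"
    using 1 idcong_sym idcong_trans by blast
  then show ?thesis unfolding k_def by (rule gauss_coeff_cong)
qed

end

section \<open>Power sums modulo a prime\<close>

lemma coprime_prime_int:
  assumes "prime p" "\<not> int p dvd a" shows "coprime a (int p)"
  using assms by (metis coprime_commute prime_imp_coprime prime_nat_int_transfer)

lemma prime_residue_nat: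
  assumes "prime p" "\<not> int p dvd x"
  obtains y where "[x = int y] (mod int p)" "coprime y p" "0 < y" "y < p"
proof
  let ?y = "nat (x mod int p)"
  have p0: "p > 0" using assms(1) prime_gt_0_nat by blast
  then have y: "int ?y = x mod int p" by simp
  show c: "[x = int ?y] (mod int p)" unfolding y by (simp add: cong_def)
  show lt: "?y < p" using p0 by (simp add: nat_less_iff)
  have "\<not> p dvd ?y" using c assms(2) by (metis cong_dvd_iff int_dvd_int_iff)
  then show "coprime ?y p" using assms(1) by (metis coprime_commute prime_imp_coprime)
  show "0 < ?y" using \<open>\<not> p dvd ?y\<close> by (cases ?y) auto
qed

lemma fermat_int:
  assumes "prime p" "\<not> int p dvd a" shows "[a ^ (p - 1) = 1] (mod int p)"
proof -
  obtain y where y: "[a = int y] (mod int p)" "coprime y p"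
    using prime_residue_nat[OF assms] by blast
  have "[y ^ (p - 1) = 1] (mod p)"
    using euler_theorem[OF y(2)] totient_prime[OF assms(1)] by simp
  then have "[int y ^ (p - 1) = 1] (mod int p)" by (metis cong_int_iff int_ops(2) of_nat_power)
  then show ?thesis using cong_pow[OF y(1), of "p - 1"] cong_trans by blast
qed

lemma primitive_root_exists:
  assumes "prime p"
  obtains g :: int where "\<not> int p dvd g" "\<And>j. [g ^ j = 1] (mod int p) \<longleftrightarrow> p - 1 dvd j"
    "\<And>x. \<not> int p dvd x \<Longrightarrow> \<exists>i. [x = g ^ i] (mod int p)"
proof -
  have p1: "p > 1" using assms prime_gt_1_nat by blast
  obtain g where g: "residue_primroot p g"
    using prime_primitive_root_exists[OF p1 assms] by blast
  have cop: "coprime p g" and ord: "ord p g = p - 1"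
    using g assms by (auto simp: residue_primroot_def totient_prime)
  show thesis
  proof (rule that[of "int g"])
    have "\<not> p dvd g" using cop p1 by (auto simp: coprime_absorb_left)
    then show "\<not> int p dvd int g" by simp
    show "[int g ^ j = 1] (mod int p) \<longleftrightarrow> p - 1 dvd j" for j
      using ord_divides[of g j p] ord by (metis cong_int_iff int_ops(2) of_nat_power)
    show "\<exists>i. [x = int g ^ i] (mod int p)" if x: "\<not> int p dvd x" for x
    proof -
      obtain y where y: "[x = int y] (mod int p)" "coprime y p" "0 < y" "y < p"
        using prime_residue_nat[OF assms x] by blast
      then have "y \<in> totatives p" by (simp add: in_totatives_iff)
      then have "y \<in> (\<lambda>i. g ^ i mod p) ` {..<totient p}"
        using bij_betw_imp_surj_on[OF residue_primroot_is_generator[OF p1 g]] by simp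
      then obtain i where "g ^ i mod p = y" by blast
      then have "[g ^ i = y] (mod p)" using y(4) by (simp add: cong_def)
      then have "[int g ^ i = int y] (mod int p)" by (metis cong_int_iff of_nat_power)
      then show ?thesis using y(1) cong_sym cong_trans by blast
    qed
  qed
qed

text \<open>The condition \<open>j > 0\<close> accounts for 0 ^ 0 = 1: for \<open>j = 0\<close> the
  sum is \<open>p\<close>. If p - 1 does not divide \<open>j\<close>, scaling by a primitive root
  shows that the sum vanishes.\<close>

lemma power_sum_mod_prime:
  assumes p: "prime p"
  shows "[(\<Sum>t\<in>{0..<int p}. t ^ j) = (if j > 0 \<and> p - 1 dvd j then - 1 else 0)] (mod int p)"
proof -
  let ?R = "{0..<int p}"
  have p0: "p > 0" and p1: "p > 1" using p prime_gt_0_nat prime_gt_1_nat by auto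
  obtain g where g: "\<not> int p dvd g" "\<And>j. [g ^ j = 1] (mod int p) \<longleftrightarrow> p - 1 dvd j"
    using primitive_root_exists[OF p] by metis
  show ?thesis
  proof (cases "p - 1 dvd j")
    case True
    show ?thesis
    proof (cases "j = 0")
      case False
      have "[(\<Sum>t\<in>?R. t ^ j) = (\<Sum>t\<in>?R. if t = 0 then 0 else 1)] (mod int p)"
      proof (rule cong_sum)
        fix t assume t: "t \<in> ?R"
        show "[t ^ j = (if t = 0 then 0 else 1)] (mod int p)"
        proof (cases "t = 0")
          case f: False
          obtain m where m: "j = (p - 1) * m" using True by blast
          have "\<not> int p dvd t" using t f by (simp add: zdvd_not_zless)
          then have "[(t ^ (p - 1)) ^ m = 1 ^ m] (mod int p)" by (intro cong_pow fermat_int p)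
          then show ?thesis using f by (simp add: m power_mult)
        qed (use False in \<open>simp add: zero_power\<close>)
      qed
      also have "(\<Sum>t\<in>?R. if t = 0 then 0 else 1) = (\<Sum>t\<in>?R - {0}. 1 :: int)"
        by (intro sum.mono_neutral_cong_right) auto
      also have "\<dots> = int p - 1" using p0 by simp
      also have "[int p - 1 = - 1] (mod int p)" by (simp add: cong_iff_dvd_diff)
      finally show ?thesis using True False by simp
    qed (simp add: cong_0_iff)
  next
    case False
    let ?S = "\<Sum>t\<in>?R. t ^ j"
    have cg: "coprime g (int p)"
      using p g(1) by (rule coprime_prime_int)
    have "g ^ j * ?S = (\<Sum>t\<in>?R. (g * t + 0) ^ j)"
      by (simp add: sum_distrib_left power_mult_distrib)
    also have "[\<dots> = (\<Sum>t\<in>?R. ((g * t + 0) mod int p) ^ j)] (mod int p)"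
      by (intro cong_sum cong_pow) (simp add: cong_def)
    also have "(\<Sum>t\<in>?R. ((g * t + 0) mod int p) ^ j) = ?S"
      by (rule sum.reindex_bij_betw[OF bij_betw_affine_mod[OF cg p0]])
    finally have "int p dvd (g ^ j - 1) * ?S" by (simp add: cong_iff_dvd_diff algebra_simps)
    moreover have "\<not> int p dvd g ^ j - 1" using g(2) False by (simp add: cong_iff_dvd_diff)
    ultimately have "int p dvd ?S" using p by (metis prime_dvd_mult_iff prime_nat_int_transfer)
    then show ?thesis using False by (simp add: cong_0_iff)
  qed
qed

lemma poly_sum_mod_prime:
  fixes f :: "int poly"
  assumes "prime p" "degree f < p - 1"
  shows "[(\<Sum>t\<in>{0..<int p}. poly f t) = 0] (mod int p)"
proof -
  have "(\<Sum>t\<in>{0..<int p}. poly f t) = (\<Sum>i\<le>degree f. coeff f i * (\<Sum>t\<in>{0..<int p}. t ^ i))"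
    unfolding poly_altdef by (subst sum.swap) (simp add: sum_distrib_left)
  also have "[\<dots> = (\<Sum>i\<le>degree f. coeff f i * 0)] (mod int p)"
  proof (intro cong_sum cong_mult cong_refl)
    fix i assume "i \<in> {..degree f}"
    then have "\<not> (i > 0 \<and> p - 1 dvd i)" using assms(2) by (auto dest: dvd_imp_le)
    then show "[(\<Sum>t\<in>{0..<int p}. t ^ i) = 0] (mod int p)"
      using power_sum_mod_prime[OF assms(1), of i] by (simp split: if_splits)
  qed
  finally show ?thesis by simp
qed

text \<open>After binomial expansion only exponents \<open>e * j\<close> that are positive multiples
  of p - 1 survive, and the bound on \<open>h * e\<close> leaves p - 1 itself, that is
  \<open>j = m\<close>.\<close>

lemma sum_binomial_mod_prime:
  fixes D c :: int
  assumes p: "prime p" and m: "m * e = p - 1" and e: "e > 0" and h: "h * e < 2 * (p - 1)"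
  shows "[(\<Sum>t\<in>{0..<int p}. (c * t ^ e + D) ^ h) = - (int (h choose m) * c ^ m * D ^ (h - m))] (mod int p)"
proof -
  let ?R = "{0..<int p}"
  have p1: "p - 1 > 0" using p prime_gt_1_nat[of p] by simp
  have m0: "m > 0" using m p1 by (cases m) auto
  have "(\<Sum>t\<in>?R. (c * t ^ e + D) ^ h)
      = (\<Sum>t\<in>?R. \<Sum>j\<le>h. int (h choose j) * c ^ j * D ^ (h - j) * t ^ (e * j))"
    unfolding binomial_ring power_mult_distrib power_mult by (simp add: mult_ac)
  also have "\<dots> = (\<Sum>j\<le>h. int (h choose j) * c ^ j * D ^ (h - j) * (\<Sum>t\<in>?R. t ^ (e * j)))"
    by (subst sum.swap) (simp add: sum_distrib_left)
  also have "[\<dots> = (\<Sum>j\<le>h. int (h choose j) * c ^ j * D ^ (h - j) * (if j = m then - 1 else 0))] (mod int p)"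
  proof (intro cong_sum cong_mult cong_refl)
    fix j assume "j \<in> {..h}"
    have "(e * j > 0 \<and> p - 1 dvd e * j) \<longleftrightarrow> j = m"
    proof
      assume a: "e * j > 0 \<and> p - 1 dvd e * j"
      then obtain r where r: "e * j = (p - 1) * r" by blast
      have "e * j \<le> h * e" using \<open>j \<in> {..h}\<close> by simp
      then have "(p - 1) * r < (p - 1) * 2" using h unfolding r by (simp only: mult.commute)
      then have "r < 2" by (simp only: mult_less_cancel1)
      moreover have "r \<noteq> 0" using a r by auto
      ultimately have "r = 1" by simp
      then have "e * j = e * m" using r m by (simp add: mult.commute)
      then show "j = m" using e by simp
    qed (use m e m0 p1 in \<open>auto simp: mult.commute\<close>)
    then show "[(\<Sum>t\<in>?R. t ^ (e * j)) = (if j = m then - 1 else 0)] (mod int p)"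
      using power_sum_mod_prime[OF p, of "e * j"] by simp
  qed
  also have "(\<Sum>j\<le>h. int (h choose j) * c ^ j * D ^ (h - j) * (if j = m then - 1 else 0))
      = - (int (h choose m) * c ^ m * D ^ (h - m))"
  proof -
    have "(\<Sum>j\<le>h. int (h choose j) * c ^ j * D ^ (h - j) * (if j = m then - 1 else 0))
       = (\<Sum>j\<le>h. if j = m then - (int (h choose j) * c ^ j * D ^ (h - j)) else 0)"
      by (intro sum.cong) auto
    then show ?thesis by (simp add: sum.delta binomial_eq_0)
  qed
  finally show ?thesis .
qed

text \<open>Modulo \<open>p = 6 n + 1\<close> one has \<open>4 n - i \<equiv> - (2 n + 1 + i)\<close>.\<close>

lemma binomial_mod_prime:
  assumes p: "prime p" "p = 6 * n + 1"
  shows "[int ((4 * n) choose n) = (- 1) ^ n * int ((3 * n) choose n)] (mod int p)"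
proof -
  have b: "int (m choose n) * int (fact n) = (\<Prod>i<n. int m - int i)" if "n \<le> m" for m
  proof -
    have "(\<Prod>i<k. m - i) * fact (m - k) = fact m" if "k \<le> m" for k
      using that
    proof (induction k)
      case (Suc k)
      then have "fact (m - k) = (m - k) * fact (m - Suc k)"
        by (metis Suc_diff_Suc Suc_le_lessD fact_Suc of_nat_id)
      then show ?case using Suc by (simp add: mult.assoc)
    qed simp
    then have "(\<Prod>i<n. m - i) * fact (m - n) = fact n * (m choose n) * fact (m - n)"
      using that binomial_fact_lemma[of n m] by (simp add: mult_ac)
    then have "fact n * (m choose n) = (\<Prod>i<n. m - i)" by simp
    then have "int (fact n * (m choose n)) = (\<Prod>i<n. int (m - i))" by simp
    also have "\<dots> = (\<Prod>i<n. int m - int i)" using that by (intro prod.cong) (auto simp: of_nat_diff)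
    finally show ?thesis by (simp add: mult.commute)
  qed
  have "int ((4 * n) choose n) * int (fact n) = (\<Prod>i<n. int (4 * n) - int i)" by (rule b) simp
  also have "[\<dots> = (\<Prod>i<n. - 1 * (int (3 * n) - int (n - Suc i)))] (mod int p)"
  proof (intro cong_prod)
    fix i assume "i \<in> {..<n}"
    then have "int (4 * n) - int i - (- 1 * (int (3 * n) - int (n - Suc i))) = int p"
      by (simp add: p(2) of_nat_diff)
    then show "[int (4 * n) - int i = - 1 * (int (3 * n) - int (n - Suc i))] (mod int p)"
      by (simp only: cong_iff_dvd_diff) simp
  qed
  also have "(\<Prod>i<n. - 1 * (int (3 * n) - int (n - Suc i))) = (- 1) ^ n * (\<Prod>i<n. int (3 * n) - int (n - Suc i))"
    by (simp only: prod.distrib prod_constant card_lessThan)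
  also have "(\<Prod>i<n. int (3 * n) - int (n - Suc i)) = (\<Prod>i<n. int (3 * n) - int i)"
    by (rule prod.nat_diff_reindex)
  also have "\<dots> = int ((3 * n) choose n) * int (fact n)" by (rule b[symmetric]) simp
  finally have "[int ((4 * n) choose n) * int (fact n) = ((- 1) ^ n * int ((3 * n) choose n)) * int (fact n)] (mod int p)"
    by (simp add: mult.assoc)
  moreover have "coprime (int (fact n)) (int p)"
  proof -
    have "\<not> p dvd fact n" using p by (simp add: prime_dvd_fact_iff)
    then show ?thesis using p(1) by (metis coprime_commute coprime_int_iff prime_imp_coprime)
  qed
  ultimately show ?thesis using cong_mult_rcancel by blast
qed

section \<open>The cubic residue character and the curves \<open>y\<^sup>2 = x\<^sup>3 + D\<close>\<close>

text \<open>The two reductions of \<open>y\<close> differ by \<open>eim y * (1 + 2 * w)\<close>, and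
  the square of 1 + 2w is -3, a unit modulo \<open>q\<close>. This is the injectivity part of the
  Chinese remainder theorem for the two primes above a split \<open>q\<close>.\<close>

lemma ered_both_zero:
  fixes q :: int
  assumes q: "prime q" "\<not> q dvd 3" and w: "[w\<^sup>2 + w + 1 = 0] (mod q)"
    and y: "[ered w y = 0] (mod q)" "[ered w (econj y) = 0] (mod q)"
  shows "of_int q dvd y"
proof -
  have 1: "q dvd ere y + eim y * w" and 2: "q dvd ere y - eim y - eim y * w"
    and w2: "q dvd w * w + w + 1"
    using w y by (simp_all add: ered_def cong_0_iff power2_eq_square)
  have "q dvd (ere y + eim y * w - (ere y - eim y - eim y * w)) * (1 + 2 * w) - 4 * eim y * (w * w + w + 1)"
    by (rule dvd_diff[OF dvd_mult2[OF dvd_diff[OF 1 2]] dvd_mult[OF w2]])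
  also have "(ere y + eim y * w - (ere y - eim y - eim y * w)) * (1 + 2 * w) - 4 * eim y * (w * w + w + 1) = - (3 * eim y)"
    by (simp add: algebra_simps)
  finally have "q dvd 3 * eim y" by simp
  then have i: "q dvd eim y" using q prime_dvd_multD by blast
  then have "q dvd ere y" using 1 by (simp add: dvd_add_left_iff)
  then show ?thesis using i unfolding of_int_dvd_eis_iff by blast
qed

text \<open>The root \<open>w\<close> selects one of the two primes of Z[om] above \<open>p\<close>.
  With \<open>p = 6 n + 1\<close> the exponents of the cubic and the quadratic residue criterion are
  \<open>2 * n\<close> and \<open>3 * n\<close>.\<close>

locale cubic_residue =
  fixes p n :: nat and w :: int
  assumes prime_p: "prime p" and p_eq: "p = 6 * n + 1" and w: "[w\<^sup>2 + w + 1 = 0] (mod int p)"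
begin

lemma n_pos: "n > 0" using prime_p p_eq by (cases n) auto

lemma prime_int_p: "prime (int p)" using prime_p by simp

lemma p_not_dvd_small: "0 < c \<Longrightarrow> c < 7 \<Longrightarrow> \<not> int p dvd c"
  using n_pos p_eq by (auto dest!: zdvd_imp_le)

lemma ered_om_power: "[ered w (om ^ i) = w ^ i] (mod int p)"
  using ered_power[OF w, of om i] by simp

lemma ered_om_power_inject:
  assumes "[ered w (om ^ i) = ered w (om ^ j)] (mod int p)" shows "om ^ i = om ^ j"
proof -
  have d: "int p dvd ered w (om ^ i) - ered w (om ^ j)" using assms by (simp add: cong_iff_dvd_diff)
  have w2: "int p dvd w * w + w + 1" using w by (simp add: cong_0_iff power2_eq_square)
  have n3: "\<not> int p dvd 3" by (rule p_not_dvd_small) simp_all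
  have "\<not> int p dvd w - 1"
  proof
    assume "int p dvd w - 1"
    then have "int p dvd (w * w + w + 1) - (w - 1) * (w + 2)" by (rule dvd_diff[OF w2 dvd_mult2])
    then show False using n3 by (simp add: algebra_simps)
  qed
  moreover have "\<not> int p dvd w + 2"
  proof
    assume "int p dvd w + 2"
    then have "int p dvd (w * w + w + 1) - (w + 2) * (w - 1)" by (rule dvd_diff[OF w2 dvd_mult2])
    then show False using n3 by (simp add: algebra_simps)
  qed
  moreover have "\<not> int p dvd 1 + 2 * w"
  proof
    assume "int p dvd 1 + 2 * w"
    then have "int p dvd 4 * (w * w + w + 1) - (1 + 2 * w) * (1 + 2 * w)"
      by (rule dvd_diff[OF dvd_mult[OF w2] dvd_mult2])
    then show False using n3 by (simp add: algebra_simps)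
  qed
  ultimately have *: "\<not> int p dvd w - 1" "\<not> int p dvd 1 - w" "\<not> int p dvd w + 2" "\<not> int p dvd - 2 - w"
     "\<not> int p dvd 1 + 2 * w" "\<not> int p dvd - 1 - 2 * w" "\<not> int p dvd 2 + w"
     "\<not> int p dvd 2 * w + 1" "\<not> int p dvd - (2 * w) - 1"
    by (metis add.commute dvd_minus_iff minus_diff_eq minus_add_distrib add_uminus_conv_diff uminus_add_conv_diff)+
  have e: "ered w 1 = 1" "ered w om = w" "ered w (om ^ 2) = - 1 - w"
    by (simp_all add: om_square ered_def)
  show ?thesis
    using om_power_cases[of i] om_power_cases[of j] d * by (auto simp: e)
qed

lemma cube_root_of_unity_cases:
  assumes "[y ^ 3 = 1] (mod int p)" shows "\<exists>i. [y = ered w (om ^ i)] (mod int p)"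
proof -
  have w2: "int p dvd w * w + w + 1" using w by (simp add: cong_0_iff power2_eq_square)
  have "int p dvd y ^ 3 - 1" using assms by (simp add: cong_iff_dvd_diff)
  then have "int p dvd (y ^ 3 - 1) - (y - 1) * (w * w + w + 1)" by (rule dvd_diff[OF _ dvd_mult[OF w2]])
  also have "(y ^ 3 - 1) - (y - 1) * (w * w + w + 1) = (y - 1) * ((y - w) * (y - (- 1 - w)))"
    by (simp add: algebra_simps power3_eq_cube)
  finally have "int p dvd y - 1 \<or> int p dvd y - w \<or> int p dvd y - (- 1 - w)"
    using prime_int_p by (simp add: prime_dvd_mult_iff)
  then have "[y = ered w (om ^ 0)] (mod int p) \<or> [y = ered w (om ^ 1)] (mod int p)
     \<or> [y = ered w (om ^ 2)] (mod int p)"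
    by (simp add: cong_iff_dvd_diff om_square ered_def)
  then show ?thesis by blast
qed

text \<open>The cubic residue symbol for the prime that is the kernel of \<open>ered w\<close>
  modulo \<open>p\<close>. The chosen exponent is determined only modulo 3, its power of
  \<open>om\<close> uniquely, by \<open>ered_om_power_inject\<close>.\<close>

definition cres :: "int \<Rightarrow> eis" where
  "cres x = (if int p dvd x then 0 else om ^ (SOME i. [x ^ (2 * n) = ered w (om ^ i)] (mod int p)))"

lemma ered_cres: "[ered w (cres x) = x ^ (2 * n)] (mod int p)"
proof (cases "int p dvd x")
  case True
  then show ?thesis using n_pos by (simp add: cres_def cong_iff_dvd_diff) (metis dvd_power dvd_trans less_numeral_extra(1) mult_pos_pos pos2)
next
  case False
  have "[(x ^ (2 * n)) ^ 3 = 1] (mod int p)"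
    using fermat_int[OF prime_p False] p_eq by (simp flip: power_mult)
  then have "\<exists>i. [x ^ (2 * n) = ered w (om ^ i)] (mod int p)" by (rule cube_root_of_unity_cases)
  then have "[x ^ (2 * n) = ered w (om ^ (SOME i. [x ^ (2 * n) = ered w (om ^ i)] (mod int p)))] (mod int p)"
    by (rule someI_ex)
  then show ?thesis using False by (simp add: cres_def cong_sym)
qed

lemma cres_values: "\<not> int p dvd x \<Longrightarrow> \<exists>i. cres x = om ^ i"
  by (auto simp: cres_def)

lemma cres_eqI:
  assumes "\<not> int p dvd x" "[x ^ (2 * n) = ered w (om ^ i)] (mod int p)" shows "cres x = om ^ i"
proof -
  obtain j where j: "cres x = om ^ j" using cres_values[OF assms(1)] by blast
  have "[ered w (om ^ j) = ered w (om ^ i)] (mod int p)"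
    using ered_cres[of x] assms(2) cong_trans unfolding j by blast
  then show ?thesis using ered_om_power_inject j by simp
qed

sublocale cubic_character p cres
proof
  show "prime p" by (rule prime_p)
  show "p \<noteq> 3" using p_eq n_pos by simp
  show "cres 0 = 0" by (simp add: cres_def)
  show "\<exists>i. cres x = om ^ i" if "\<not> int p dvd x" for x by (rule cres_values[OF that])
  show "periodic p cres"
    unfolding periodic_def
  proof
    fix x
    show "cres (x mod int p) = cres x"
    proof (cases "int p dvd x")
      case False
      then obtain i where i: "cres x = om ^ i" using cres_values by blast
      have "[(x mod int p) ^ (2 * n) = x ^ (2 * n)] (mod int p)"
        by (intro cong_pow) (simp add: cong_def)
      then have "[(x mod int p) ^ (2 * n) = ered w (om ^ i)] (mod int p)"
        using ered_cres[of x] i cong_sym cong_trans by metis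
      then have "cres (x mod int p) = om ^ i" using False by (intro cres_eqI) (auto simp: dvd_mod_iff)
      then show ?thesis using i by simp
    qed (simp add: cres_def dvd_mod_iff)
  qed
  show "cres (x * y) = cres x * cres y" for x y
  proof (cases "int p dvd x \<or> int p dvd y")
    case False
    then obtain i j where ij: "cres x = om ^ i" "cres y = om ^ j" using cres_values by metis
    have "[ered w (om ^ (i + j)) = ered w (om ^ i) * ered w (om ^ j)] (mod int p)"
      using ered_mult[OF w, of "om ^ i" "om ^ j"] by (simp add: power_add)
    also have "[ered w (om ^ i) * ered w (om ^ j) = x ^ (2 * n) * y ^ (2 * n)] (mod int p)"
      using ered_cres[of x] ered_cres[of y] ij by (intro cong_mult) simp_all
    finally have "[(x * y) ^ (2 * n) = ered w (om ^ (i + j))] (mod int p)"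
      by (simp add: power_mult_distrib cong_sym)
    moreover have "\<not> int p dvd x * y" using False prime_int_p by (simp add: prime_dvd_mult_iff)
    ultimately have "cres (x * y) = om ^ (i + j)" by (intro cres_eqI)
    then show ?thesis using ij by (simp add: power_add)
  qed (auto simp: cres_def)
  show "\<exists>x. \<not> int p dvd x \<and> cres x \<noteq> 1"
  proof -
    obtain g where g: "\<not> int p dvd g" "\<And>j. [g ^ j = 1] (mod int p) \<longleftrightarrow> p - 1 dvd j"
      using primitive_root_exists[OF prime_p] by metis
    have "cres g \<noteq> 1"
    proof
      assume "cres g = 1"
      then have "[1 = g ^ (2 * n)] (mod int p)" using ered_cres[of g] by simp
      then have "p - 1 dvd 2 * n" using g(2) cong_sym by blast
      then show False using p_eq n_pos by (auto dest: dvd_imp_le)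
    qed
    then show ?thesis using g by blast
  qed
qed

text \<open>The sum reduces to values of a polynomial of degree 4n < p - 1, so it vanishes:
  \<open>jac\<close> lies in the prime that defines \<open>cres\<close>.\<close>

lemma ered_jac: "[ered w jac = 0] (mod int p)"
proof -
  define f :: "int poly" where "f = ([:0, 1:] * [:1, - 1:]) ^ (2 * n)"
  have "degree f \<le> degree ([:0, 1:] * [:1, - 1::int:]) * (2 * n)"
    unfolding f_def by (rule degree_power_le)
  also have "\<dots> < p - 1" using p_eq n_pos by simp
  finally have deg: "degree f < p - 1" .
  have "[ered w jac = (\<Sum>t\<in>{0..<int p}. poly f t)] (mod int p)"
    unfolding jac_def ered_sum
  proof (intro cong_sum)
    fix t
    have "[ered w (cres t * cres (1 - t)) = ered w (cres t) * ered w (cres (1 - t))] (mod int p)"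
      by (rule ered_mult[OF w])
    also have "[ered w (cres t) * ered w (cres (1 - t)) = t ^ (2 * n) * (1 - t) ^ (2 * n)] (mod int p)"
      by (intro cong_mult ered_cres)
    also have "t ^ (2 * n) * (1 - t) ^ (2 * n) = poly f t"
      by (simp add: f_def poly_power power_mult_distrib)
    finally show "[ered w (cres t * cres (1 - t)) = poly f t] (mod int p)" .
  qed
  also have "[(\<Sum>t\<in>{0..<int p}. poly f t) = 0] (mod int p)"
    by (rule poly_sum_mod_prime[OF prime_p deg])
  finally show ?thesis .
qed

text \<open>Conjugation squares the character, so the exponent 2n becomes 4n; the degree 8n now
  exceeds p - 1 and one coefficient survives. Completing the square, 4 t (1 - t) = 1 - (1 - 2t)^2,
  reduces it to a single binomial coefficient and costs the factor 4^(4n) = 16^(2n).\<close>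

lemma ered_econj_jac: "[16 ^ (2 * n) * ered w (econj jac) = - int ((3 * n) choose n)] (mod int p)"
proof -
  let ?R = "{0..<int p}"
  have "[ered w (econj jac) = (\<Sum>t\<in>?R. (t * (1 - t)) ^ (4 * n))] (mod int p)"
    unfolding jac_def econj_sum ered_sum
  proof (intro cong_sum)
    fix t
    have "econj (cres t * cres (1 - t)) = (cres t * cres (1 - t)) ^ 2"
      by (simp add: econj_hom econj_chi power_mult_distrib)
    then have "econj (cres t * cres (1 - t)) = cres (t * (1 - t)) ^ 2" by (simp add: chi_mult)
    then have "[ered w (econj (cres t * cres (1 - t))) = ered w (cres (t * (1 - t))) ^ 2] (mod int p)"
      using ered_power[OF w, of "cres (t * (1 - t))" 2] by simp
    also have "[ered w (cres (t * (1 - t))) ^ 2 = ((t * (1 - t)) ^ (2 * n)) ^ 2] (mod int p)"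
      by (intro cong_pow ered_cres)
    also have "((t * (1 - t)) ^ (2 * n)) ^ 2 = (t * (1 - t)) ^ (4 * n)"
      by (simp flip: power_mult)
    finally show "[ered w (econj (cres t * cres (1 - t))) = (t * (1 - t)) ^ (4 * n)] (mod int p)" .
  qed
  then have "[16 ^ (2 * n) * ered w (econj jac) = 16 ^ (2 * n) * (\<Sum>t\<in>?R. (t * (1 - t)) ^ (4 * n))] (mod int p)"
    by (rule cong_scalar_left)
  also have "16 ^ (2 * n) * (\<Sum>t\<in>?R. (t * (1 - t)) ^ (4 * n)) = (\<Sum>t\<in>?R. (- 1 * (- 2 * t + 1) ^ 2 + 1) ^ (4 * n))"
    unfolding sum_distrib_left
  proof (rule sum.cong[OF refl])
    fix t :: int
    have "(16::int) ^ (2 * n) = 4 ^ (4 * n)" by (simp add: power_mult)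
    then have "16 ^ (2 * n) * (t * (1 - t)) ^ (4 * n) = (4 * (t * (1 - t))) ^ (4 * n)"
      by (simp only: power_mult_distrib)
    also have "4 * (t * (1 - t)) = - 1 * (- 2 * t + 1) ^ 2 + 1"
      by (simp add: algebra_simps power2_eq_square)
    finally show "16 ^ (2 * n) * (t * (1 - t)) ^ (4 * n) = (- 1 * (- 2 * t + 1) ^ 2 + 1) ^ (4 * n)" .
  qed
  also have "[\<dots> = (\<Sum>t\<in>?R. (- 1 * ((- 2 * t + 1) mod int p) ^ 2 + 1) ^ (4 * n))] (mod int p)"
    by (intro cong_sum cong_pow cong_add cong_mult cong_refl) (simp add: cong_def)
  also have "(\<Sum>t\<in>?R. (- 1 * ((- 2 * t + 1) mod int p) ^ 2 + 1) ^ (4 * n)) = (\<Sum>t\<in>?R. (- 1 * t ^ 2 + 1) ^ (4 * n))"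
  proof (rule sum.reindex_bij_betw[OF bij_betw_affine_mod])
    have "\<not> int p dvd - 2" using p_not_dvd_small[of 2] by simp
    then show "coprime (- 2) (int p)" by (rule coprime_p)
  qed (rule p_pos)
  also have "[\<dots> = - (int ((4 * n) choose (3 * n)) * (- 1) ^ (3 * n) * 1 ^ (4 * n - 3 * n))] (mod int p)"
    by (rule sum_binomial_mod_prime[OF prime_p]) (use p_eq n_pos in auto)
  also have "- (int ((4 * n) choose (3 * n)) * (- 1) ^ (3 * n) * 1 ^ (4 * n - 3 * n)) = - ((- 1) ^ n * int ((4 * n) choose n))"
  proof -
    have "(4 * n) choose (3 * n) = (4 * n) choose n" using binomial_symmetric[of "3 * n" "4 * n"] by simp
    moreover have "(- 1 :: int) ^ (3 * n) = (- 1) ^ n" by (simp add: power_mult)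
    ultimately show ?thesis by simp
  qed
  also have "[\<dots> = - ((- 1) ^ n * ((- 1) ^ n * int ((3 * n) choose n)))] (mod int p)"
    by (intro cong_uminus cong_scalar_left binomial_mod_prime prime_p p_eq) 
  also have "- ((- 1) ^ n * ((- 1) ^ n * int ((3 * n) choose n))) = - int ((3 * n) choose n)"
    by (simp add: mult.assoc[symmetric] power_mult_distrib[symmetric])
  finally show ?thesis .
qed

lemma Legendre_cong: "[Legendre a (int p) = a ^ (3 * n)] (mod int p)"
proof -
  have "p > 2" "(p - 1) div 2 = 3 * n" using p_eq n_pos by auto
  then show ?thesis using euler_criterion[OF prime_p, of a] by simp
qed

text \<open>By Euler's criterion the left side is a sum of (t^3 + D)^(3n), whose only surviving
  coefficient contains the same binomial as \<open>ered_econj_jac\<close>. Eliminating it leaves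
  16^(2n) = 2^(6n) * 4^n, which is 4^n modulo \<open>p\<close>.\<close>

theorem sum_Legendre_cong:
  "[(\<Sum>t\<in>{0..<int p}. Legendre (t ^ 3 + D) (int p)) = ered w (econj jac) * (4 * D) ^ n] (mod int p)"
proof -
  let ?R = "{0..<int p}" and ?e = "ered w (econj jac)"
  have "[(\<Sum>t\<in>?R. Legendre (t ^ 3 + D) (int p)) = (\<Sum>t\<in>?R. (1 * t ^ 3 + D) ^ (3 * n))] (mod int p)"
    using Legendre_cong by (intro cong_sum) simp
  also have "[(\<Sum>t\<in>?R. (1 * t ^ 3 + D) ^ (3 * n))
      = - (int ((3 * n) choose (2 * n)) * 1 ^ (2 * n) * D ^ (3 * n - 2 * n))] (mod int p)"
    by (rule sum_binomial_mod_prime[OF prime_p]) (use p_eq n_pos in auto)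
  also have "- (int ((3 * n) choose (2 * n)) * 1 ^ (2 * n) * D ^ (3 * n - 2 * n)) = - int ((3 * n) choose n) * D ^ n"
    using binomial_symmetric[of "2 * n" "3 * n"] by simp
  also have "[\<dots> = 16 ^ (2 * n) * ?e * D ^ n] (mod int p)"
    by (intro cong_scalar_right cong_sym[OF ered_econj_jac])
  also have "16 ^ (2 * n) * ?e * D ^ n = 2 ^ (p - 1) * (?e * (4 * D) ^ n)"
  proof -
    have "(16::int) ^ (2 * n) = 2 ^ (4 * (2 * n))" unfolding power_mult by simp
    also have "\<dots> = 2 ^ (p - 1) * 2 ^ (2 * n)" unfolding p_eq power_add[symmetric] by simp
    also have "(2::int) ^ (2 * n) = 4 ^ n" by (simp add: power_mult)
    finally show ?thesis by (simp add: power_mult_distrib)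
  qed
  also have "[2 ^ (p - 1) * (?e * (4 * D) ^ n) = 1 * (?e * (4 * D) ^ n)] (mod int p)"
    using p_not_dvd_small[of 2] by (intro cong_scalar_right fermat_int prime_p) simp
  finally show ?thesis by simp
qed

text \<open>Both \<open>jac\<close> and \<open>z\<close> lie in the same prime, so
  \<open>jac * econj z\<close> has both reductions zero and is divisible by
  \<open>p = z * econj z\<close>; the quotient has norm 1 by comparison of norms.\<close>

lemma jac_associated:
  assumes z: "[ered w z = 0] (mod int p)" "enorm z = int p"
  obtains u where "enorm u = 1" "jac = u * z"
proof -
  define y where "y = jac * econj z"
  have "[ered w y = 0 * ered w (econj z)] (mod int p)"
    unfolding y_def using ered_mult[OF w] cong_scalar_right[OF ered_jac] cong_trans by blast
  moreover have "econj y = econj jac * z" by (simp add: y_def econj_hom)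
  then have "[ered w (econj y) = ered w (econj jac) * 0] (mod int p)"
    using ered_mult[OF w] cong_scalar_left[OF z(1)] cong_trans by metis
  ultimately have "of_int (int p) dvd y"
    using p_not_dvd_small[of 3] by (intro ered_both_zero[OF prime_int_p _ w]) simp_all
  then obtain u where u: "y = of_int (int p) * u" by blast
  have "of_int (int p) * (jac - u * z) = jac * of_int (int p) - (of_int (int p) * u) * z"
    by (simp add: algebra_simps)
  also have "\<dots> = jac * of_int (int p) - jac * (z * econj z)"
    unfolding u[symmetric] y_def by (simp add: ac_simps)
  also have "\<dots> = 0" by (simp add: mult_econj z(2))
  finally have "of_int (int p) * (jac - u * z) = 0" .
  moreover have "int p \<noteq> 0" using p_pos by simp
  ultimately have "jac - u * z = 0" by (rule of_int_mult_eis_eq_0)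
  then have jz: "jac = u * z" by simp
  then have "enorm u * int p = int p" using enorm_jac z(2) by (simp add: enorm_mult)
  then have "enorm u = 1" using p_pos by simp
  then show thesis using jz that by blast
qed

end

lemma eis_unit_cases:
  assumes "enorm u = 1"
  shows "u \<in> {1, - 1, om, - om, om ^ 2, - (om ^ 2)}"
proof -
  define a b where "a = ere u" and "b = eim u"
  have "4 = 4 * enorm u" using assms by simp
  also have "\<dots> = (2 * a - b) ^ 2 + 3 * b ^ 2"
    by (simp add: enorm_def a_def b_def power2_eq_square algebra_simps)
  finally have e: "4 = (2 * a - b) ^ 2 + 3 * b ^ 2" .
  then have "3 * b ^ 2 \<le> 4" using zero_le_power2[of "2 * a - b"] by linarith
  then have "b ^ 2 < 2 ^ 2" by simp
  then have b: "b = -1 \<or> b = 0 \<or> b = 1" using abs_less_iff[of b 2] power2_less_imp_less[of "\<bar>b\<bar>" 2] by auto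
  have "3 * a ^ 2 \<le> 4"
  proof -
    have "4 = (2 * b - a) ^ 2 + 3 * a ^ 2" using e by (simp add: power2_eq_square algebra_simps)
    then show ?thesis using zero_le_power2[of "2 * b - a"] by linarith
  qed
  then have "a ^ 2 < 2 ^ 2" by simp
  then have a: "a = -1 \<or> a = 0 \<or> a = 1" using abs_less_iff[of a 2] power2_less_imp_less[of "\<bar>a\<bar>" 2] by auto
  show ?thesis using a b e by (auto simp: eis_eq_iff a_def b_def om_square power2_eq_square)
qed

lemma cong_imp_eq_int:
  fixes a b :: int
  assumes "[a = b] (mod n)" "\<bar>a - b\<bar> < n" shows "a = b"
proof -
  obtain k where k: "a - b = n * k" using assms(1) unfolding cong_iff_dvd_diff by blast
  have "n > 0" using assms(2) by linarith
  then have "n * \<bar>k\<bar> < n * 1" using assms(2) by (simp add: k abs_mult)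
  then have "k = 0" using \<open>n > 0\<close> by (simp only: mult_less_cancel_left_pos)
  then show ?thesis using k by simp
qed

lemma Legendre_bounds: "Legendre a b \<le> 1" "- 1 \<le> Legendre a b"
  by (auto simp: Legendre_def)

lemma Legendre_eq_of_cong: "[a = b] (mod m) \<Longrightarrow> Legendre a m = Legendre b m"
  by (simp add: Legendre_def QuadRes_def cong_def)

lemma Legendre_mult:
  assumes "prime p" "p > 2"
  shows "Legendre (a * b) (int p) = Legendre a (int p) * Legendre b (int p)"
proof (rule cong_imp_eq_int)
  let ?h = "(p - 1) div 2"
  have "[Legendre (a * b) (int p) = a ^ ?h * b ^ ?h] (mod int p)"
    using euler_criterion[OF assms, of "a * b"] by (simp add: power_mult_distrib)
  also have "[a ^ ?h * b ^ ?h = Legendre a (int p) * Legendre b (int p)] (mod int p)"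
    by (intro cong_mult cong_sym[OF euler_criterion[OF assms]])
  finally show "[Legendre (a * b) (int p) = Legendre a (int p) * Legendre b (int p)] (mod int p)" .
  have "\<bar>Legendre (a * b) (int p) - Legendre a (int p) * Legendre b (int p)\<bar> \<le> 2"
    by (auto simp: Legendre_def)
  then show "\<bar>Legendre (a * b) (int p) - Legendre a (int p) * Legendre b (int p)\<bar> < int p"
    using assms(2) by linarith
qed

lemma (in cubic_residue) om_power_cres_eqI:
  assumes "prime q" "q \<noteq> 3" "q \<noteq> p"
    and "idcong (of_int (int q)) 0 ((of_int (int p) * jac) ^ ((q\<^sup>2 - 1) div 3)) (om ^ i)"
  shows "cres (int q) = om ^ i"
proof -
  have "\<not> int p dvd int q" using assms prime_p primes_dvd_imp_eq[of p q] by auto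
  then obtain j where j: "cres (int q) = om ^ j" using cres_values by blast
  have "idcong (of_int (int q)) 0 (om ^ j) (om ^ i)"
    using jac_reciprocity[OF assms(1-3)] assms(4) idcong_sym idcong_trans unfolding j by blast
  moreover have "\<not> int q dvd 1" using assms(1) by (simp add: prime_nat_iff)
  ultimately have "[j = i] (mod 3)" by (rule om_power_idcong)
  then show ?thesis using j om_power_eq_iff by simp
qed

section \<open>The primes \<open>3 m\<^sup>2 + 3 m + 1\<close>\<close>

text \<open>These are exactly the elements x + y om of trace 2x - y = 1.\<close>

definition zeta :: "int \<Rightarrow> eis" where "zeta m = Eis (m + 1) (2 * m + 1)"

lemma enorm_zeta: "enorm (zeta m) = 3 * m\<^sup>2 + 3 * m + 1"
  by (simp add: zeta_def enorm_def power2_eq_square algebra_simps)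

text \<open>\<open>h\<close> is an exponent for which \<open>om ^ h * zeta m\<close> is -1 modulo 3,
  as the Jacobi sum has to be. Only its class modulo 3 matters.\<close>

locale trace_one_prime =
  fixes p :: nat and m :: int and h :: nat
  assumes p1: "prime p" and p_m: "int p = 3 * m\<^sup>2 + 3 * m + 1" and m_pos: "m > 0"
    and h: "[int h = 2 * m + 1] (mod 3)"
begin

definition nn :: nat where "nn = nat (m * (m + 1) div 2)"

lemma two_nn: "2 * int nn = m * (m + 1)"
proof -
  have "even (m * (m + 1))" by simp
  then show ?thesis using m_pos by (simp add: nn_def)
qed

text \<open>The root m/(m + 1) is the one at which \<open>zeta m\<close> reduces to 0, as (m + 1)^2
  + (2m + 1) m = p.\<close>

definition ww :: int where "ww = (SOME w. [(m + 1) * w = m] (mod int p))"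

lemma not_dvd_m1: "\<not> int p dvd m + 1"
proof
  assume "int p dvd m + 1"
  then have "int p \<le> m + 1" using m_pos by (intro zdvd_imp_le) auto
  moreover have "m\<^sup>2 > 0" using m_pos by simp
  ultimately show False using p_m m_pos by linarith
qed

lemma ww: "[(m + 1) * ww = m] (mod int p)"
proof -
  have "coprime (m + 1) (int p)" by (rule coprime_prime_int[OF p1 not_dvd_m1])
  then obtain b where "[(m + 1) * b = 1] (mod int p)" using cong_solve_coprime_int by blast
  then have "[(m + 1) * b * m = 1 * m] (mod int p)" by (rule cong_scalar_right)
  then have "[(m + 1) * (b * m) = m] (mod int p)" by (simp add: mult.assoc)
  then show ?thesis unfolding ww_def by (rule someI)
qed

sublocale cubic_residue p nn ww
proof
  show "prime p" by (rule p1)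
  have "int p = int (6 * nn + 1)" using two_nn p_m by (simp add: power2_eq_square algebra_simps)
  then show "p = 6 * nn + 1" by linarith
  have "[((m + 1) * ww)\<^sup>2 + (m + 1) * ((m + 1) * ww) + (m + 1)\<^sup>2 = m\<^sup>2 + (m + 1) * m + (m + 1)\<^sup>2] (mod int p)"
    by (intro cong_add cong_pow cong_scalar_left ww cong_refl)
  also have "m\<^sup>2 + (m + 1) * m + (m + 1)\<^sup>2 = int p" using p_m by (simp add: power2_eq_square algebra_simps)
  also have "[int p = 0] (mod int p)" by (simp add: cong_0_iff)
  also have "((m + 1) * ww)\<^sup>2 + (m + 1) * ((m + 1) * ww) + (m + 1)\<^sup>2 = (m + 1)\<^sup>2 * (ww\<^sup>2 + ww + 1)"
    by (simp add: power2_eq_square algebra_simps)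
  finally have "int p dvd (m + 1)\<^sup>2 * (ww\<^sup>2 + ww + 1)" by (simp add: cong_0_iff)
  then show "[ww\<^sup>2 + ww + 1 = 0] (mod int p)"
    using p1 not_dvd_m1 by (simp add: prime_dvd_mult_iff prime_dvd_power_iff cong_0_iff)
qed

lemma ered_zeta: "[ered ww (zeta m) = 0] (mod int p)"
proof -
  have "(m + 1) * ered ww (zeta m) = (m + 1)\<^sup>2 + (2 * m + 1) * ((m + 1) * ww)"
    by (simp add: ered_def zeta_def power2_eq_square algebra_simps)
  also have "[\<dots> = (m + 1)\<^sup>2 + (2 * m + 1) * m] (mod int p)"
    by (intro cong_add cong_scalar_left ww cong_refl)
  also have "(m + 1)\<^sup>2 + (2 * m + 1) * m = int p" using p_m by (simp add: power2_eq_square algebra_simps)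
  finally have "int p dvd (m + 1) * ered ww (zeta m)" by (simp add: cong_dvd_iff)
  then show ?thesis using p1 not_dvd_m1 by (simp add: prime_dvd_mult_iff cong_0_iff)
qed

text \<open>Trace one enters here: the conjugate of \<open>zeta m\<close> is 1 -
  \<open>zeta m\<close>, and \<open>zeta m\<close> reduces to 0.\<close>

lemma ered_econj_zeta: "[ered ww (econj (zeta m)) = 1] (mod int p)"
proof -
  have "ered ww (econj (zeta m)) = 1 - ered ww (zeta m)"
    by (simp add: ered_def zeta_def algebra_simps)
  also have "[\<dots> = 1 - 0] (mod int p)" by (intro cong_diff cong_refl ered_zeta)
  finally show ?thesis by simp
qed

text \<open>The Jacobi sum and \<open>zeta m\<close> differ by one of six units, and
  \<open>jac_mod_3\<close> admits only one of them for each class of \<open>m\<close> modulo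
  3.\<close>

lemma jac_eq: "jac = om ^ h * zeta m"
proof -
  obtain u where u: "enorm u = 1" "jac = u * zeta m"
    using jac_associated[OF ered_zeta] enorm_zeta p_m by metis
  have m3: "idcong (of_int 3) 0 (u * zeta m) (- 1)" using jac_mod_3 u by simp
  have "u = om ^ h"
  proof -
    have hm: "om ^ h = om ^ (h mod 3)" by (rule om_power_mod)
    have "h mod 3 = 0 \<or> h mod 3 = 1 \<or> h mod 3 = 2" by auto
    then show ?thesis
    proof (elim disjE)
      assume a: "h mod 3 = 0"
      then have "m mod 3 = 1" using h unfolding cong_def by presburger
      then obtain k where k: "m = 3 * k + 1" by (metis mult_div_mod_eq)
      have "u = 1" using eis_unit_cases[OF u(1)] m3
        unfolding k zeta_def eis_idcong_iff cong_iff_dvd_diff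
        by (elim insertE emptyE; simp add: om_square; presburger)
      then show ?thesis using hm a by simp
    next
      assume a: "h mod 3 = 1"
      then have "m mod 3 = 0" using h unfolding cong_def by presburger
      then obtain k where k: "m = 3 * k + 0" by (metis mult_div_mod_eq)
      have "u = om" using eis_unit_cases[OF u(1)] m3
        unfolding k zeta_def eis_idcong_iff cong_iff_dvd_diff
        by (elim insertE emptyE; simp add: om_square; presburger)
      then show ?thesis using hm a by simp
    next
      assume a: "h mod 3 = 2"
      then have "m mod 3 = 2" using h unfolding cong_def by presburger
      then obtain k where k: "m = 3 * k + 2" by (metis mult_div_mod_eq)
      have "u = om ^ 2" using eis_unit_cases[OF u(1)] m3
        unfolding k zeta_def eis_idcong_iff cong_iff_dvd_diff
        by (elim insertE emptyE; simp add: om_square; presburger)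
      then show ?thesis using hm a by simp
    qed
  qed
  then show ?thesis using u by simp
qed

text \<open>With \<open>D\<close> a nonresidue, (4D)^(3n) = -1, hence (4D)^n is minus the square of
  the cubic character of 4D. Together with \<open>jac_eq\<close> the sum is minus the square of
  \<open>cres (4 * D) * om ^ h\<close>, reduced modulo \<open>p\<close>.\<close>

theorem anomalous:
  assumes D: "Legendre D (int p) = - 1" and c: "cres (4 * D) * om ^ h = 1"
  shows "(\<Sum>t\<in>{0..<int p}. Legendre (t ^ 3 + D) (int p)) = - 1"
proof -
  let ?S = "\<Sum>t\<in>{0..<int p}. Legendre (t ^ 3 + D) (int p)"
  have "(4 * D) ^ (3 * nn) = 2 ^ (p - 1) * D ^ (3 * nn)"
    by (simp add: p_eq power_mult_distrib power_mult)
  also have "[\<dots> = 1 * Legendre D (int p)] (mod int p)"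
    using p_not_dvd_small[of 2] by (intro cong_mult fermat_int prime_p cong_sym[OF Legendre_cong]) simp
  finally have D3: "[(4 * D) ^ (3 * nn) = - 1] (mod int p)" using D by simp
  have "[(4 * D) ^ nn * - 1 = (4 * D) ^ nn * (4 * D) ^ (3 * nn)] (mod int p)"
    by (intro cong_scalar_left cong_sym[OF D3])
  also have "(4 * D) ^ nn * (4 * D) ^ (3 * nn) = ((4 * D) ^ (2 * nn)) ^ 2"
    unfolding power_add[symmetric] power_mult[symmetric]
    by (rule arg_cong[where f = "power (4 * D)"]) simp
  also have "[\<dots> = ered ww (cres (4 * D)) ^ 2] (mod int p)"
    by (intro cong_pow cong_sym[OF ered_cres])
  finally have n1: "[(4 * D) ^ nn = - (ered ww (cres (4 * D)) ^ 2)] (mod int p)"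
    using cong_minus_minus_iff by fastforce
  have "[ered ww (econj jac) = ered ww ((om ^ h) ^ 2) * ered ww (econj (zeta m))] (mod int p)"
    unfolding jac_eq econj_hom econj_om_power by (rule ered_mult[OF w])
  also have "[ered ww ((om ^ h) ^ 2) * ered ww (econj (zeta m)) = ered ww (om ^ h) ^ 2 * 1] (mod int p)"
    by (intro cong_mult ered_power[OF w] ered_econj_zeta)
  finally have e: "[ered ww (econj jac) = ered ww (om ^ h) ^ 2] (mod int p)" by simp
  have "[?S = ered ww (econj jac) * (4 * D) ^ nn] (mod int p)" by (rule sum_Legendre_cong)
  also have "[ered ww (econj jac) * (4 * D) ^ nn = ered ww (om ^ h) ^ 2 * - (ered ww (cres (4 * D)) ^ 2)] (mod int p)"
    by (intro cong_mult e n1)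
  also have "ered ww (om ^ h) ^ 2 * - (ered ww (cres (4 * D)) ^ 2) = - ((ered ww (cres (4 * D)) * ered ww (om ^ h)) ^ 2)"
    by (simp add: power_mult_distrib)
  also have "[\<dots> = - (ered ww (cres (4 * D) * om ^ h) ^ 2)] (mod int p)"
    by (intro cong_uminus cong_pow cong_sym[OF ered_mult[OF w]])
  finally have S: "[?S = - 1] (mod int p)" using c by simp
  have p0: "p > 0" by (rule p_pos)
  \<comment> \<open>The term at t = 0 is -1, so the sum lies between -p and p - 2 and its distance
    from -1 is less than \<open>p\<close>.\<close>
  have "?S = Legendre D (int p) + (\<Sum>t\<in>{0..<int p} - {0}. Legendre (t ^ 3 + D) (int p))"
    using p0 by (subst sum.remove[of _ 0]) auto
  also have "\<dots> \<le> - 1 + (\<Sum>t\<in>{0..<int p} - {0}. 1)"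
    unfolding D by (intro add_left_mono sum_mono Legendre_bounds)
  finally have "?S \<le> int p - 2" using p0 by simp
  moreover have "?S \<ge> (\<Sum>t\<in>{0..<int p}. - 1)" by (intro sum_mono Legendre_bounds)
  ultimately have "\<bar>?S - - 1\<bar> < int p" by simp
  with S show ?thesis by (rule cong_imp_eq_int)
qed

lemma cres_prime:
  assumes q: "prime q" "q \<noteq> 3" "q \<noteq> p"
    and theta: "idcong (of_int (int q)) 0 ((of_int (enorm (zeta m)) * zeta m) ^ ((q\<^sup>2 - 1) div 3)) (om ^ i)"
  shows "cres (int q) = om ^ (i + h * ((q\<^sup>2 - 1) div 3))"
proof (rule om_power_cres_eqI[OF q])
  let ?K = "(q\<^sup>2 - 1) div 3"
  have "of_int (int p) * jac = of_int (enorm (zeta m)) * zeta m * om ^ h"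
    by (simp only: jac_eq p_m enorm_zeta ac_simps)
  then have "(of_int (int p) * jac) ^ ?K = (of_int (enorm (zeta m)) * zeta m) ^ ?K * om ^ (h * ?K)"
    by (simp only: power_mult_distrib[of _ "om ^ h"] power_mult)
  also have "idcong (of_int (int q)) 0 \<dots> (om ^ i * om ^ (h * ?K))"
    using theta by (rule idcong_mult) simp
  finally show "idcong (of_int (int q)) 0 ((of_int (int p) * jac) ^ ?K) (om ^ (i + h * ?K))"
    by (simp add: power_add)
qed

text \<open>Modulo a prime divisor of m + 1 the norm of \<open>zeta m\<close> is 1 and
  \<open>zeta m\<close> itself is -om, so reciprocity gives an explicit character. The exponent (a^2
  - 1)/3 is additive modulo 3 under multiplication of a's prime to 3. The lemma prepares the value
  of \<open>cres 3\<close>.\<close>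

lemma cres_divisor_m1:
  assumes h0: "[h = 0] (mod 3)"
  shows "a > 0 \<Longrightarrow> \<not> 3 dvd a \<Longrightarrow> int a dvd m + 1 \<Longrightarrow> cres (int a) = om ^ ((a\<^sup>2 - 1) div 3)"
proof (induction a rule: prime_divisors_induct)
  case (factor q a)
  have am: "\<not> 3 dvd a" "a > 0" "\<not> 3 dvd q" using factor.prems(1,2) dvd_mult[of 3 a q] dvd_mult2[of 3 q a] by auto
  then have q3: "q \<noteq> 3" by auto
  have "int q * int a dvd m + 1" using factor.prems(3) by simp
  then have qm: "int q dvd m + 1" and am': "int a dvd m + 1"
    using dvd_mult_left dvd_mult_right by blast+
  have qp: "q \<noteq> p" using qm not_dvd_m1 by auto
  let ?K = "(q\<^sup>2 - 1) div 3"
  have sq: "\<exists>A. b\<^sup>2 = 3 * A + 1" if "\<not> 3 dvd b" for b :: nat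
  proof -
    have "b mod 3 = 1 \<or> b mod 3 = 2" using that by presburger
    then have "b\<^sup>2 mod 3 = 1" by (auto simp: power2_eq_square mod_mult_eq[of b 3 b, symmetric])
    then show ?thesis by (intro exI[of _ "b\<^sup>2 div 3"]) presburger
  qed
  have cq: "cres (int q) = om ^ ?K"
  proof -
    have z: "idcong (of_int (int q)) 0 (of_int (enorm (zeta m)) * zeta m) (- om)"
    proof -
      obtain c where c: "m + 1 = int q * c" using qm by blast
      have "of_int (enorm (zeta m)) * zeta m - - om = of_int (m + 1) * (of_int (3 * m) * zeta m + Eis 1 2)"
        unfolding enorm_zeta by (rule eis_eqI) (simp_all add: zeta_def power2_eq_square algebra_simps)
      then show ?thesis unfolding idcong_zero_iff c by simp
    qed
    have "idcong (of_int (int q)) 0 ((- om) ^ ?K) (om ^ ?K)"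
    proof (cases "q = 2")
      case True
      have "idcong (of_int (int 2)) 0 (- om) om" unfolding eis_idcong_iff by (simp add: cong_def)
      then show ?thesis using True by (auto intro: idcong_power)
    next
      case False
      then have "odd q" using \<open>prime q\<close> prime_odd_nat prime_ge_2_nat by (metis le_neq_implies_less)
      then obtain A where A: "q\<^sup>2 = 3 * A + 1" using sq am by blast
      then have "even A" using \<open>odd q\<close> by (metis even_add even_mult_iff even_power odd_numeral odd_one)
      moreover have "?K = A" using A by simp
      ultimately show ?thesis by simp
    qed
    then have "idcong (of_int (int q)) 0 ((of_int (enorm (zeta m)) * zeta m) ^ ?K) (om ^ ?K)"
      using idcong_power[OF z] idcong_trans by blast
    then have "cres (int q) = om ^ (?K + h * ?K)" using cres_prime \<open>prime q\<close> q3 qp by blast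
    also have "\<dots> = om ^ ?K"
      unfolding om_power_eq_iff using cong_scalar_right[OF h0, of ?K] cong_add[of ?K ?K 3 "h * ?K" 0] by simp
    finally show ?thesis .
  qed
  have ca: "cres (int a) = om ^ ((a\<^sup>2 - 1) div 3)" using factor.IH am am' by simp
  obtain A B where AB: "q\<^sup>2 = 3 * A + 1" "a\<^sup>2 = 3 * B + 1" using sq am by meson
  have "(q * a)\<^sup>2 = 3 * (3 * (A * B) + A + B) + 1"
    unfolding power_mult_distrib AB by (simp add: algebra_simps)
  then have "((q * a)\<^sup>2 - 1) div 3 = 3 * (A * B) + A + B" by simp
  moreover have "om ^ (3 * (A * B) + A + B) = om ^ A * om ^ B" by (simp add: power_add power_mult)
  ultimately show ?case using cq ca AB by (simp add: chi_mult)
qed (auto simp: chi_1)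

text \<open>The supplementary law for 3. In Z[om] one has 3 = - om^2 (1 - om)^2; under
  \<open>om -> ww = m/(m + 1)\<close> the factor 1 - om becomes 1/(m + 1). The character of m + 1
  comes from \<open>cres_divisor_m1\<close>, that of \<open>ww\<close> from its (p - 1)/3-th power.
  The result depends on \<open>m\<close> modulo 9.\<close>

lemma cres_3:
  assumes m: "m = 3 * int s + 1" shows "cres 3 = om ^ (2 + s)"
proof -
  have h0: "[h = 0] (mod 3)" using h m unfolding cong_def by presburger
  define a where "a = nat (m + 1)"
  have a: "int a = m + 1" using m_pos by (simp add: a_def)
  have "a = 3 * s + 2" using a m by simp
  then have "\<not> 3 dvd a" by presburger
  then have ca: "cres (m + 1) = om ^ ((a\<^sup>2 - 1) div 3)"
    using cres_divisor_m1[OF h0, of a] a m_pos by simp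
  have "(a\<^sup>2 - 1) div 3 = 3 * s\<^sup>2 + 4 * s + 1"
  proof -
    have "a\<^sup>2 = 3 * (3 * s\<^sup>2 + 4 * s + 1) + 1" using \<open>a = 3 * s + 2\<close> by (simp add: power2_eq_square algebra_simps)
    then show ?thesis by simp
  qed
  then have ca: "cres (m + 1) = om ^ (s + 1)"
    unfolding ca om_power_eq_iff by (simp add: cong_def) presburger
  have pw: "\<not> int p dvd ww"
  proof
    assume "int p dvd ww"
    then have "int p dvd ww * ww + ww" by simp
    moreover have "int p dvd ww * ww + ww + 1" using w by (simp add: cong_0_iff power2_eq_square)
    ultimately have "int p dvd 1" by (simp add: dvd_add_right_iff)
    then show False using p_not_dvd_small[of 1] by simp
  qed
  have cw: "cres ww = om ^ (2 * nn)"
    by (rule cres_eqI[OF pw]) (rule cong_sym[OF ered_om_power])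
  have n: "2 * nn = 9 * s\<^sup>2 + 9 * s + 2"
  proof -
    have "2 * int nn = int (9 * s\<^sup>2 + 9 * s + 2)" using two_nn m by (simp add: power2_eq_square algebra_simps)
    then show ?thesis by linarith
  qed
  then have "2 * nn = 2 + 3 * (3 * s\<^sup>2 + 3 * s)" by simp
  then have cw: "cres ww = om ^ 2" unfolding cw om_power_eq_iff by (simp only: cong_def mod_mult_self2)
  have "cres m = cres ((m + 1) * ww)" by (rule periodicD[OF chi_periodic cong_sym[OF ww]])
  then have cm: "cres m = om ^ (s + 1) * om ^ 2" by (simp add: chi_mult ca cw)
  \<comment> \<open>The relation 3 = - om^2 (1 - om)^2 with denominators cleared; the right side is
    p (m^2 + 3m + 3).\<close>
  have "3 * (m + 1) ^ 4 - - (m\<^sup>2) = int p * (m + 1)\<^sup>2 + (m + 2) * int p"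
    unfolding p_m by (simp add: power2_eq_square power4_eq_xxxx algebra_simps)
  then have "[3 * (m + 1) ^ 4 = - (m\<^sup>2)] (mod int p)" by (simp add: cong_iff_dvd_diff)
  then have "cres (3 * (m + 1) ^ 4) = cres (- (m\<^sup>2))" by (rule periodicD[OF chi_periodic])
  then have "cres 3 * om ^ ((s + 1) * 4) = om ^ ((s + 1) * 2 + 2 * 2)"
    by (simp only: chi_mult chi_power chi_minus ca cm power_mult_distrib power_add power_mult)
  then have "cres 3 * om ^ ((s + 1) * 4) * om ^ ((s + 1) * 2) = om ^ ((s + 1) * 2 + 2 * 2) * om ^ ((s + 1) * 2)"
    by simp
  then have "cres 3 * om ^ ((s + 1) * 6) = om ^ ((s + 1) * 4 + 4)"
    unfolding mult.assoc power_add[symmetric] by (simp add: algebra_simps)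
  moreover have "om ^ ((s + 1) * 6) = om ^ 0" unfolding om_power_eq_iff cong_def by presburger
  ultimately have "cres 3 = om ^ ((s + 1) * 4 + 4)" by simp
  also have "\<dots> = om ^ (2 + s)" unfolding om_power_eq_iff cong_def by presburger
  finally show ?thesis .
qed

end

section \<open>The primes \<open>3 W\<^sup>2 + 1\<close> with \<open>42 | W\<close>\<close>

text \<open>\<open>zz\<close> below has norm \<open>p\<close> and trace 2. The factor 42 = 2 * 3 * 7
  makes \<open>zz\<close> congruent to 1 modulo 2, 3 and 7, which settles the unit in the Jacobi sum
  and the characters of 2 and 7.\<close>

locale trace_two_prime =
  fixes p :: nat and k :: int
  assumes p1: "prime p" and p_k: "int p = 3 * (42 * k)\<^sup>2 + 1" and k_pos: "k > 0"
begin

abbreviation WW :: int where "WW \<equiv> 42 * k"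

definition nn :: nat where "nn = nat (882 * k\<^sup>2)"

definition zz :: eis where "zz = Eis (1 + WW) (2 * WW)"

lemma enorm_zz: "enorm zz = int p"
  unfolding p_k by (simp add: zz_def enorm_def power2_eq_square algebra_simps)

lemma not_dvd_2W: "\<not> int p dvd 2 * WW"
proof
  assume "int p dvd 2 * WW"
  then have "int p \<le> 2 * WW" using k_pos by (intro zdvd_imp_le) auto
  moreover have "42 * k * 1 \<le> 42 * k * (42 * k)" using k_pos by (intro mult_left_mono) auto
  ultimately show False using p_k k_pos by (simp add: power2_eq_square)
qed

definition ww :: int where "ww = (SOME w. [2 * WW * w = - (1 + WW)] (mod int p))"

lemma ww: "[2 * WW * ww = - (1 + WW)] (mod int p)"
proof -
  have "coprime (2 * WW) (int p)" by (rule coprime_prime_int[OF p1 not_dvd_2W])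
  then obtain b where "[2 * WW * b = 1] (mod int p)" using cong_solve_coprime_int by blast
  then have "[2 * WW * b * - (1 + WW) = 1 * - (1 + WW)] (mod int p)" by (rule cong_scalar_right)
  then have "[2 * WW * (b * - (1 + WW)) = - (1 + WW)] (mod int p)" by (simp only: mult.assoc mult_1)
  then show ?thesis unfolding ww_def by (rule someI)
qed

sublocale cubic_residue p nn ww
proof
  show "prime p" by (rule p1)
  have "int p = int (6 * nn + 1)" using p_k by (simp add: nn_def power2_eq_square)
  then show "p = 6 * nn + 1" by linarith
  have "[(2 * WW * ww)\<^sup>2 + 2 * WW * (2 * WW * ww) + (2 * WW)\<^sup>2
      = (- (1 + WW))\<^sup>2 + 2 * WW * (- (1 + WW)) + (2 * WW)\<^sup>2] (mod int p)"
    by (intro cong_add cong_pow cong_scalar_left ww cong_refl)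
  also have "(- (1 + WW))\<^sup>2 + 2 * WW * (- (1 + WW)) + (2 * WW)\<^sup>2 = int p"
    using p_k by (simp add: power2_eq_square algebra_simps)
  also have "[int p = 0] (mod int p)" by (simp add: cong_0_iff)
  also have "(2 * WW * ww)\<^sup>2 + 2 * WW * (2 * WW * ww) + (2 * WW)\<^sup>2 = (2 * WW)\<^sup>2 * (ww\<^sup>2 + ww + 1)"
    by (simp add: power2_eq_square algebra_simps)
  finally have "int p dvd (2 * WW)\<^sup>2 * (ww\<^sup>2 + ww + 1)" by (simp add: cong_0_iff)
  moreover have "\<not> int p dvd (2 * WW)\<^sup>2"
    using not_dvd_2W p1 by (metis prime_dvd_power prime_nat_int_transfer)
  ultimately show "[ww\<^sup>2 + ww + 1 = 0] (mod int p)"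
    using p1 by (metis cong_0_iff prime_dvd_mult_iff prime_nat_int_transfer)
qed

lemma ered_zz: "[ered ww zz = 0] (mod int p)"
proof -
  have "ered ww zz = (1 + WW) + 2 * WW * ww" by (simp add: ered_def zz_def)
  also have "[\<dots> = (1 + WW) + - (1 + WW)] (mod int p)" by (intro cong_add ww cong_refl)
  finally show ?thesis by simp
qed

lemma ered_econj_zz: "[ered ww (econj zz) = 2] (mod int p)"
proof -
  have "ered ww (econj zz) = 2 - ered ww zz" by (simp add: ered_def zz_def algebra_simps)
  also have "[\<dots> = 2 - 0] (mod int p)" by (intro cong_diff cong_refl ered_zz)
  finally show ?thesis by simp
qed

lemma jac_eq: "jac = - zz"
proof -
  obtain u where u: "enorm u = 1" "jac = u * zz"
    using jac_associated[OF ered_zz enorm_zz] by metis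
  have m3: "idcong (of_int 3) 0 (u * zz) (- 1)" using jac_mod_3 u by simp
  have "u = - 1" using eis_unit_cases[OF u(1)] m3
    unfolding zz_def eis_idcong_iff cong_iff_dvd_diff
    by (elim insertE emptyE; simp add: om_square; presburger)
  then show ?thesis using u by simp
qed

lemma p_not_7: "p \<noteq> 7" and p_not_2: "p \<noteq> 2"
proof -
  have "1 \<le> k\<^sup>2" using k_pos by (intro one_le_power) simp
  then have "int p > 7" using p_k by (simp add: power_mult_distrib)
  then show "p \<noteq> 7" "p \<noteq> 2" by auto
qed

lemma pjac_mod_42: "idcong (of_int 42) 0 (of_int (int p) * jac) (- 1)"
proof -
  have "of_int (int p) * jac - - 1 = of_int 42 * - (of_int (3 * 42 * k * k) * zz + of_int k * Eis 1 2)"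
    unfolding jac_eq p_k by (rule eis_eqI) (simp_all add: zz_def power2_eq_square algebra_simps)
  then show ?thesis unfolding idcong_zero_iff by (metis dvd_triv_left)
qed

lemma pjac_mod: "int q dvd 42 \<Longrightarrow> idcong (of_int (int q)) 0 (of_int (int p) * jac) (- 1)"
  using pjac_mod_42 unfolding idcong_zero_iff of_int_dvd_eis_iff by (meson dvd_trans)

lemma cres_7: "cres 7 = 1"
proof -
  have "idcong (of_int (int 7)) 0 ((of_int (int p) * jac) ^ ((7\<^sup>2 - 1) div 3)) ((- 1) ^ ((7\<^sup>2 - 1) div 3))"
    by (intro idcong_power pjac_mod) simp
  then have "cres (int 7) = om ^ 0"
    using p_not_7 by (intro om_power_cres_eqI) auto
  then show ?thesis by simp
qed

lemma cres_2: "cres 2 = 1"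
proof -
  have "idcong (of_int (int 2)) 0 ((of_int (int p) * jac) ^ ((2\<^sup>2 - 1) div 3)) ((- 1) ^ ((2\<^sup>2 - 1) div 3))"
    by (intro idcong_power pjac_mod) simp
  also have "idcong (of_int (int 2)) 0 ((- 1) ^ ((2\<^sup>2 - 1) div 3)) (om ^ 0)"
    unfolding eis_idcong_iff by (simp add: cong_def)
  finally have "cres (int 2) = om ^ 0"
    using p_not_2 by (intro om_power_cres_eqI) auto
  then show ?thesis by simp
qed

lemma power_nn_eq_1:
  assumes "[a ^ (2 * nn) = 1] (mod int p)" "[a ^ (3 * nn) = 1] (mod int p)"
  shows "[a ^ nn = 1] (mod int p)"
proof -
  have "[a ^ nn * a ^ (2 * nn) = a ^ nn * 1] (mod int p)" using assms(1) by (rule cong_scalar_left)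
  moreover have "a ^ nn * a ^ (2 * nn) = a ^ (3 * nn)"
    unfolding power_add[symmetric] by (rule arg_cong[where f = "power a"]) simp
  ultimately show ?thesis using assms(2) cong_sym cong_trans by fastforce
qed

abbreviation sq :: "int \<Rightarrow> bool" where "sq a \<equiv> [a ^ (3 * nn) = 1] (mod int p)"

lemma sq_mult: "sq a \<Longrightarrow> sq b \<Longrightarrow> sq (a * b)"
  using cong_mult[of "a ^ (3 * nn)" 1 "int p" "b ^ (3 * nn)" 1] by (simp add: power_mult_distrib)

lemma sq_square: "\<not> int p dvd a \<Longrightarrow> sq (a\<^sup>2)"
  using fermat_int[OF prime_p, of a] p_eq by (simp flip: power_mult)

lemma even_nn: "even nn"
  by (simp add: nn_def nat_mult_distrib)

lemma sq_minus_1: "sq (- 1)"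
  using even_nn by simp

lemma sq_minus_3: "sq (- 3)"
proof -
  have "- 3 * WW\<^sup>2 - 1 = - int p" using p_k by simp
  then have "[- 3 * WW\<^sup>2 = 1] (mod int p)" by (simp only: cong_iff_dvd_diff) simp
  then have "[(- 3 * WW\<^sup>2) ^ (3 * nn) = 1 ^ (3 * nn)] (mod int p)" by (rule cong_pow)
  then have 1: "[(- 3) ^ (3 * nn) * (WW\<^sup>2) ^ (3 * nn) = 1] (mod int p)"
    by (simp only: power_mult_distrib power_one)
  have "\<not> int p dvd WW" using not_dvd_2W dvd_mult[of "int p" WW 2] by blast
  then have "[(- 3) ^ (3 * nn) * (WW\<^sup>2) ^ (3 * nn) = (- 3) ^ (3 * nn) * 1] (mod int p)"
    by (intro cong_scalar_left sq_square)
  then show ?thesis using 1 cong_sym cong_trans by fastforce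
qed

lemma sq_7: "sq 7"
proof -
  have p2: "p > 2" using p_eq n_pos by simp
  have "[int p = 1] (mod 7)" unfolding p_k cong_iff_dvd_diff by (simp add: power2_eq_square)
  then have "Legendre (int p) 7 = Legendre 1 7" by (rule Legendre_eq_of_cong)
  also have "\<dots> = 1" by (auto simp: Legendre_def QuadRes_def cong_def intro: exI[of _ 1])
  finally have 1: "Legendre (int p) (int 7) = 1" by simp
  have "Legendre (int p) (int 7) * Legendre (int 7) (int p) = (- 1) ^ ((p - 1) div 2 * ((7 - 1) div 2))"
    using Quadratic_Reciprocity[of p 7] prime_p p2 p_not_7 by simp
  also have "(p - 1) div 2 = 3 * nn" using p_eq by simp
  also have "(- 1 :: int) ^ (3 * nn * ((7 - 1) div 2)) = 1" using even_nn by simp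
  finally have "Legendre 7 (int p) = 1" using 1 by simp
  then show ?thesis using Legendre_cong[of 7] by (simp add: cong_sym)
qed

lemma ered_econj_jac_eq: "[ered ww (econj jac) = - 2] (mod int p)"
proof -
  have "econj (- zz) = - econj zz" by (simp add: eis_eq_iff)
  then have "ered ww (econj jac) = - ered ww (econj zz)" by (simp add: jac_eq)
  also have "[\<dots> = - 2] (mod int p)" by (rule cong_uminus[OF ered_econj_zz])
  finally show ?thesis .
qed

text \<open>Here \<open>4 * D\<close> is a square and a cube modulo \<open>p\<close>, so
  \<open>(4 * D) ^ nn\<close> is 1 and the sum is -2 modulo \<open>p\<close> by trace two. The
  trivial bounds would still allow p - 2; this is excluded by the three cube roots of
  \<open>- D\<close>, at which the summand vanishes.\<close>

theorem sum_Legendre_trace_two: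
  assumes s: "s = - 1 \<or> s = 27" and c: "\<not> int p dvd c" and D: "D = 16 * s * 7 ^ 5 * c ^ 6"
  shows "(\<Sum>t\<in>{0..<int p}. Legendre (t ^ 3 + D) (int p)) = - 2"
proof -
  have c4: "cres 4 = 1" using chi_mult[of 2 2] cres_2 by simp
  have cs: "cres s = 1"
  proof -
    have "cres 27 = cres 3 ^ 3" using chi_power[of 3 3] by simp
    also have "\<dots> = 1" by (rule chi_cube) (rule p_not_dvd_small; simp)
    finally show ?thesis using s chi_minus[of 1] chi_1 by auto
  qed
  have "cres D = cres 4 ^ 2 * cres s * cres 7 ^ 5 * (cres c ^ 3) ^ 2"
    unfolding D chi_mult chi_power[symmetric] using chi_mult[of 4 4] chi_power[of c 6]
    by (simp add: chi_power)
  then have cD: "cres D = 1" using c4 cs cres_7 chi_cube[OF c] by simp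
  have "\<not> int p dvd 7"
  proof
    assume "int p dvd 7"
    then have "int p dvd int 7" by simp
    then have "p dvd 7" by (simp only: int_dvd_int_iff)
    then show False using primes_dvd_imp_eq[of p 7] p_not_7 p1 by simp
  qed
  then have "\<not> int p dvd 7 ^ 2" "\<not> int p dvd c ^ 3" "\<not> int p dvd 4" "\<not> int p dvd 2"
    using c p_not_dvd_small[of 4] p_not_dvd_small[of 2] prime_dvd_power[OF prime_int_p] by (blast | simp)+
  then have nd: "\<not> int p dvd 2 * (4 * 7 ^ 2 * c ^ 3)"
    using prime_dvd_multD[OF prime_int_p] by blast
  have ss: "sq s"
  proof -
    have "sq (- 1 * (- 3) * 3 ^ 2)"
      by (intro sq_mult sq_minus_1 sq_minus_3 sq_square) (rule p_not_dvd_small; simp)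
    then show ?thesis using s sq_minus_1 by auto
  qed
  \<comment> \<open>What remains outside the square is \<open>s * 7\<close>, and \<open>s\<close> is
    -1 or (-1)(-3) 3^2, so the characters of -1, -3 and 7 decide.\<close>
  have "4 * D = s * 7 * (2 * (4 * 7 ^ 2 * c ^ 3))\<^sup>2"
    unfolding D by (simp add: power_mult_distrib flip: power_mult)
  then have s4D: "sq (4 * D)" using sq_mult[OF sq_mult[OF ss sq_7] sq_square[OF nd]] by simp
  have "cres (4 * D) = 1" using chi_mult[of 4 D] c4 cD by simp
  then have "[1 = (4 * D) ^ (2 * nn)] (mod int p)" using ered_cres[of "4 * D"] by simp
  then have n1: "[(4 * D) ^ nn = 1] (mod int p)" using power_nn_eq_1 s4D cong_sym by blast
  let ?L = "\<lambda>t. Legendre (t ^ 3 + D) (int p)" and ?R = "{0..<int p}"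
  have "[sum ?L ?R = ered ww (econj jac) * (4 * D) ^ nn] (mod int p)" by (rule sum_Legendre_cong)
  also have "[ered ww (econj jac) * (4 * D) ^ nn = - 2 * 1] (mod int p)"
    by (intro cong_mult ered_econj_jac_eq n1)
  finally have S: "[sum ?L ?R = - 2] (mod int p)" by simp
  have D0: "\<not> int p dvd - D"
  proof
    assume "int p dvd - D"
    then show False using cD chi_dvd[of D] by (simp add: eis_eq_iff)
  qed
  \<comment> \<open>\<open>- D\<close> has trivial cubic character; in terms of a primitive root its
    exponent is divisible by 3, which yields a cube root \<open>r\<close>. The others are
    \<open>r * ww\<close> and \<open>r * ww ^ 2\<close>.\<close>
  obtain g where g: "\<not> int p dvd g" "\<And>j. [g ^ j = 1] (mod int p) \<longleftrightarrow> p - 1 dvd j"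
      "\<And>x. \<not> int p dvd x \<Longrightarrow> \<exists>i. [x = g ^ i] (mod int p)"
    using primitive_root_exists[OF p1] by metis
  obtain i where i: "[- D = g ^ i] (mod int p)" using g(3)[OF D0] by blast
  have "[(g ^ i) ^ (2 * nn) = (- D) ^ (2 * nn)] (mod int p)" by (intro cong_pow cong_sym[OF i])
  also have "[(- D) ^ (2 * nn) = ered ww (cres (- D))] (mod int p)" by (rule cong_sym[OF ered_cres])
  finally have "[g ^ (i * (2 * nn)) = 1] (mod int p)" using cD by (simp add: chi_minus power_mult)
  then have "2 * nn * 3 dvd 2 * nn * i" using g(2) p_eq by (simp add: mult.commute mult.left_commute)
  then have "3 dvd i" using n_pos by (simp only: dvd_mult_cancel1 nat_mult_dvd_cancel_disj) simp
  then obtain j where j: "i = 3 * j" by blast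
  define r where "r = g ^ j"
  have r3: "[r ^ 3 = - D] (mod int p)"
    using cong_sym[OF i] by (simp add: r_def j mult.commute flip: power_mult)
  have r0: "\<not> int p dvd r" using g(1) p1 unfolding r_def by (metis prime_dvd_power prime_nat_int_transfer)
  define f where "f = (\<lambda>a. (r * ww ^ a) mod int p)"
  have inj: "inj_on f {..<3}"
  proof (rule inj_onI)
    fix a b :: nat assume ab: "a \<in> {..<3}" "b \<in> {..<3}" "f a = f b"
    then have "[r * ww ^ a = r * ww ^ b] (mod int p)" by (simp add: f_def cong_def)
    then have "[ww ^ a = ww ^ b] (mod int p)"
      using coprime_p[OF r0] by (simp add: cong_mult_lcancel)
    then have "[ered ww (om ^ a) = ered ww (om ^ b)] (mod int p)"
      using ered_om_power cong_sym cong_trans by meson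
    then have "om ^ a = om ^ b" by (rule ered_om_power_inject)
    then show "a = b" using ab by (simp add: om_power_eq_iff cong_def)
  qed
  have fR: "f ` {..<3} \<subseteq> ?R" using p_pos by (auto simp: f_def)
  have f0: "?L t = 0" if tf: "t \<in> f ` {..<3}" for t
  proof -
    from tf obtain a where t: "t = f a" by blast
    have "[t = r * ww ^ a] (mod int p)" by (simp add: t f_def cong_def)
    then have "[t ^ 3 = (r * ww ^ a) ^ 3] (mod int p)" by (rule cong_pow)
    also have "(r * ww ^ a) ^ 3 = r ^ 3 * (ww ^ 3) ^ a"
      by (simp add: power_mult_distrib mult.commute flip: power_mult)
    also have "[\<dots> = - D * 1 ^ a] (mod int p)"
      using ered_om_power[of 3] by (intro cong_mult r3 cong_pow) (simp add: cong_sym)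
    finally have "[t ^ 3 + D = - D * 1 ^ a + D] (mod int p)" by (intro cong_add cong_refl)
    then show ?thesis by (simp add: Legendre_def)
  qed
  have "sum ?L ?R = sum ?L (?R - f ` {..<3})"
    by (rule sum.mono_neutral_right) (use fR f0 in auto)
  also have "\<dots> \<le> (\<Sum>t\<in>?R - f ` {..<3}. 1)" by (intro sum_mono Legendre_bounds)
  also have "\<dots> = int p - 3"
    using fR card_image[OF inj] p_eq n_pos by (simp add: card_Diff_subset of_nat_diff)
  finally have "sum ?L ?R \<le> int p - 3" .
  moreover have "sum ?L ?R \<ge> (\<Sum>t\<in>?R. - 1)" by (intro sum_mono Legendre_bounds)
  ultimately have "\<bar>sum ?L ?R - - 2\<bar> < int p" by simp
  with S show ?thesis by (rule cong_imp_eq_int)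
qed

end

section \<open>Residue classes with prescribed quadratic and cubic characters\<close>

text \<open>The side of cubic reciprocity that lives modulo \<open>q\<close>: for \<open>z\<close>
  of norm \<open>p\<close> it is (p z)^((q^2 - 1)/3), which agrees with (p J)^((q^2 - 1)/3) up to a
  power of the unit relating \<open>z\<close> and J.\<close>

definition Psi :: "nat \<Rightarrow> eis \<Rightarrow> eis" where
  "Psi q z = (of_int (enorm z) * z) ^ ((q\<^sup>2 - 1) div 3)"

lemma Psi_mult: "Psi q (a * b) = Psi q a * Psi q b"
  by (simp add: Psi_def enorm_mult power_mult_distrib mult_ac)

lemma enorm_1 [simp]: "enorm 1 = 1" by (simp add: enorm_def)

lemma Psi_power: "Psi q (a ^ n) = Psi q a ^ n"
  by (induction n) (auto simp: Psi_mult, simp add: Psi_def)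

definition etrace :: "eis \<Rightarrow> int" where "etrace z = 2 * ere z - eim z"

text \<open>Everything that \<open>m\<close> modulo \<open>q\<close> contributes to the characters
  of \<open>q\<close> modulo \<open>p = enorm (zeta m)\<close>: \<open>i\<close> enters the cubic
  one by \<open>cres_prime\<close>, \<open>s\<close> the quadratic one by quadratic
  reciprocity.\<close>

definition local_class :: "nat \<Rightarrow> int \<Rightarrow> nat \<Rightarrow> int \<Rightarrow> bool" where
  "local_class q m i s \<longleftrightarrow>
     idcong (of_int (int q)) 0 (Psi q (zeta m)) (om ^ i) \<and> Legendre (enorm (zeta m)) (int q) = s"

section \<open>Cubic characters modulo a prime at least 5\<close>

locale big_prime =
  fixes q :: nat
  assumes q: "prime q" and q5: "q \<ge> 5"
begin

abbreviation ecg :: "eis \<Rightarrow> eis \<Rightarrow> bool" where "ecg \<equiv> idcong (of_int (int q)) 0"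

definition KK :: nat where "KK = (q\<^sup>2 - 1) div 3"

lemma Psi_KK: "Psi q z = (of_int (enorm z) * z) ^ KK"
  by (simp add: Psi_def KK_def)

lemma prime_int_q: "prime (int q)" using q by simp

lemma not_dvd_small: "0 < c \<Longrightarrow> c < 5 \<Longrightarrow> \<not> int q dvd c"
  using q5 by (auto dest!: zdvd_imp_le)

lemma q_mod_3: "q mod 3 = 1 \<or> q mod 3 = 2"
proof -
  have "\<not> 3 dvd q" using q q5 primes_dvd_imp_eq[of 3 q] by auto
  then show ?thesis by presburger
qed

lemma odd_q: "odd q" using q q5 prime_odd_nat by simp

lemma q_square: "q\<^sup>2 = 3 * KK + 1"
proof -
  have "q\<^sup>2 mod 3 = 1" using q_mod_3 by (auto simp: power2_eq_square mod_mult_eq[of q 3 q, symmetric])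
  then show ?thesis unfolding KK_def by presburger
qed

lemma q_square': "3 * KK = (q - 1) * (q + 1)"
proof -
  have "(q - 1) * (q + 1) = q\<^sup>2 - 1" by (cases q) (auto simp: power2_eq_square)
  then show ?thesis using q_square by linarith
qed

lemma fermat_multiple: "\<not> int q dvd a \<Longrightarrow> q - 1 dvd j \<Longrightarrow> [a ^ j = 1] (mod int q)"
  using cong_pow[OF fermat_int[OF q], of a] by (auto simp: dvd_def power_mult)

lemma Psi_of_int:
  assumes "\<not> int q dvd c" shows "ecg (Psi q (of_int c)) 1"
proof -
  have "Psi q (of_int c) = of_int ((c ^ 3) ^ KK)"
    unfolding Psi_KK by (simp add: power3_eq_cube power2_eq_square flip: of_int_mult of_int_power)
  also have "(c ^ 3) ^ KK = c ^ (3 * KK)" by (simp only: power_mult)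
  also have "ecg (of_int (c ^ (3 * KK))) (of_int 1)"
    unfolding q_square' by (intro idcong_of_int fermat_multiple assms) simp
  finally show ?thesis by simp
qed

lemma Psi_cong: assumes "ecg a b" shows "ecg (Psi q a) (Psi q b)"
  unfolding Psi_KK
  by (intro idcong_power idcong_mult idcong_of_int enorm_idcong assms)

lemma frobenius: "ecg (z ^ q) (of_int (ere z) + of_int (eim z) * om ^ q)"
proof -
  have pw: "[x ^ q = x] (mod int q)" for x
  proof (cases "int q dvd x")
    case False
    have "[x * x ^ (q - 1) = x * 1] (mod int q)" by (intro cong_scalar_left fermat_int q False)
    moreover have "x * x ^ (q - 1) = x ^ q" using q5 by (simp flip: power_Suc)
    ultimately show ?thesis by simp
  next
    case True
    moreover have "x dvd x ^ q" using q5 by (intro dvd_power) auto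
    ultimately have "int q dvd x ^ q" by (rule dvd_trans)
    then show ?thesis using True by (simp add: cong_iff_dvd_diff)
  qed
  have "z = of_int (ere z) + of_int (eim z) * om" by (simp add: eis_eq_iff)
  then have "z ^ q = (of_int (ere z) + of_int (eim z) * om) ^ q" by simp
  also have "ecg \<dots> ((of_int (ere z)) ^ q + (of_int (eim z) * om) ^ q)"
    using prime_power_add_idcong[OF q, where 'a = eis] by simp
  also have "(of_int (ere z)) ^ q + (of_int (eim z) * om) ^ q
      = of_int (ere z ^ q) + of_int (eim z ^ q) * om ^ q"
    by (simp add: power_mult_distrib)
  also have "ecg \<dots> (of_int (ere z) + of_int (eim z) * om ^ q)"
    by (intro idcong_add idcong_mult idcong_of_int pw idcong_refl)
  finally show ?thesis .
qed

lemma ecg_cancel: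
  assumes "ecg (a * z) (b * z)" "\<not> int q dvd enorm z" shows "ecg a b"
proof -
  have "of_int (int q) dvd (a * z - b * z) * econj z"
    using assms(1) unfolding idcong_zero_iff by (rule dvd_mult2)
  also have "(a * z - b * z) * econj z = of_int (enorm z) * (a - b)"
    by (simp add: algebra_simps flip: mult_econj)
  finally have "of_int (int q) dvd of_int (enorm z) * (a - b)" .
  then have "int q dvd enorm z * ere (a - b)" "int q dvd enorm z * eim (a - b)"
    unfolding of_int_dvd_eis_iff by simp_all
  then show ?thesis
    using assms(2) prime_dvd_multD[OF prime_int_q] unfolding idcong_zero_iff of_int_dvd_eis_iff by blast
qed

text \<open>Frobenius applied twice fixes \<open>z\<close>, since om^(q^2) = om; hence z^(q^2 - 1)
  is 1. The argument covers split and inert \<open>q\<close> at once.\<close>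

lemma Psi_cube:
  assumes "\<not> int q dvd enorm z" shows "ecg (Psi q z ^ 3) 1"
proof -
  have "ecg (z ^ q ^ 2) ((of_int (ere z) + of_int (eim z) * om ^ q) ^ q)"
    unfolding power2_eq_square power_mult by (intro idcong_power frobenius)
  also have "ecg \<dots> ((of_int (ere z)) ^ q + (of_int (eim z) * om ^ q) ^ q)"
    using prime_power_add_idcong[OF q, where 'a = eis] by simp
  also have "(of_int (ere z)) ^ q + (of_int (eim z) * om ^ q) ^ q
     = (of_int (ere z)) ^ q + (of_int (eim z)) ^ q * om ^ (q ^ 2)"
    by (simp add: power_mult_distrib power2_eq_square power_mult)
  also have "om ^ (q ^ 2) = om ^ 1" unfolding om_power_eq_iff q_square by (simp add: cong_def)
  also have "ecg ((of_int (ere z)) ^ q + (of_int (eim z)) ^ q * om ^ 1)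
      (of_int (ere z) + of_int (eim z) * om ^ 1)"
    using frobenius[of "of_int c" for c] by (intro idcong_add idcong_mult idcong_refl) simp_all
  also have "\<dots> = z" by (simp add: eis_eq_iff)
  finally have "ecg (z ^ (3 * KK) * z) (1 * z)" unfolding q_square by (simp add: mult.commute)
  then have z1: "ecg (z ^ (3 * KK)) 1" using ecg_cancel assms by blast
  have "ecg (of_int (enorm z ^ (3 * KK))) (of_int 1)"
    unfolding q_square' by (intro idcong_of_int fermat_multiple assms) simp
  then have "ecg (of_int (enorm z ^ (3 * KK)) * z ^ (3 * KK)) (of_int 1 * 1)"
    using z1 by (rule idcong_mult)
  then show ?thesis
    unfolding Psi_KK by (simp add: power_mult_distrib mult.commute flip: power_mult)
qed

lemma ecg_unitI:
  assumes "[c * d = 1] (mod int q)" shows "\<not> int q dvd c"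
proof
  assume "int q dvd c"
  then have "int q dvd c * d" by simp
  then have "int q dvd 1" using assms by (metis cong_dvd_iff)
  then show False using not_dvd_small[of 1] by simp
qed

text \<open>Multiplying \<open>z\<close> by the inverse \<open>c\<close> of its trace gives trace 1
  modulo \<open>q\<close>, hence the class of some \<open>zeta m\<close>. Rational factors change
  neither \<open>Psi\<close> nor the quadratic character of the norm, which is multiplied by
  c^2.\<close>

lemma local_classI:
  assumes "\<not> int q dvd etrace z" "\<not> int q dvd enorm z" "ecg (Psi q z) (om ^ i)"
  shows "\<exists>m. local_class q m i (Legendre (enorm z) (int q))"
proof -
  obtain c where c: "[etrace z * c = 1] (mod int q)"
    using cong_solve_coprime_int[OF coprime_prime_int[OF q assms(1)]] by blast
  define m where "m = c * ere z - 1"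
  have e: "2 * m + 1 - c * eim z = etrace z * c - 1"
    by (simp add: m_def etrace_def algebra_simps)
  have "int q dvd 2 * m + 1 - c * eim z" using c unfolding e cong_iff_dvd_diff .
  then have zc: "ecg (zeta m) (of_int c * z)"
    unfolding eis_idcong_iff cong_iff_dvd_diff by (simp add: zeta_def m_def)
  have nc: "\<not> int q dvd c" using c by (intro ecg_unitI[of c "etrace z"]) (simp add: mult.commute)
  have "ecg (Psi q (zeta m)) (Psi q (of_int c) * Psi q z)"
    using Psi_cong[OF zc] by (simp add: Psi_mult)
  also have "ecg \<dots> (1 * om ^ i)" by (intro idcong_mult Psi_of_int nc assms)
  finally have 1: "ecg (Psi q (zeta m)) (om ^ i)" by simp
  have "[enorm (zeta m) = enorm (of_int c * z)] (mod int q)" using zc by (rule enorm_idcong)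
  then have "Legendre (enorm (zeta m)) (int q) = Legendre (c * c * enorm z) (int q)"
    by (intro Legendre_eq_of_cong) (simp add: enorm_mult power2_eq_square)
  also have "\<dots> = Legendre c (int q) * Legendre c (int q) * Legendre (enorm z) (int q)"
    using q5 by (simp add: Legendre_mult[OF q])
  also have "Legendre c (int q) * Legendre c (int q) = 1"
    using nc by (simp add: Legendre_def cong_0_iff)
  finally show ?thesis using 1 unfolding local_class_def by auto
qed

section \<open>Elements of trace zero\<close>

abbreviation sqm3 :: eis where "sqm3 \<equiv> Eis 1 2"

lemma etrace_0:
  assumes "int q dvd etrace z" shows "ecg z (of_int (ere z) * sqm3)"
  using assms unfolding eis_idcong_iff cong_iff_dvd_diff etrace_def
  by (simp add: dvd_diff_commute mult.commute)

lemma Psi_sqm3: "ecg (Psi q sqm3) 1"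
proof -
  obtain r where r: "q = 2 * r + 1" using odd_q by (elim oddE)
  have "KK * 3 = 4 * (r * (r + 1))" using q_square' by (simp add: r algebra_simps)
  then have "even (KK * 3)" by simp
  then obtain j where j: "KK = 2 * j" by auto
  have e: "enorm sqm3 = 3" by (simp add: enorm_def)
  have "(of_int 3 * sqm3) ^ 2 = of_int ((- 3) ^ 3)" by (simp add: eis_eq_iff power2_eq_square)
  then have "Psi q sqm3 = of_int ((- 3) ^ (3 * j))"
    unfolding Psi_KK e j by (simp only: power_mult of_int_power)
  also have "3 * j = (q - 1) * (r + 1)" using q_square' unfolding j by (simp add: r algebra_simps)
  also have "ecg (of_int ((- 3) ^ ((q - 1) * (r + 1)))) (of_int 1)"
    using not_dvd_small[of 3] by (intro idcong_of_int fermat_multiple) simp_all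
  finally show ?thesis by simp
qed

text \<open>Modulo \<open>q\<close> an element of trace zero is a rational multiple of sqrt(-3), and
  both factors have trivial \<open>Psi\<close>. So an element with nontrivial \<open>Psi\<close>
  always meets the trace condition of \<open>local_classI\<close>.\<close>

lemma Psi_etrace_0:
  assumes "int q dvd etrace z" "\<not> int q dvd enorm z" shows "ecg (Psi q z) 1"
proof -
  have zc: "ecg z (of_int (ere z) * sqm3)" by (rule etrace_0[OF assms(1)])
  have "\<not> int q dvd ere z"
  proof
    assume a: "int q dvd ere z"
    have "[enorm z = enorm (of_int (ere z) * sqm3)] (mod int q)" using zc by (rule enorm_idcong)
    moreover have "int q dvd enorm (of_int (ere z) * sqm3)" using a by (simp add: enorm_mult power2_eq_square)
    ultimately show False using assms(2) cong_dvd_iff by blast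
  qed
  then have "ecg (Psi q (of_int (ere z)) * Psi q sqm3) (1 * 1)"
    by (intro idcong_mult Psi_of_int Psi_sqm3)
  then show ?thesis using Psi_cong[OF zc] idcong_trans by (simp add: Psi_mult)
qed

text \<open>The norm in question is n^2 + 3. If it were never a nonresidue, adding 3 would preserve
  squares modulo \<open>q\<close>; starting from 0, every class would be a square, even a primitive
  root.\<close>

lemma exists_norm_nonresidue: "\<exists>n. Legendre (enorm (Eis (n + 1) 2)) (int q) = - 1"
proof (rule ccontr)
  assume "\<not> ?thesis"
  then have no: "Legendre (n\<^sup>2 + 3) (int q) \<noteq> - 1" for n
    by (simp add: enorm_def power2_eq_square algebra_simps)
  have all: "QuadRes (int q) (3 * int j)" for j
  proof (induction j)
    case 0
    then show ?case by (auto simp: QuadRes_def intro: exI[of _ 0])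
  next
    case (Suc j)
    then obtain n where n: "[n\<^sup>2 = 3 * int j] (mod int q)" unfolding QuadRes_def by blast
    then have n3: "[n\<^sup>2 + 3 = 3 * int (Suc j)] (mod int q)" using cong_add[OF n cong_refl[of 3]] by (simp add: add.commute)
    have "[n\<^sup>2 + 3 = 0] (mod int q) \<or> QuadRes (int q) (n\<^sup>2 + 3)"
      using no[of n] by (auto simp: Legendre_def split: if_splits)
    then show ?case
    proof
      assume "[n\<^sup>2 + 3 = 0] (mod int q)"
      then have "[0\<^sup>2 = 3 * int (Suc j)] (mod int q)" using n3 cong_sym cong_trans by fastforce
      then show ?thesis unfolding QuadRes_def by blast
    next
      assume "QuadRes (int q) (n\<^sup>2 + 3)"
      then show ?thesis using n3 cong_trans unfolding QuadRes_def by blast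
    qed
  qed
  obtain g where g: "\<not> int q dvd g" "\<And>j. [g ^ j = 1] (mod int q) \<longleftrightarrow> q - 1 dvd j"
    using primitive_root_exists[OF q] by metis
  obtain c where "[3 * c = 1] (mod int q)"
    using cong_solve_coprime_int[OF coprime_prime_int[OF q not_dvd_small[of 3]]] by auto
  then have "[3 * c * g = 1 * g] (mod int q)" by (rule cong_scalar_right)
  then obtain b where b: "[3 * b = g] (mod int q)" unfolding mult.assoc mult_1 by blast
  have "int (nat (b mod int q)) = b mod int q" using q5 by simp
  then have "[3 * int (nat (b mod int q)) = 3 * b] (mod int q)"
    by (simp only:) (intro cong_scalar_left, simp add: cong_def)
  then have "QuadRes (int q) g"
    using all[of "nat (b mod int q)"] b cong_trans unfolding QuadRes_def by blast
  then have "Legendre g (int q) = 1" using g(1) by (simp add: Legendre_def cong_0_iff)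
  then have "[1 = g ^ ((q - 1) div 2)] (mod int q)"
    using euler_criterion[OF q, of g] q5 by simp
  then have "q - 1 dvd (q - 1) div 2" using g(2) cong_sym by blast
  then show False using q5 by (auto dest!: dvd_imp_le)
qed

text \<open>Take \<open>z\<close> with reductions \<open>g\<close> and 1 at the two primes above
  \<open>q\<close>, where \<open>g\<close> is a primitive root. Then its norm is \<open>g\<close>,
  and \<open>Psi q z\<close> reduces to g^(2 KK) = w and g^KK = w^2, which are the reductions of
  \<open>om\<close>.\<close>

lemma nontrivial_split:
  assumes "q mod 3 = 1"
  shows "\<exists>z. \<not> int q dvd enorm z \<and> ecg (Psi q z) om"
proof -
  obtain g where g: "\<not> int q dvd g" "\<And>j. [g ^ j = 1] (mod int q) \<longleftrightarrow> q - 1 dvd j"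
    using primitive_root_exists[OF q] by metis
  define l where "l = (q - 1) div 3"
  have l: "q = 3 * l + 1" using assms q5 unfolding l_def by presburger
  have l0: "l > 0" using l q5 by simp
  define w where "w = g ^ l"
  have w3: "[w ^ 3 = 1] (mod int q)" using g(2)[of "l * 3"] l by (simp add: w_def flip: power_mult)
  have w1: "\<not> int q dvd w - 1"
  proof
    assume "int q dvd w - 1"
    then have "q - 1 dvd l" using g(2)[of l] by (simp add: w_def cong_iff_dvd_diff)
    then show False using l l0 by (auto dest: dvd_imp_le)
  qed
  have "w ^ 3 - 1 = (w - 1) * (w\<^sup>2 + w + 1)" by (simp add: power2_eq_square power3_eq_cube algebra_simps)
  then have w: "[w\<^sup>2 + w + 1 = 0] (mod int q)"
    using w3 w1 prime_dvd_multD[OF prime_int_q] unfolding cong_iff_dvd_diff by (metis diff_zero)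
  obtain b0 where b0: "[- 3 * b0 = 1] (mod int q)"
    using cong_solve_coprime_int[OF coprime_prime_int[OF q, of "- 3"]] not_dvd_small[of 3] by auto
  \<comment> \<open>The condition on \<open>b\<close> is b (w - w^2) = g - 1; since (w - w^2)^2 =
    -3, the inverse of w - w^2 is \<open>b0 * (w - w^2)\<close>.\<close>
  define b where "b = b0 * (w - w\<^sup>2) * (g - 1)"
  define z where "z = Eis (g - b * w) b"
  have e1: "ered w z = g" by (simp add: z_def ered_def)
  have w4: "[w - (- 1 - w) = w - w\<^sup>2] (mod int q)" and
    ww: "[(w - w\<^sup>2) * (w - w\<^sup>2) = - 3] (mod int q)"
  proof -
    have "int q dvd w\<^sup>2 + w + 1" using w by (simp add: cong_0_iff)
    then show "[w - (- 1 - w) = w - w\<^sup>2] (mod int q)" by (simp add: cong_iff_dvd_diff algebra_simps)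
    have "(w - w\<^sup>2) * (w - w\<^sup>2) - - 3 = (w\<^sup>2 + w + 1) * (w\<^sup>2 - 3 * w + 3)"
      by (simp add: power2_eq_square algebra_simps)
    then show "[(w - w\<^sup>2) * (w - w\<^sup>2) = - 3] (mod int q)"
      using \<open>int q dvd w\<^sup>2 + w + 1\<close> by (simp add: cong_iff_dvd_diff)
  qed
  have e2: "[ered w (econj z) = 1] (mod int q)"
  proof -
    have "ered w (econj z) = g - b * (w - (- 1 - w))" by (simp add: z_def ered_def algebra_simps)
    also have "[\<dots> = g - b * (w - w\<^sup>2)] (mod int q)" by (intro cong_diff cong_refl cong_scalar_left w4)
    also have "g - b * (w - w\<^sup>2) = g - b0 * (g - 1) * ((w - w\<^sup>2) * (w - w\<^sup>2))" by (simp add: b_def ac_simps)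
    also have "[\<dots> = g - b0 * (g - 1) * - 3] (mod int q)" by (intro cong_diff cong_refl cong_scalar_left ww)
    also have "g - b0 * (g - 1) * - 3 = g - (- 3 * b0) * (g - 1)" by simp
    also have "[\<dots> = g - 1 * (g - 1)] (mod int q)" by (intro cong_diff cong_refl cong_scalar_right b0)
    finally show ?thesis by simp
  qed
  have en: "[enorm z = g] (mod int q)"
  proof -
    have "[ered w (z * econj z) = ered w z * ered w (econj z)] (mod int q)" by (rule ered_mult[OF w])
    also have "[ered w z * ered w (econj z) = g * 1] (mod int q)" unfolding e1 by (intro cong_scalar_left e2)
    finally show ?thesis by (simp add: mult_econj)
  qed
  then have nz: "\<not> int q dvd enorm z" using g(1) cong_dvd_iff by blast
  have gK: "[g ^ KK = w\<^sup>2] (mod int q)"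
  proof -
    have "KK * 3 = l * (q + 1) * 3" using q_square' l by simp
    then have "KK = l * (3 * l + 2)" using l by simp
    then have "g ^ KK = (w ^ 3) ^ l * w\<^sup>2" by (simp add: w_def algebra_simps flip: power_mult power_add)
    also have "[\<dots> = 1 ^ l * w\<^sup>2] (mod int q)" by (intro cong_scalar_right cong_pow w3)
    finally show ?thesis by simp
  qed
  have P: "[ered w (Psi q y) = (enorm y * ered w y) ^ KK] (mod int q)" for y
  proof -
    have "[ered w (Psi q y) = ered w (of_int (enorm y) * y) ^ KK] (mod int q)"
      unfolding Psi_KK by (rule ered_power[OF w])
    also have "[ered w (of_int (enorm y) * y) ^ KK = (enorm y * ered w y) ^ KK] (mod int q)"
      using ered_mult[OF w, of "of_int (enorm y)" y] by (intro cong_pow) simp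
    finally show ?thesis .
  qed
  have w22: "[w\<^sup>2 * w\<^sup>2 = w] (mod int q)"
  proof -
    have "w\<^sup>2 * w\<^sup>2 = w ^ 3 * w" by (simp add: power2_eq_square power3_eq_cube)
    then show ?thesis using cong_scalar_right[OF w3, of w] by simp
  qed
  have "[ered w (Psi q z) = (enorm z * ered w z) ^ KK] (mod int q)" by (rule P)
  also have "[(enorm z * ered w z) ^ KK = (g * g) ^ KK] (mod int q)"
    unfolding e1 by (intro cong_pow cong_mult en cong_refl)
  also have "(g * g) ^ KK = g ^ KK * g ^ KK" by (simp add: power_mult_distrib)
  also have "[\<dots> = w\<^sup>2 * w\<^sup>2] (mod int q)" by (intro cong_mult gK)
  also have "[w\<^sup>2 * w\<^sup>2 = w] (mod int q)" by (rule w22)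
  finally have 1: "[ered w (Psi q z - om) = 0] (mod int q)" by (simp add: cong_iff_dvd_diff)
  have cP: "econj (Psi q z) = Psi q (econj z)"
  proof -
    have "enorm (econj z) = enorm z" by (simp add: enorm_def power2_eq_square algebra_simps)
    then show ?thesis by (simp add: Psi_KK econj_power econj_hom)
  qed
  have "[ered w (Psi q (econj z)) = (enorm (econj z) * ered w (econj z)) ^ KK] (mod int q)" by (rule P)
  also have "enorm (econj z) = enorm z" by (simp add: enorm_def power2_eq_square algebra_simps)
  also have "[(enorm z * ered w (econj z)) ^ KK = (g * 1) ^ KK] (mod int q)"
    by (intro cong_pow cong_mult en e2)
  also have "[(g * 1) ^ KK = w\<^sup>2] (mod int q)" using gK by simp
  finally have "[ered w (econj (Psi q z)) = w\<^sup>2] (mod int q)" by (simp add: cP)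
  moreover have "ered w (econj (Psi q z - om)) = ered w (econj (Psi q z)) + w + 1"
    by (simp add: ered_def algebra_simps)
  ultimately have "[ered w (econj (Psi q z - om)) = w\<^sup>2 + w + 1] (mod int q)"
    by (simp only:) (intro cong_add cong_refl)
  then have 2: "[ered w (econj (Psi q z - om)) = 0] (mod int q)" using w cong_trans by blast
  have "ecg (Psi q z) om" unfolding idcong_zero_iff
    by (rule ered_both_zero[OF prime_int_q _ w 1 2]) (rule not_dvd_small, simp_all)
  then show ?thesis using nz by blast
qed

text \<open>If \<open>q\<close> divides the norm then a^3 = (-b)^3 modulo \<open>q\<close>, and
  cubing is injective because 3 does not divide q - 1. So a = -b, and the norm becomes 3
  b^2.\<close>

lemma inert_norm:
  assumes "q mod 3 = 2" "int q dvd enorm z" shows "of_int (int q) dvd z"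
proof -
  define a b where "a = ere z" and "b = eim z"
  define l where "l = (q - 2) div 3"
  have l: "q - 1 = 3 * l + 1" using assms(1) q5 unfolding l_def by presburger
  have N: "int q dvd a\<^sup>2 - a * b + b\<^sup>2" using assms(2) by (simp add: enorm_def a_def b_def)
  have "int q dvd b"
  proof (rule ccontr)
    assume nb: "\<not> int q dvd b"
    have na: "\<not> int q dvd a"
    proof
      assume "int q dvd a"
      then have "int q dvd (a\<^sup>2 - a * b + b\<^sup>2) - a * (a - b)" using N by (intro dvd_diff dvd_mult2)
      then have "int q dvd b\<^sup>2" by (simp add: power2_eq_square algebra_simps)
      then show False using nb prime_dvd_power[OF prime_int_q] by blast
    qed
    have "a ^ 3 - (- b) ^ 3 = (a + b) * (a\<^sup>2 - a * b + b\<^sup>2)"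
      by (simp add: power2_eq_square power3_eq_cube algebra_simps)
    then have c3: "[a ^ 3 = (- b) ^ 3] (mod int q)" using N by (simp add: cong_iff_dvd_diff)
    have "[a * (a ^ 3) ^ l = a * ((- b) ^ 3) ^ l] (mod int q)" by (intro cong_scalar_left cong_pow c3)
    moreover have "a * (a ^ 3) ^ l = a ^ (q - 1)" unfolding l by (simp add: power_mult)
    ultimately have "[a * ((- b) ^ 3) ^ l = 1] (mod int q)"
      using fermat_int[OF q na] cong_sym cong_trans by metis
    moreover have "(- b) * ((- b) ^ 3) ^ l = (- b) ^ (q - 1)" unfolding l by (simp add: power_mult)
    then have "[(- b) * ((- b) ^ 3) ^ l = 1] (mod int q)"
      using fermat_int[OF q, of "- b"] nb by simp
    ultimately have "[a * ((- b) ^ 3) ^ l = (- b) * ((- b) ^ 3) ^ l] (mod int q)"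
      using cong_sym cong_trans by blast
    moreover have "\<not> int q dvd ((- b) ^ 3) ^ l"
      using nb prime_dvd_power[OF prime_int_q] dvd_minus_iff by blast
    ultimately have "[a = - b] (mod int q)"
      using coprime_prime_int[OF q] by (metis cong_mult_rcancel)
    then have ab: "int q dvd a + b" by (simp add: cong_iff_dvd_diff)
    have "int q dvd (a\<^sup>2 - a * b + b\<^sup>2) - (a + b) * (a - 2 * b)"
      by (rule dvd_diff[OF N dvd_mult2[OF ab]])
    then have "int q dvd 3 * b\<^sup>2" by (simp add: power2_eq_square algebra_simps)
    then have "int q dvd b\<^sup>2" using not_dvd_small[of 3] prime_dvd_multD[OF prime_int_q] by fastforce
    then show False using nb prime_dvd_power[OF prime_int_q] by blast
  qed
  moreover from this have "int q dvd (a\<^sup>2 - a * b + b\<^sup>2) - b * (b - a)" using N by (intro dvd_diff dvd_mult2)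
  then have "int q dvd a\<^sup>2" by (simp add: power2_eq_square algebra_simps)
  then have "int q dvd a" using prime_dvd_power[OF prime_int_q] by blast
  ultimately show ?thesis unfolding of_int_dvd_eis_iff a_def b_def by blast
qed

text \<open>If \<open>(n + \<omega>)\<^sup>k\<close> were rational modulo \<open>q\<close> for all \<open>n\<close>, then so would be the power sum
  below, whose only surviving term is the one with \<open>\<omega>\<^sup>1\<close>.\<close>

lemma nontrivial_inert:
  assumes q2: "q mod 3 = 2"
  shows "\<exists>z. \<not> int q dvd enorm z \<and> (ecg (Psi q z) om \<or> ecg (Psi q z) (om ^ 2))"
proof -
  let ?R = "{0..<int q}"
  define k where "k = (q + 1) div 3"
  have k: "q + 1 = 3 * k" using q2 unfolding k_def by presburger
  have k0: "k > 0" "k < q" using k q5 by auto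
  have N1: "\<not> int q dvd enorm (Eis n 1)" for n
  proof
    assume "int q dvd enorm (Eis n 1)"
    then have "int q dvd eim (Eis n 1)" using inert_norm[OF q2] unfolding of_int_dvd_eis_iff by blast
    then have "int q dvd 1" by simp
    then show False using not_dvd_small[of 1] by simp
  qed
  have "\<exists>n. \<not> ecg (Psi q (Eis n 1)) 1"
  proof (rule ccontr)
    assume "\<not> ?thesis"
    then have all: "ecg (Psi q (Eis n 1)) 1" for n by blast
    have im: "int q dvd eim ((Eis n 1) ^ k)" for n
    proof -
      let ?z = "Eis n 1"
      have "om ^ q = om ^ 2" unfolding om_power_eq_iff using q2 by (simp add: cong_def)
      then have F: "ecg (?z ^ q) (econj ?z)"
        using frobenius[of ?z] by (simp add: om_square econj_def plus_eis_def)
      \<comment> \<open>In the inert case Frobenius is conjugation. Trivial \<open>Psi\<close>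
        therefore means z^((q - 1) k) = 1, so that z^k equals its conjugate.\<close>
      have KKk: "KK = (q - 1) * k" using q_square' unfolding k by simp
      have "ecg (of_int (enorm ?z ^ KK)) (of_int 1)"
        by (intro idcong_of_int fermat_multiple N1) (simp add: KKk)
      then have "ecg (of_int (enorm ?z ^ KK) * ?z ^ KK) (of_int 1 * ?z ^ KK)" by (rule idcong_mult) simp
      then have "ecg (Psi q ?z) (?z ^ KK)" by (simp add: Psi_KK power_mult_distrib)
      then have "ecg (?z ^ KK) 1" using all idcong_sym idcong_trans by blast
      then have 1: "ecg (?z ^ KK * ?z ^ k) (1 * ?z ^ k)" by (rule idcong_mult) simp
      have "?z ^ KK * ?z ^ k = (?z ^ q) ^ k"
        unfolding power_mult[symmetric] power_add[symmetric] KKk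
        by (rule arg_cong[where f = "power ?z"]) (use q5 in \<open>simp add: algebra_simps\<close>)
      then have "ecg ((?z ^ q) ^ k) (?z ^ k)" using 1 by simp
      moreover have "ecg ((?z ^ q) ^ k) (econj (?z ^ k))"
        unfolding econj_power by (rule idcong_power[OF F])
      ultimately have "ecg (?z ^ k) (econj (?z ^ k))" using idcong_sym idcong_trans by blast
      then have "int q dvd 2 * eim (?z ^ k)" unfolding eis_idcong_iff cong_iff_dvd_diff by simp
      then show ?thesis using prime_dvd_multD[OF prime_int_q] not_dvd_small[of 2] by fastforce
    qed
    have exp: "eim ((Eis n 1) ^ k) = (\<Sum>j\<le>k. int (k choose j) * eim (om ^ j) * n ^ (k - j))" for n
    proof -
      have eim_sum: "eim (sum f A) = (\<Sum>x\<in>A. eim (f x))" for f :: "nat \<Rightarrow> eis" and A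
        by (induction A rule: infinite_finite_induct) auto
      have "Eis n 1 = om + of_int n" by (simp add: eis_eq_iff)
      then have "(Eis n 1) ^ k = (\<Sum>j\<le>k. of_nat (k choose j) * om ^ j * of_int (n ^ (k - j)))"
        by (simp add: binomial_ring)
      then show ?thesis by (simp only: eim_sum) (simp add: mult.commute del: of_int_power)
    qed
    \<comment> \<open>The weight n^(q - k) shifts the exponent k - j of the binomial term to q - j,
      which is q - 1 precisely for j = 1.\<close>
    have "[(\<Sum>n\<in>?R. n ^ (q - k) * eim ((Eis n 1) ^ k)) = (\<Sum>n\<in>?R. n ^ (q - k) * 0)] (mod int q)"
      by (intro cong_sum cong_scalar_left) (simp add: cong_0_iff im)
    moreover have "(\<Sum>n\<in>?R. n ^ (q - k) * eim ((Eis n 1) ^ k))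
        = (\<Sum>j\<le>k. int (k choose j) * eim (om ^ j) * (\<Sum>n\<in>?R. n ^ (q - j)))"
    proof -
      have "(\<Sum>n\<in>?R. n ^ (q - k) * eim ((Eis n 1) ^ k))
        = (\<Sum>n\<in>?R. \<Sum>j\<le>k. int (k choose j) * eim (om ^ j) * (n ^ (q - k) * n ^ (k - j)))"
        unfolding exp sum_distrib_left by (simp add: mult_ac)
      also have "\<dots> = (\<Sum>n\<in>?R. \<Sum>j\<le>k. int (k choose j) * eim (om ^ j) * n ^ (q - j))"
        using k0 by (intro sum.cong refl) (simp flip: power_add)
      finally show ?thesis by (subst (asm) sum.swap) (simp add: sum_distrib_left)
    qed
    moreover have "[(\<Sum>j\<le>k. int (k choose j) * eim (om ^ j) * (\<Sum>n\<in>?R. n ^ (q - j)))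
        = (\<Sum>j\<le>k. if j = 1 then - int k else 0)] (mod int q)"
    proof (intro cong_sum)
      fix j assume j: "j \<in> {..k}"
      consider "j = 0" | "j = 1" | "j \<ge> 2" by linarith
      then show "[int (k choose j) * eim (om ^ j) * (\<Sum>n\<in>?R. n ^ (q - j)) = (if j = 1 then - int k else 0)] (mod int q)"
      proof cases
        case 2
        have "[(\<Sum>n\<in>?R. n ^ (q - 1)) = - 1] (mod int q)"
          using power_sum_mod_prime[OF q, of "q - 1"] q5 by simp
        then have "[int k * (\<Sum>n\<in>?R. n ^ (q - 1)) = int k * - 1] (mod int q)" by (rule cong_scalar_left)
        then show ?thesis using 2 by simp
      next
        case 3
        have "\<not> (q - j > 0 \<and> q - 1 dvd q - j)" using 3 j k0 by (auto dest: dvd_imp_le)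
        then have "[(\<Sum>n\<in>?R. n ^ (q - j)) = 0] (mod int q)"
          using power_sum_mod_prime[OF q, of "q - j"] by (simp split: if_splits)
        then have "[int (k choose j) * eim (om ^ j) * (\<Sum>n\<in>?R. n ^ (q - j)) = int (k choose j) * eim (om ^ j) * 0] (mod int q)"
          by (rule cong_scalar_left)
        then show ?thesis using 3 by simp
      qed simp
    qed
    ultimately have "[0 = (\<Sum>j\<le>k. if j = 1 then - int k else 0)] (mod int q)"
      using cong_sym cong_trans by fastforce
    then have "[0 = - int k] (mod int q)" using k0 by (simp add: sum.delta)
    then have "int q dvd 0 - - int k" by (simp only: cong_iff_dvd_diff)
    then have "int q dvd int k" by simp
    then show False using k0 by (simp add: nat_dvd_not_less)
  qed
  then obtain n where n: "\<not> ecg (Psi q (Eis n 1)) 1" by blast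
  define P where "P = Psi q (Eis n 1)"
  have "ecg (P ^ 3) 1" unfolding P_def by (rule Psi_cube[OF N1])
  then have "of_int (int q) dvd P ^ 3 - 1" by (simp add: idcong_zero_iff)
  \<comment> \<open>The three factors correspond to the three possible values; passing to norms
    shows that \<open>q\<close>, being inert, divides one of them.\<close>
  moreover have "P ^ 3 - 1 = (P - 1) * ((P - om) * (P - om ^ 2))"
    by (rule eis_eqI) (simp_all add: power2_eq_square power3_eq_cube algebra_simps)
  ultimately have "of_int (int q) dvd (P - 1) * ((P - om) * (P - om ^ 2))" by simp
  then obtain v where v: "(P - 1) * ((P - om) * (P - om ^ 2)) = of_int (int q) * v" by blast
  have "enorm (P - 1) * (enorm (P - om) * enorm (P - om ^ 2)) = (int q)\<^sup>2 * enorm v"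
    using arg_cong[OF v, of enorm] by (simp only: enorm_mult enorm_of_int)
  then have "int q dvd enorm (P - 1) * (enorm (P - om) * enorm (P - om ^ 2))"
    by (simp add: power2_eq_square)
  then have "int q dvd enorm (P - 1) \<or> int q dvd enorm (P - om) \<or> int q dvd enorm (P - om ^ 2)"
    using prime_dvd_multD[OF prime_int_q] by blast
  then have "ecg P 1 \<or> ecg P om \<or> ecg P (om ^ 2)"
    using inert_norm[OF q2] unfolding idcong_zero_iff by blast
  then show ?thesis using n N1 unfolding P_def by blast
qed

section \<open>Existence of classes with prescribed characters at q\<close>

lemma Legendre_power: "Legendre (a ^ n) (int q) = Legendre a (int q) ^ n"
proof (induction n)
  case 0
  have "\<not> int q dvd 1" by (rule not_dvd_small) auto
  then show ?case by (auto simp: Legendre_def QuadRes_def cong_0_iff intro: exI[of _ 1])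
next
  case (Suc n)
  then show ?case using q5 by (simp add: Legendre_mult[OF q])
qed

lemma Legendre_nonzero: "Legendre a (int q) \<noteq> 0 \<Longrightarrow> \<not> int q dvd a"
  by (auto simp: Legendre_def cong_0_iff)

lemma Legendre_values: "\<not> int q dvd a \<Longrightarrow> Legendre a (int q) = 1 \<or> Legendre a (int q) = - 1"
  by (auto simp: Legendre_def cong_0_iff)

lemma nontrivial_class:
  assumes "\<not> [i = 0] (mod 3)"
  obtains z where "Legendre (enorm z) (int q) = 1" "ecg (Psi q z) (om ^ i)"
proof -
  obtain z j where z: "\<not> int q dvd enorm z" "ecg (Psi q z) (om ^ j)" "j = 1 \<or> j = 2"
  proof (cases "q mod 3 = 1")
    case True
    then show thesis using nontrivial_split[OF True] that[of _ 1] by auto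
  next
    case False
    then have "q mod 3 = 2" using q_mod_3 by simp
    then show thesis using nontrivial_inert that[of _ 1] that[of _ 2] by auto
  qed
  \<comment> \<open>A fourth power has a square norm, and 4 is 1 modulo 3, so fourth powers do not
    restrict the cubic character.\<close>
  have "\<exists>e. [j * (4 * e) = i] (mod 3) \<and> e > 0"
  proof -
    have "i mod 3 = 1 \<or> i mod 3 = 2" using assms unfolding cong_def by presburger
    then show ?thesis
      using z(3) by (elim disjE) (rule exI[of _ 1] exI[of _ 2], simp add: cong_def; fail)+
  qed
  then obtain e where e: "[j * (4 * e) = i] (mod 3)" by blast
  show thesis
  proof
    have "Legendre (enorm (z ^ (4 * e))) (int q) = (Legendre (enorm z) (int q) ^ 4) ^ e"
      by (simp add: enorm_power Legendre_power power_mult)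
    then show "Legendre (enorm (z ^ (4 * e))) (int q) = 1" using Legendre_values[OF z(1)] by auto
    have "ecg (Psi q (z ^ (4 * e))) ((om ^ j) ^ (4 * e))" unfolding Psi_power by (rule idcong_power[OF z(2)])
    also have "(om ^ j) ^ (4 * e) = om ^ i" unfolding power_mult[symmetric] om_power_eq_iff by (rule e)
    finally show "ecg (Psi q (z ^ (4 * e))) (om ^ i)" .
  qed
qed

lemma nontrivial_etrace:
  assumes "\<not> [i = 0] (mod 3)" "ecg (Psi q z) (om ^ i)" "\<not> int q dvd enorm z"
  shows "\<not> int q dvd etrace z"
proof
  assume "int q dvd etrace z"
  then have "ecg (Psi q z) 1" using assms(3) by (rule Psi_etrace_0)
  then have "ecg (om ^ i) (om ^ 0)" unfolding power_0 using assms(2) idcong_sym idcong_trans by blast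
  then have "[i = 0] (mod 3)" by (rule om_power_idcong) (rule not_dvd_small; simp)
  then show False using assms(1) by blast
qed

theorem local_class_square: "\<exists>m. local_class q m i 1"
proof (cases "[i = 0] (mod 3)")
  case True
  have "om ^ i = 1" using True om_power_eq_iff[of i 0] by simp
  then have "ecg (Psi q 1) (om ^ i)" by (simp add: Psi_KK)
  moreover have "etrace 1 = 2" by (simp add: etrace_def)
  moreover have "Legendre 1 (int q) = 1" using Legendre_power[of 1 0] by simp
  ultimately show ?thesis
    using local_classI[of 1 i] not_dvd_small[of 1] not_dvd_small[of 2] by simp
next
  case False
  then obtain z where z: "Legendre (enorm z) (int q) = 1" "ecg (Psi q z) (om ^ i)"
    by (rule nontrivial_class)
  then show ?thesis
    using local_classI[OF nontrivial_etrace[OF False], of z] Legendre_nonzero[of "enorm z"] by simp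
qed

text \<open>A factor y^3 with nonresidue norm changes the sign but not \<open>Psi\<close>;
  nontriviality of \<open>Psi\<close> takes care of the trace.\<close>

theorem local_class_nonsquare:
  assumes "\<not> [i = 0] (mod 3)" shows "\<exists>m. local_class q m i (- 1)"
proof -
  obtain z where z: "Legendre (enorm z) (int q) = 1" "ecg (Psi q z) (om ^ i)"
    using assms by (rule nontrivial_class)
  obtain y where y: "Legendre (enorm y) (int q) = - 1" using exists_norm_nonresidue by blast
  have y0: "\<not> int q dvd enorm y" using y by (intro Legendre_nonzero) simp
  have "ecg (Psi q (y ^ 3 * z)) (1 * om ^ i)"
    unfolding Psi_mult Psi_power by (intro idcong_mult Psi_cube y0 z)
  then have 1: "ecg (Psi q (y ^ 3 * z)) (om ^ i)" by simp
  have 2: "Legendre (enorm (y ^ 3 * z)) (int q) = - 1"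
    using y z q5 by (simp add: enorm_mult enorm_power Legendre_mult[OF q] Legendre_power)
  then have 3: "\<not> int q dvd enorm (y ^ 3 * z)" by (intro Legendre_nonzero) simp
  show ?thesis using local_classI[OF nontrivial_etrace[OF assms 1 3] 3 1] 2 by simp
qed

text \<open>A cube y^3 of nonresidue norm has the right characters but may have trace zero. Then it
  is a multiple of sqrt(-3), and a factor t^6, which changes neither character, makes the trace
  nonzero. For q = 5 and q = 7 all elements with these characters have trace zero, whence the
  bound.\<close>

theorem local_class_nonsquare_trivial:
  assumes "q \<ge> 11" shows "\<exists>m. local_class q m 0 (- 1)"
proof -
  obtain y where y: "Legendre (enorm y) (int q) = - 1" using exists_norm_nonresidue by blast
  have y0: "\<not> int q dvd enorm y" using y by (intro Legendre_nonzero) simp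
  have P: "ecg (Psi q (y ^ 3)) (om ^ 0)" using Psi_cube[OF y0] by (simp add: Psi_power)
  have L: "Legendre (enorm (y ^ 3)) (int q) = - 1" using y by (simp add: enorm_power Legendre_power)
  have N: "\<not> int q dvd enorm (y ^ 3)" using L by (intro Legendre_nonzero) simp
  show ?thesis
  proof (cases "int q dvd etrace (y ^ 3)")
    case False
    then show ?thesis using local_classI[OF False N P] L by simp
  next
    case True
    \<comment> \<open>The choice t = 3 + 4 om has norm 13 and gives the trace -2^3 * 3^3 * 5 * 7, so
      it serves every \<open>q >= 11\<close> except 13, which is treated by its own element.\<close>
    obtain t where t: "\<not> int q dvd enorm t" "\<not> int q dvd etrace (sqm3 * t ^ 6)"
    proof (cases "q = 13")
      case True
      show thesis by (rule that[of "Eis 4 6"]) (simp_all add: True enorm_def etrace_def eval_nat_numeral)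
    next
      case False
      have nd: "\<not> int q dvd int r" if "prime r" "r \<noteq> q" for r
        using that q by (auto simp: primes_dvd_imp_eq simp flip: int_dvd_int_iff dest: primes_dvd_imp_eq)
      have 1: "\<not> int q dvd enorm (Eis 3 4)" using nd[of 13] False by (simp add: enorm_def)
      have e: "- etrace (sqm3 * Eis 3 4 ^ 6) = 2 ^ 3 * (3 ^ 3 * (5 * 7))"
        by (simp add: etrace_def eval_nat_numeral)
      have "\<not> int q dvd 2" "\<not> int q dvd 3" "\<not> int q dvd 5" "\<not> int q dvd 7"
        using assms nd[of 2] nd[of 3] nd[of 5] nd[of 7] by simp_all
      then have "\<not> int q dvd 2 ^ 3 * (3 ^ 3 * (5 * 7))"
        using prime_dvd_multD[OF prime_int_q] prime_dvd_power[OF prime_int_q] by blast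
      then have 2: "\<not> int q dvd etrace (sqm3 * Eis 3 4 ^ 6)" unfolding e[symmetric] dvd_minus_iff .
      show thesis by (rule that[OF 1 2])
    qed
    have yc: "ecg (y ^ 3) (of_int (ere (y ^ 3)) * sqm3)" by (rule etrace_0[OF True])
    have c0: "\<not> int q dvd ere (y ^ 3)"
    proof
      assume "int q dvd ere (y ^ 3)"
      then have "int q dvd enorm (of_int (ere (y ^ 3)) * sqm3)" by (simp add: enorm_mult power2_eq_square)
      then show False using enorm_idcong[OF yc] N cong_dvd_iff by blast
    qed
    define u where "u = y ^ 3 * t ^ 6"
    have "ecg u (of_int (ere (y ^ 3)) * sqm3 * t ^ 6)" unfolding u_def by (rule idcong_mult[OF yc]) simp
    then have "ecg u (of_int (ere (y ^ 3)) * (sqm3 * t ^ 6))" by (simp only: mult.assoc)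
    then have "[etrace u = ere (y ^ 3) * etrace (sqm3 * t ^ 6)] (mod int q)"
      unfolding eis_idcong_iff etrace_def
      by (metis (no_types, lifting) cong_diff cong_scalar_left ere_simps(6) eim_simps(6) of_int_eis mult_zero_left diff_zero add_0_right mult.left_commute right_diff_distrib')
    then have 1: "\<not> int q dvd etrace u"
      using c0 t(2) prime_dvd_multD[OF prime_int_q] cong_dvd_iff by blast
    have "ecg (Psi q u) (om ^ 0 * (1 ^ 2))"
      unfolding u_def Psi_mult Psi_power[of q t 6] using P idcong_power[OF Psi_cube[OF t(1)], of 2]
      by (intro idcong_mult) (simp_all flip: power_mult)
    then have 2: "ecg (Psi q u) (om ^ 0)" by simp
    have "Legendre (enorm u) (int q) = - 1 * Legendre (enorm t) (int q) ^ 6"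
      unfolding u_def using L q5 by (simp add: enorm_mult enorm_power[of t] Legendre_mult[OF q] Legendre_power)
    then have 3: "Legendre (enorm u) (int q) = - 1" using Legendre_values[OF t(1)] by auto
    then have "\<not> int q dvd enorm u" by (intro Legendre_nonzero) simp
    then show ?thesis using local_classI[OF 1 _ 2] 3 by simp
  qed
qed

end

section \<open>Evaluation of the characters of \<open>D\<close>\<close>

text \<open>2^h h! is the product of the even numbers up to p - 1. Each of them is an even i <= h or
  p - i with i <= h odd, so the product is h! up to the sign (-1)^(1 + ... + h).\<close>

lemma two_power_mod_prime:
  assumes "prime p" "p = 2 * h + 1"
  shows "[2 ^ h = (- 1) ^ (h * (h + 1) div 2)] (mod int p)"
proof -
  define f where "f = (\<lambda>i. if even i then i div 2 else (p - i) div 2)"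
  have f2: "2 * f i = (if even i then i else p - i)" if "i \<in> {1..h}" for i
    using that assms(2) by (auto simp: f_def)
  have inj: "inj_on f {1..h}"
  proof (rule inj_onI)
    fix i j assume ij: "i \<in> {1..h}" "j \<in> {1..h}" "f i = f j"
    have b: "i \<le> h" "j \<le> h" "1 \<le> i" "1 \<le> j" using ij by auto
    have "(if even i then i else p - i) = (if even j then j else p - j)"
      using f2[OF ij(1)] f2[OF ij(2)] ij(3) by simp
    then show "i = j" using b assms(2) by (cases "even i"; cases "even j"; simp)
  qed
  have "f ` {1..h} \<subseteq> {1..h}"
  proof
    fix y assume "y \<in> f ` {1..h}"
    then obtain i where i: "i \<in> {1..h}" "y = f i" by blast
    have "1 \<le> i" "i \<le> h" using i by auto
    then show "y \<in> {1..h}" using f2[OF i(1)] i(2) assms(2)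
      by (cases "even i"; simp; presburger)
  qed
  then have bij: "bij_betw f {1..h} {1..h}"
    using inj endo_inj_surj[of "{1..h}" f] by (simp add: bij_betw_def)
  have neg: "(\<Prod>i\<in>{1..n}. (- 1) ^ i) = (- 1 :: int) ^ (n * (n + 1) div 2)" for n
  proof (induction n)
    case (Suc n)
    have "(Suc n * (Suc n + 1)) div 2 = n * (n + 1) div 2 + Suc n" by simp
    then show ?case using Suc by (simp add: power_add)
  qed simp
  have "2 ^ h * (\<Prod>i\<in>{1..h}. int i) = (\<Prod>i\<in>{1..h}. int (2 * i))"
    by (simp add: prod.distrib)
  also have "\<dots> = (\<Prod>i\<in>{1..h}. int (2 * f i))"
    by (rule prod.reindex_bij_betw[OF bij, symmetric])
  also have "[\<dots> = (\<Prod>i\<in>{1..h}. (- 1) ^ i * int i)] (mod int p)"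
  proof (rule cong_prod)
    fix i assume i: "i \<in> {1..h}"
    show "[int (2 * f i) = (- 1) ^ i * int i] (mod int p)"
      unfolding f2[OF i] using i assms(2) by (auto simp: cong_iff_dvd_diff of_nat_diff)
  qed
  also have "(\<Prod>i\<in>{1..h}. (- 1) ^ i * int i) = (- 1) ^ (h * (h + 1) div 2) * (\<Prod>i\<in>{1..h}. int i)"
    unfolding prod.distrib neg ..
  finally have *: "[2 ^ h * int (fact h) = (- 1) ^ (h * (h + 1) div 2) * int (fact h)] (mod int p)"
    by (simp add: fact_prod)
  have "\<not> p dvd fact h" using assms by (simp add: prime_dvd_fact_iff)
  then have "coprime (int (fact h)) (int p)"
    using assms(1) by (metis coprime_commute coprime_int_iff prime_imp_coprime)
  then show ?thesis using * cong_mult_rcancel by blast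
qed

lemma Legendre_minus_one:
  assumes "prime p" "p > 2" shows "Legendre (- 1) (int p) = (- 1) ^ ((p - 1) div 2)"
proof (rule cong_imp_eq_int)
  show "[Legendre (- 1) (int p) = (- 1) ^ ((p - 1) div 2)] (mod int p)"
    by (rule euler_criterion[OF assms])
  have "\<bar>Legendre (- 1) (int p) - (- 1) ^ ((p - 1) div 2)\<bar> \<le> 2"
    by (cases "even ((p - 1) div 2)") (auto simp: Legendre_def)
  then show "\<bar>Legendre (- 1) (int p) - (- 1) ^ ((p - 1) div 2)\<bar> < int p" using assms(2) by linarith
qed

lemma Legendre_two:
  assumes "prime p" "p > 2" "p = 2 * h + 1"
  shows "Legendre 2 (int p) = (- 1) ^ (h * (h + 1) div 2)"
proof (rule cong_imp_eq_int)
  show "[Legendre 2 (int p) = (- 1) ^ (h * (h + 1) div 2)] (mod int p)"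
    using euler_criterion[OF assms(1,2), of 2] two_power_mod_prime[OF assms(1,3)] assms(3)
    by (auto intro: cong_trans)
  have "\<bar>Legendre 2 (int p) - (- 1) ^ (h * (h + 1) div 2)\<bar> \<le> 2"
    by (cases "even (h * (h + 1) div 2)") (auto simp: Legendre_def)
  then show "\<bar>Legendre 2 (int p) - (- 1) ^ (h * (h + 1) div 2)\<bar> < int p" using assms(2) by linarith
qed

lemma Legendre_two_mod_8:
  assumes "prime p"
  shows "p mod 8 = 7 \<Longrightarrow> Legendre 2 (int p) = 1" "p mod 8 = 5 \<Longrightarrow> Legendre 2 (int p) = - 1"
proof -
  assume "p mod 8 = 7"
  then obtain k where k: "p = 8 * k + 7" by (metis mult_div_mod_eq)
  have "(4 * k + 3) * (4 * k + 3 + 1) div 2 = 2 * ((4 * k + 3) * (k + 1))" by (simp add: algebra_simps)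
  then show "Legendre 2 (int p) = 1" using Legendre_two[of p "4 * k + 3"] assms k by simp
next
  assume "p mod 8 = 5"
  then obtain k where k: "p = 8 * k + 5" by (metis mult_div_mod_eq)
  have "(4 * k + 2) * (4 * k + 2 + 1) div 2 = 2 * (4 * k * k + 5 * k + 1) + 1" by (simp add: algebra_simps)
  then show "Legendre 2 (int p) = - 1" using Legendre_two[of p "4 * k + 2"] assms k by simp
qed

section \<open>The characters of D at a prime of trace one\<close>

context trace_one_prime
begin

lemma p_gt_2: "p > 2" using p_eq n_pos by simp

lemma Legendre_m3: "Legendre (- 3) (int p) = 1"
proof -
  have "- 3 * (2 * m + 1)\<^sup>2 - 1 = int p * - 4" unfolding p_m by (simp add: power2_eq_square algebra_simps)
  then have "[- 3 * (2 * m + 1)\<^sup>2 = 1] (mod int p)" unfolding cong_iff_dvd_diff by simp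
  then have "Legendre (- 3 * (2 * m + 1)\<^sup>2) (int p) = Legendre 1 (int p)" by (rule Legendre_eq_of_cong)
  also have "\<dots> = 1" using p_not_dvd_small[of 1]
    by (auto simp: Legendre_def QuadRes_def cong_0_iff intro: exI[of _ 1])
  finally have "Legendre (- 3) (int p) * Legendre (2 * m + 1) (int p) ^ 2 = 1"
    by (simp only: Legendre_mult[OF p1 p_gt_2] power2_eq_square)
  then show ?thesis by (auto simp: Legendre_def split: if_splits)
qed

abbreviation L1 :: int where "L1 \<equiv> Legendre (- 1) (int p)"

lemma L1_square: "L1 * L1 = 1"
  using Legendre_minus_one[OF p1 p_gt_2] by (simp flip: power_mult_distrib)

lemma Legendre_3: "Legendre 3 (int p) = L1"
proof -
  have "L1 * Legendre 3 (int p) = 1"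
    using Legendre_mult[OF p1 p_gt_2, of "- 1" 3] Legendre_m3 by simp
  then have "L1 * L1 * Legendre 3 (int p) = L1" by (simp add: mult.assoc)
  then show ?thesis using L1_square by simp
qed

lemma Legendre_power: "Legendre (a ^ n) (int p) = Legendre a (int p) ^ n"
proof (induction n)
  case 0
  show ?case using p_not_dvd_small[of 1]
    by (auto simp: Legendre_def QuadRes_def cong_0_iff intro: exI[of _ 1])
qed (simp add: Legendre_mult[OF p1 p_gt_2])

lemma Legendre_prod: "finite A \<Longrightarrow> Legendre (\<Prod>x\<in>A. f x) (int p) = (\<Prod>x\<in>A. Legendre (f x) (int p))"
  by (induction A rule: finite_induct)
     (use Legendre_power[of 1 0] in \<open>auto simp: Legendre_mult[OF p1 p_gt_2]\<close>)

lemma Legendre_prime: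
  assumes "prime q" "q \<ge> 5" "q \<noteq> p" "local_class q m i s"
  shows "Legendre (int q) (int p) = L1 ^ ((q - 1) div 2) * s"
proof -
  have s: "Legendre (int p) (int q) = s" using assms(4) by (simp add: local_class_def enorm_zeta p_m)
  have "\<not> q dvd p" using assms p1 primes_dvd_imp_eq[of q p] by auto
  then have "s = 1 \<or> s = - 1" using s unfolding Legendre_def cong_0_iff by (auto split: if_splits)
  then have s2: "s * s = 1" by auto
  have "s * Legendre (int q) (int p) = (- 1) ^ ((p - 1) div 2 * ((q - 1) div 2))"
    using Quadratic_Reciprocity[of p q] assms p1 p_gt_2 s by simp
  also have "\<dots> = L1 ^ ((q - 1) div 2)"
    using Legendre_minus_one[OF p1 p_gt_2] by (simp add: power_mult)
  finally have "s * (s * Legendre (int q) (int p)) = L1 ^ ((q - 1) div 2) * s" by simp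
  then show ?thesis using s2 by (simp flip: mult.assoc)
qed

lemma Legendre_D:
  assumes D: "D = (- 1) ^ sg * 2 ^ a * 3 ^ b * (\<Prod>q\<in>Q. int q ^ e q)"
    and Q: "finite Q" "\<And>q. q \<in> Q \<Longrightarrow> prime q \<and> q \<ge> 5 \<and> q \<noteq> p \<and> local_class q m (th q) (s q)"
  shows "Legendre D (int p) = L1 ^ (sg + b + (\<Sum>q\<in>Q. (q - 1) div 2 * e q))
     * Legendre 2 (int p) ^ a * (\<Prod>q\<in>Q. s q ^ e q)"
proof -
  have "Legendre (\<Prod>q\<in>Q. int q ^ e q) (int p) = (\<Prod>q\<in>Q. (L1 ^ ((q - 1) div 2) * s q) ^ e q)"
    unfolding Legendre_prod[OF Q(1)] Legendre_power
    by (intro prod.cong refl arg_cong2[where f = power] Legendre_prime) (use Q in blast)+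
  also have "\<dots> = L1 ^ (\<Sum>q\<in>Q. (q - 1) div 2 * e q) * (\<Prod>q\<in>Q. s q ^ e q)"
    by (simp add: power_mult_distrib prod.distrib power_sum power_mult)
  finally show ?thesis
    unfolding D Legendre_mult[OF p1 p_gt_2] Legendre_power Legendre_3
    by (simp add: power_add mult_ac)
qed

text \<open>For q = 2 the exponent (q^2 - 1)/3 is 1 and the norm is odd, so \<open>zeta m\<close>
  modulo 2 decides; it is om^2 for even and om for odd \<open>m\<close>.\<close>

lemma cres_2: "cres 2 = om ^ ((if even m then 2 else 1) + h)"
proof -
  let ?i = "if even m then 2 else 1 :: nat"
  have "idcong (of_int (int 2)) 0 ((of_int (enorm (zeta m)) * zeta m) ^ ((2\<^sup>2 - 1) div 3)) (om ^ ?i)"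
  proof -
    have "odd (enorm (zeta m))" unfolding enorm_zeta by simp
    then have 1: "[enorm (zeta m) = 1] (mod 2)" by (simp add: cong_def odd_iff_mod_2_eq_one)
    have "idcong (of_int (int 2)) 0 (of_int (enorm (zeta m)) * zeta m) (of_int 1 * zeta m)"
      using 1 by (intro idcong_mult idcong_of_int idcong_refl) simp
    also have "idcong (of_int (int 2)) 0 (of_int 1 * zeta m) (om ^ ?i)"
      unfolding eis_idcong_iff cong_iff_dvd_diff by (auto simp: zeta_def om_square)
    finally show ?thesis by simp
  qed
  then have "cres (int 2) = om ^ (?i + h * ((2\<^sup>2 - 1) div 3))"
    using p_gt_2 by (intro cres_prime) auto
  then show ?thesis by simp
qed

lemma cres_prod: "finite A \<Longrightarrow> cres (\<Prod>x\<in>A. f x) = (\<Prod>x\<in>A. cres (f x))"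
  by (induction A rule: finite_induct) (auto simp: chi_1 chi_mult)

text \<open>The character of 3 is assumed only through its \<open>b\<close>-th power: it is known
  for \<open>m\<close> equal to 1 modulo 3, whereas for 3 dividing \<open>b\<close> the power is
  trivial and \<open>m\<close> modulo 3 must stay free.\<close>

lemma cres_4D:
  assumes D: "D = (- 1) ^ sg * 2 ^ a * 3 ^ b * (\<Prod>q\<in>Q. int q ^ e q)"
    and Q: "finite Q" "\<And>q. q \<in> Q \<Longrightarrow> prime q \<and> q \<ge> 5 \<and> q \<noteq> p \<and> local_class q m (th q) (s q)"
    and c3: "cres 3 ^ b = om ^ (b * c)"
  shows "cres (4 * D) * om ^ h
    = om ^ ((a + 2) * ((if even m then 2 else 1) + h) + b * c
        + (\<Sum>q\<in>Q. e q * (th q + h * ((q\<^sup>2 - 1) div 3))) + h)"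
proof -
  have "cres (\<Prod>q\<in>Q. int q ^ e q) = (\<Prod>q\<in>Q. om ^ (e q * (th q + h * ((q\<^sup>2 - 1) div 3))))"
    unfolding cres_prod[OF Q(1)]
  proof (rule prod.cong[OF refl])
    fix q assume "q \<in> Q"
    then have "prime q" "q \<ge> 5" and q': "q \<noteq> p" "local_class q m (th q) (s q)" using Q(2) by blast+
    then have q: "prime q" "q \<noteq> 3" by simp_all
    then have "cres (int q) = om ^ (th q + h * ((q\<^sup>2 - 1) div 3))"
      using q' by (intro cres_prime) (simp_all add: local_class_def Psi_def)
    then show "cres (int q ^ e q) = om ^ (e q * (th q + h * ((q\<^sup>2 - 1) div 3)))"
      by (simp only: chi_power mult.commute[of "e q"] power_mult)
  qed
  also have "\<dots> = om ^ (\<Sum>q\<in>Q. e q * (th q + h * ((q\<^sup>2 - 1) div 3)))" by (simp add: power_sum)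
  finally have c: "cres (\<Prod>q\<in>Q. int q ^ e q) = om ^ (\<Sum>q\<in>Q. e q * (th q + h * ((q\<^sup>2 - 1) div 3)))" .
  have m1: "cres ((- 1) ^ sg) = 1" using chi_minus[of 1] chi_1 by (simp add: chi_power)
  have "4 * D = (- 1) ^ sg * 2 ^ (a + 2) * 3 ^ b * (\<Prod>q\<in>Q. int q ^ e q)" by (simp add: D)
  then have "cres (4 * D) = cres 2 ^ (a + 2) * cres 3 ^ b * cres (\<Prod>q\<in>Q. int q ^ e q)"
    by (simp only: chi_mult chi_power[symmetric] m1 mult_1) 
  also have "cres 2 ^ (a + 2) = om ^ ((a + 2) * ((if even m then 2 else 1) + h))"
    unfolding cres_2 power_mult[symmetric] mult.commute[of "a + 2"] ..
  finally show ?thesis unfolding c c3 by (simp only: power_add)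
qed

end

section \<open>The choice of residue classes\<close>

lemma solve_mod_3: "\<not> 3 dvd (b::nat) \<Longrightarrow> \<exists>j<3. 3 dvd A + b * j"
proof -
  assume "\<not> 3 dvd b"
  then have "3 dvd A + b * 0 \<or> 3 dvd A + b * 1 \<or> 3 dvd A + b * 2" by presburger
  moreover have "(0::nat) < 3" "(1::nat) < 3" "(2::nat) < 3" by simp_all
  ultimately show ?thesis by blast
qed

text \<open>The combinatorial core: local data whose cubic exponents add up to 0 modulo 3 and whose
  signs multiply to \<open>tau\<close>. \<open>t2\<close> encodes the parity of \<open>m\<close>
  (exponent of \<open>cres 2\<close>), \<open>m9\<close> is \<open>m\<close> modulo 9,
  \<open>th\<close> and \<open>s\<close> are the classes at the primes of \<open>Q\<close>;
  \<open>exc\<close> provides what is missing at 5 and 7.\<close>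

lemma selection:
  fixes a b :: nat and e :: "nat \<Rightarrow> nat" and tau :: int
  assumes Q: "finite Q" "\<And>q. q \<in> Q \<Longrightarrow> prime q \<and> q \<ge> 5"
    and tau: "tau = 1 \<or> tau = - 1 \<and> even a \<and> (\<exists>q\<in>Q. odd (e q))"
    and cube: "\<not> (3 dvd a \<and> 3 dvd b \<and> (\<forall>q\<in>Q. 3 dvd e q))"
    and exc: "\<And>q. tau = - 1 \<Longrightarrow> a mod 6 = 4 \<Longrightarrow> 3 dvd b \<Longrightarrow> q \<in> Q \<Longrightarrow> q = 5 \<and> e q mod 6 = 1 \<or> q = 7 \<and> e q mod 6 = 5
        \<Longrightarrow> \<exists>r\<in>Q - {q}. \<not> 6 dvd e r"
  obtains t2 m9 :: nat and th :: "nat \<Rightarrow> nat" and s :: "nat \<Rightarrow> int"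
  where "t2 = 1 \<or> t2 = 2" "3 dvd b \<or> m9 mod 3 = 1" "m9 < 9"
    "\<And>q. q \<in> Q \<Longrightarrow> \<exists>m. local_class q m (th q) (s q)"
    "(\<Prod>q\<in>Q. s q ^ e q) = tau"
    "\<And>h c. [h = 2 * m9 + 1] (mod 3) \<Longrightarrow> 3 dvd b \<or> [c = 2 + m9 div 3] (mod 3) \<Longrightarrow>
      3 dvd (a + 2) * (t2 + h) + b * c + (\<Sum>q\<in>Q. e q * (th q + h * ((q\<^sup>2 - 1) div 3))) + h"
proof -
  note choice = that
  have bp: "big_prime q" if "q \<in> Q" for q using Q(2)[OF that] by (simp add: big_prime_def)
  define SK where "SK = (\<Sum>q\<in>Q. e q * ((q\<^sup>2 - 1) div 3))"
  have expr: "3 dvd (a + 2) * (t2 + h) + b * c + (\<Sum>q\<in>Q. e q * (th q + h * ((q\<^sup>2 - 1) div 3))) + h"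
    if "[h = h0] (mod 3)" "[b * c = B] (mod 3)"
      "3 dvd (a + 2) * (t2 + h0) + B + ((\<Sum>q\<in>Q. e q * th q) + h0 * SK) + h0"
    for h h0 c t2 B :: nat and th
  proof -
    have 1: "(\<Sum>q\<in>Q. e q * (th q + h * ((q\<^sup>2 - 1) div 3))) = (\<Sum>q\<in>Q. e q * th q) + h * SK"
      unfolding SK_def by (simp add: sum_distrib_left sum.distrib algebra_simps)
    have 2: "[(a + 2) * (t2 + h) + b * c + ((\<Sum>q\<in>Q. e q * th q) + h * SK) + h
        = (a + 2) * (t2 + h0) + B + ((\<Sum>q\<in>Q. e q * th q) + h0 * SK) + h0] (mod 3)"
      using that(1,2) by (intro cong_add cong_mult cong_refl)
    show ?thesis unfolding 1 cong_dvd_iff[OF 2] by (rule that(3))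
  qed
  have bc: "[b * c = 0] (mod 3)" if "3 dvd b" for c using that by (simp add: cong_0_iff)
  have h_m9: "[h = h0] (mod 3)" if "[h = 2 * m9 + 1] (mod 3)" "(2 * m9 + 1) mod 3 = h0 mod 3" for h h0 m9 :: nat
    using that by (simp add: cong_def)
  have square: "\<exists>m. local_class q m i 1" if "q \<in> Q" for q i
    using big_prime.local_class_square[OF bp[OF that]] .
  have nonsquare: "\<exists>m. local_class q m i (- 1)" if "q \<in> Q" "i = 1 \<or> i = 2" for q i
    using big_prime.local_class_nonsquare[OF bp[OF that(1)], of i] that(2) by (auto simp: cong_def)
  have basic: "\<exists>th s. (\<forall>q\<in>Q. \<exists>m. local_class q m (th q) (s q)) \<and> (\<Prod>q\<in>Q. s q ^ e q) = tau \<and> s q1 = 1"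
    if "tau = 1 \<or> (\<exists>q0\<in>Q - {q1}. odd (e q0))" for q1
  proof (cases "tau = 1")
    case True
    then show ?thesis using square
      by (intro exI[of _ "\<lambda>_. 0"] exI[of _ "\<lambda>_. 1"]) auto
  next
    case False
    with that obtain q0 where q0: "q0 \<in> Q" "q0 \<noteq> q1" "odd (e q0)" by blast
    have "(\<Prod>q\<in>Q. (if q = q0 then - 1 else 1) ^ e q) = (\<Prod>q\<in>Q. if q = q0 then (- 1) ^ e q else 1 :: int)"
      by (intro prod.cong) auto
    also have "\<dots> = - 1" using q0 Q(1) by (simp add: prod.delta)
    finally show ?thesis using q0 square nonsquare False tau
      by (intro exI[of _ "\<lambda>_. 1"] exI[of _ "\<lambda>q. if q = q0 then - 1 else 1"]) auto
  qed
  have all: "\<exists>th s. (\<forall>q\<in>Q. \<exists>m. local_class q m (th q) (s q)) \<and> (\<Prod>q\<in>Q. s q ^ e q) = tau"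
  proof -
    have "0 \<notin> Q" using Q(2) by fastforce
    then have "tau = 1 \<or> (\<exists>q0\<in>Q - {0}. odd (e q0))" using tau by auto
    then show ?thesis using basic by blast
  qed
  \<comment> \<open>The cases name the source of the cubic correction: \<open>m\<close> modulo 9
    through \<open>cres 3\<close> (A); \<open>m\<close> modulo 3 alone (B2); the class at a prime
    \<open>q1\<close> that need not supply the sign (B1); a prime \<open>q1\<close> that must supply
    both sign and cubic correction (B3).\<close>
  consider (A) "\<not> 3 dvd b" | (B2) "3 dvd b" "\<forall>q\<in>Q. 3 dvd e q"
    | (B1) q1 where "3 dvd b" "q1 \<in> Q" "\<not> 3 dvd e q1" "tau = 1 \<or> (\<exists>q0\<in>Q - {q1}. odd (e q0))"
    | (B3) q1 where "3 dvd b" "q1 \<in> Q" "\<not> 3 dvd e q1" "tau = - 1" "odd (e q1)"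
        "\<forall>r\<in>Q - {q1}. 3 dvd e r \<and> even (e r)"
  proof -
    assume cA: "\<not> 3 dvd b \<Longrightarrow> thesis" and cB2: "3 dvd b \<Longrightarrow> \<forall>q\<in>Q. 3 dvd e q \<Longrightarrow> thesis"
      and cB1: "\<And>q1. 3 dvd b \<Longrightarrow> q1 \<in> Q \<Longrightarrow> \<not> 3 dvd e q1 \<Longrightarrow> tau = 1 \<or> (\<exists>q0\<in>Q - {q1}. odd (e q0)) \<Longrightarrow> thesis"
      and cB3: "\<And>q1. 3 dvd b \<Longrightarrow> q1 \<in> Q \<Longrightarrow> \<not> 3 dvd e q1 \<Longrightarrow> tau = - 1 \<Longrightarrow> odd (e q1)
        \<Longrightarrow> \<forall>r\<in>Q - {q1}. 3 dvd e r \<and> even (e r) \<Longrightarrow> thesis"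
    show thesis
    proof (cases "3 dvd b \<and> (\<exists>q1\<in>Q. \<not> 3 dvd e q1)")
      case True
      then obtain q1 where q1: "3 dvd b" "q1 \<in> Q" "\<not> 3 dvd e q1" by blast
      show thesis
      proof (cases "tau = 1 \<or> (\<exists>q0\<in>Q - {q1}. odd (e q0))")
        case False
        then have t: "tau = - 1" and ev: "\<forall>r\<in>Q - {q1}. even (e r)" using tau by auto
        then have o: "odd (e q1)" using tau by auto
        show thesis
        proof (cases "\<exists>r\<in>Q - {q1}. \<not> 3 dvd e r")
          case True
          then obtain r where "r \<in> Q" "r \<noteq> q1" "\<not> 3 dvd e r" by blast
          then show thesis using cB1[of r] q1 o by blast
        qed (use cB3[of q1] q1 t ev o in blast)
      qed (use cB1 q1 in blast)
    qed (use cA cB2 in blast)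
  qed
  then show thesis
  proof cases
    case A
    obtain th s where ths: "\<And>q. q \<in> Q \<Longrightarrow> \<exists>m. local_class q m (th q) (s q)" "(\<Prod>q\<in>Q. s q ^ e q) = tau"
      using all by blast
    obtain j where j: "j < 3" "3 dvd ((a + 2) + b * 2 + (\<Sum>q\<in>Q. e q * th q)) + b * j"
      using solve_mod_3[OF A] by blast
    show thesis
    proof (rule choice[of 1 "3 * j + 1" th s])
      fix h c :: nat assume h: "[h = 2 * (3 * j + 1) + 1] (mod 3)"
        and c: "3 dvd b \<or> [c = 2 + (3 * j + 1) div 3] (mod 3)"
      have "(3 * j + 1) div 3 = j" by simp
      then have cc: "[b * c = b * (2 + j)] (mod 3)" using c A by (intro cong_scalar_left) simp
      have hh: "[h = 0] (mod 3)" using h by (rule h_m9) presburger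
      have "(a + 2) * (1 + 0) + b * (2 + j) + ((\<Sum>q\<in>Q. e q * th q) + 0 * SK) + 0
          = ((a + 2) + b * 2 + (\<Sum>q\<in>Q. e q * th q)) + b * j"
        by (simp add: algebra_simps)
      then have "3 dvd (a + 2) * (1 + 0) + b * (2 + j) + ((\<Sum>q\<in>Q. e q * th q) + 0 * SK) + 0"
        using j(2) by (simp only:)
      then show "3 dvd (a + 2) * (1 + h) + b * c + (\<Sum>q\<in>Q. e q * (th q + h * ((q\<^sup>2 - 1) div 3))) + h"
        by (rule expr[OF hh cc])
    qed (use ths j in auto)
  next
    case B2
    obtain th s where ths: "\<And>q. q \<in> Q \<Longrightarrow> \<exists>m. local_class q m (th q) (s q)" "(\<Prod>q\<in>Q. s q ^ e q) = tau"
      using all by blast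
    have S: "3 dvd (\<Sum>q\<in>Q. e q * th q)" and SK: "3 dvd SK"
      unfolding SK_def using B2 by (auto intro!: dvd_sum)
    have "\<not> 3 dvd a" using cube B2 by blast
    then have "a mod 3 = 1 \<or> a mod 3 = 2" by presburger
    then obtain m9 h0 :: nat where mh: "m9 < 2" "(2 * m9 + 1) mod 3 = h0 mod 3" "3 dvd (a + 2) * (1 + h0) + h0"
    proof
      assume a: "a mod 3 = 1"
      show thesis by (rule that[of 1 0]) (simp, simp, use a in presburger)
    next
      assume a: "a mod 3 = 2"
      show thesis by (rule that[of 0 1]) (simp, simp, use a in presburger)
    qed
    show thesis
    proof (rule choice[of 1 m9 th s])
      fix h c :: nat assume h: "[h = 2 * m9 + 1] (mod 3)"
      have "3 dvd ((a + 2) * (1 + h0) + h0) + ((\<Sum>q\<in>Q. e q * th q) + h0 * SK)"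
        by (rule dvd_add[OF mh(3) dvd_add[OF S dvd_mult[OF SK]]])
      then have "3 dvd (a + 2) * (1 + h0) + 0 + ((\<Sum>q\<in>Q. e q * th q) + h0 * SK) + h0"
        by (simp only: ac_simps add_0_right add_0)
      then show "3 dvd (a + 2) * (1 + h) + b * c + (\<Sum>q\<in>Q. e q * (th q + h * ((q\<^sup>2 - 1) div 3))) + h"
        by (rule expr[OF h_m9[OF h mh(2)] bc[OF B2(1)]])
    qed (use ths mh B2 in auto)
  next
    case B1
    obtain th s where ths: "\<And>q. q \<in> Q \<Longrightarrow> \<exists>m. local_class q m (th q) (s q)"
        "(\<Prod>q\<in>Q. s q ^ e q) = tau" "s q1 = 1"
      using basic[OF B1(4)] by blast
    define S where "S = (\<Sum>q\<in>Q - {q1}. e q * th q)"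
    obtain x where x: "3 dvd (a + 2 + S) + e q1 * x" using solve_mod_3[OF B1(3)] by blast
    have sum: "(\<Sum>q\<in>Q. e q * (th(q1 := x)) q) = e q1 * x + S"
      unfolding S_def using Q(1) B1(2) by (subst sum.remove[of Q q1]) (auto intro!: sum.cong)
    show thesis
    proof (rule choice[of 1 1 "th(q1 := x)" s])
      fix h c :: nat assume h: "[h = 2 * 1 + 1] (mod 3)"
      have hh: "[h = 0] (mod 3)" using h by (rule h_m9) simp
      have "(a + 2) * (1 + 0) + 0 + ((e q1 * x + S) + 0 * SK) + 0 = (a + 2 + S) + e q1 * x" by simp
      then have "3 dvd (a + 2) * (1 + 0) + 0 + ((\<Sum>q\<in>Q. e q * (th(q1 := x)) q) + 0 * SK) + 0"
        using x unfolding sum by (simp only:)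
      then show "3 dvd (a + 2) * (1 + h) + b * c + (\<Sum>q\<in>Q. e q * ((th(q1 := x)) q + h * ((q\<^sup>2 - 1) div 3))) + h"
        by (rule expr[OF hh bc[OF B1(1)]])
    next
      fix q assume "q \<in> Q"
      then show "\<exists>m. local_class q m ((th(q1 := x)) q) (s q)"
        using ths square by (cases "q = q1") auto
    qed (use ths in auto)
  next
    case B3
    define s :: "nat \<Rightarrow> int" where "s = (\<lambda>q. if q = q1 then - 1 else 1)"
    have "(\<Prod>q\<in>Q. s q ^ e q) = (\<Prod>q\<in>Q. if q = q1 then (- 1) ^ e q else 1)"
      unfolding s_def by (intro prod.cong) auto
    also have "\<dots> = tau" using B3 Q(1) by (simp add: prod.delta)
    finally have ps: "(\<Prod>q\<in>Q. s q ^ e q) = tau" .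
    define k where "k = (q1\<^sup>2 - 1) div 3"
    have SK: "[SK = e q1 * k] (mod 3)"
    proof -
      have "SK = e q1 * k + (\<Sum>q\<in>Q - {q1}. e q * ((q\<^sup>2 - 1) div 3))"
        unfolding SK_def k_def using Q(1) B3(2) by (rule sum.remove)
      moreover have "3 dvd (\<Sum>q\<in>Q - {q1}. e q * ((q\<^sup>2 - 1) div 3))"
        using B3(6) by (intro dvd_sum) auto
      ultimately show ?thesis by (simp add: cong_def mod_add_right_eq dvd_imp_mod_0 mod_add_eq[symmetric])
    qed
    have fin: thesis if t: "\<exists>m. local_class q1 m t (- 1)"
        and m9: "m9 < 3" "(2 * m9 + 1) mod 3 = h0 mod 3"
        and d: "3 dvd (a + 2) * (1 + h0) + (e q1 * t + h0 * (e q1 * k)) + h0" for t m9 h0 :: nat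
    proof (rule choice[of 1 m9 "\<lambda>q. if q = q1 then t else 0" s])
      have sum: "(\<Sum>q\<in>Q. e q * (if q = q1 then t else 0)) = e q1 * t"
        using Q(1) B3(2) by (simp add: if_distrib sum.delta cong: if_cong)
      fix h c :: nat assume h: "[h = 2 * m9 + 1] (mod 3)"
      have "[(a + 2) * (1 + h0) + 0 + (e q1 * t + h0 * SK) + h0
          = (a + 2) * (1 + h0) + 0 + (e q1 * t + h0 * (e q1 * k)) + h0] (mod 3)"
        by (intro cong_add cong_mult cong_refl SK)
      then have "3 dvd (a + 2) * (1 + h0) + 0 + (e q1 * t + h0 * SK) + h0"
        using d by (simp add: cong_dvd_iff)
      then have "3 dvd (a + 2) * (1 + h0) + 0 + ((\<Sum>q\<in>Q. e q * (if q = q1 then t else 0)) + h0 * SK) + h0"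
        unfolding sum .
      then show "3 dvd (a + 2) * (1 + h) + b * c + (\<Sum>q\<in>Q. e q * ((if q = q1 then t else 0) + h * ((q\<^sup>2 - 1) div 3))) + h"
        by (rule expr[OF h_m9[OF h m9(2)] bc[OF B3(1)]])
    next
      fix q assume "q \<in> Q"
      then show "\<exists>m. local_class q m (if q = q1 then t else 0) (s q)"
        using t square by (cases "q = q1") (auto simp: s_def)
    qed (use ps m9 B3 in auto)
    have loc: "\<exists>m. local_class q1 m t (- 1)" if "t = 1 \<or> t = 2" for t using nonsquare B3(2) that by blast
    show thesis
    proof (cases "q1 \<ge> 11")
      case True
      obtain t where t: "t < 3" "3 dvd (a + 2) + e q1 * t" using solve_mod_3[OF B3(3)] by blast
      have "\<exists>m. local_class q1 m t (- 1)"
        using t(1) loc[of t] big_prime.local_class_nonsquare_trivial[OF bp[OF B3(2)] True]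
        by (cases "t = 0"; cases "t = 1"; simp)
      then show thesis by (rule fin[of _ 1 0]) (use t in simp_all)
    next
      case False
      have "q1 \<noteq> 6" "q1 \<noteq> 8" "q1 \<noteq> 9" "q1 \<noteq> 10" "prime q1" "q1 \<ge> 5"
        using Q(2)[OF B3(2)] by (auto simp: prime_nat_numeral_eq)
      then have q57: "q1 = 5 \<or> q1 = 7" using False by linarith
      \<comment> \<open>At 5 and 7 the sign forces a nontrivial cubic class. Modulo 3 the total
        exponent contains \<open>h\<close> with the coefficient \<open>a + e q1 * k\<close>; if 3
        does not divide it, \<open>m\<close> modulo 3 can correct the sum.\<close>
      show thesis
      proof (cases "3 dvd a + e q1 * k")
        case False
        obtain h0 where h0: "h0 < 3" "3 dvd ((a + 2) + e q1) + (a + e q1 * k) * h0" using solve_mod_3[OF False] by blast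
        \<comment> \<open>Solves 2 m + 1 = h0 modulo 3.\<close>
        define m9 where "m9 = (if h0 = 0 then 1 else if h0 = 1 then 0 else 2 :: nat)"
        have "(a + 2) * (1 + h0) + (e q1 * 1 + h0 * (e q1 * k)) + h0
            = (((a + 2) + e q1) + (a + e q1 * k) * h0) + 3 * h0" by (simp add: algebra_simps)
        then have d: "3 dvd (a + 2) * (1 + h0) + (e q1 * 1 + h0 * (e q1 * k)) + h0"
          by (simp only:) (rule dvd_add[OF h0(2) dvd_triv_left])
        have "h0 = 0 \<or> h0 = 1 \<or> h0 = 2" using h0(1) by linarith
        then have m9: "m9 < 3" "(2 * m9 + 1) mod 3 = h0 mod 3" by (auto simp: m9_def)
        show thesis by (rule fin[OF loc m9 d]) simp
      next
        case True
        \<comment> \<open>Now \<open>h\<close> has no influence. If a + 2 is not divisible by 3, a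
          nontrivial class at \<open>q1\<close> corrects the sum; the opposite case is exactly the
          one excluded by \<open>exc\<close>.\<close>
        have "a mod 3 \<noteq> 1"
        proof
          assume a1: "a mod 3 = 1"
          have "even a" using tau B3(4) by auto
          then have a4: "a mod 6 = 4" using a1 by presburger
          have "3 dvd a + e q1 * 8 \<and> q1 = 5 \<or> 3 dvd a + e q1 * 16 \<and> q1 = 7"
            using True q57 by (auto simp: k_def)
          moreover have "3 dvd a + x * 8 \<Longrightarrow> odd x \<Longrightarrow> x mod 6 = 1"
            "3 dvd a + x * 16 \<Longrightarrow> odd x \<Longrightarrow> x mod 6 = 5" for x using a1 by presburger+
          ultimately have "q1 = 5 \<and> e q1 mod 6 = 1 \<or> q1 = 7 \<and> e q1 mod 6 = 5"
            using B3(5) by blast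
          then obtain r where "r \<in> Q - {q1}" "\<not> 6 dvd e r" using exc[OF B3(4) a4 B3(1,2)] by blast
          moreover have "6 dvd x" if "3 dvd x" "even x" for x :: nat using that by presburger
          ultimately show False using B3(6) by blast
        qed
        then have "3 dvd (a + 2) + e q1 * 1 \<or> 3 dvd (a + 2) + e q1 * 2"
          using B3(3) by presburger
        then obtain t where t: "t = 1 \<or> t = 2" "3 dvd (a + 2) + e q1 * t" by blast
        show thesis by (rule fin[OF loc[OF t(1)], of 1 0]) (use t(2) in simp_all)
      qed
    qed
  qed
qed

lemma local_class_cong:
  assumes "prime q" "q \<ge> 5" "[m = m'] (mod int q)" "local_class q m i s"
  shows "local_class q m' i s"
proof -
  interpret big_prime q using assms by (simp add: big_prime_def)
  have m: "[m' = m] (mod int q)" using assms(3) by (rule cong_sym)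
  have z: "ecg (zeta m') (zeta m)"
    unfolding eis_idcong_iff zeta_def eis.sel
    by (intro conjI cong_add cong_scalar_left m cong_refl)
  have "ecg (Psi q (zeta m')) (om ^ i)"
    using Psi_cong[OF z] assms(4) idcong_trans unfolding local_class_def by blast
  moreover have "Legendre (enorm (zeta m')) (int q) = s"
    using Legendre_eq_of_cong[OF enorm_idcong[OF z]] assms(4) unfolding local_class_def by simp
  ultimately show ?thesis unfolding local_class_def by blast
qed

lemma prod_power_div_mod:
  fixes f :: "'a \<Rightarrow> int"
  shows "(\<Prod>q\<in>Q. f q ^ e q) = (\<Prod>q\<in>Q. f q ^ (e q div k)) ^ k * (\<Prod>q\<in>Q. f q ^ (e q mod k))"
proof -
  have "(\<Prod>q\<in>Q. f q ^ e q) = (\<Prod>q\<in>Q. (f q ^ (e q div k)) ^ k * f q ^ (e q mod k))"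
    by (intro prod.cong refl) (simp flip: power_mult power_add)
  then show ?thesis by (simp add: prod.distrib prod_power_distrib)
qed

lemma int_prime_decomposition:
  fixes D :: int
  assumes "D \<noteq> 0"
  obtains sg a b :: nat and Q :: "nat set" and e :: "nat \<Rightarrow> nat"
  where "sg < 2" "finite Q" "\<And>q. q \<in> Q \<Longrightarrow> prime q \<and> q \<ge> 5 \<and> e q > 0 \<and> int q dvd D"
    "D = (- 1) ^ sg * 2 ^ a * 3 ^ b * (\<Prod>q\<in>Q. int q ^ e q)"
proof -
  define N where "N = nat \<bar>D\<bar>"
  have N0: "N > 0" using assms by (simp add: N_def)
  define Q where "Q = prime_factors N - {2, 3}"
  define e where "e = (\<lambda>q. multiplicity q N)"
  have "N = (\<Prod>q\<in>prime_factors N. q ^ e q)" unfolding e_def using N0 by (rule prime_factorization_nat)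
  also have "\<dots> = (\<Prod>q\<in>insert 2 (insert 3 Q). q ^ e q)"
  proof (rule prod.mono_neutral_left)
    show "\<forall>q\<in>insert 2 (insert 3 Q) - prime_factors N. q ^ e q = 1"
    proof
      fix q assume q: "q \<in> insert 2 (insert 3 Q) - prime_factors N"
      then have "prime q" by (auto simp: Q_def)
      then have "\<not> q dvd N" using q N0 by (auto simp: in_prime_factors_iff)
      then show "q ^ e q = 1" by (simp add: e_def not_dvd_imp_multiplicity_0)
    qed
  qed (auto simp: Q_def)
  also have "\<dots> = 2 ^ e 2 * 3 ^ e 3 * (\<Prod>q\<in>Q. q ^ e q)"
    by (subst prod.insert; simp add: Q_def)+
  finally have "int N = int (2 ^ e 2 * 3 ^ e 3 * (\<Prod>q\<in>Q. q ^ e q))" by simp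
  then have N: "\<bar>D\<bar> = 2 ^ e 2 * 3 ^ e 3 * (\<Prod>q\<in>Q. int q ^ e q)" by (simp add: N_def)
  have D: "D = (- 1) ^ (if D < 0 then 1 else 0) * \<bar>D\<bar>" by simp
  show thesis
  proof (rule that[of "if D < 0 then 1 else 0" Q e "e 2" "e 3"])
    fix q assume q: "q \<in> Q"
    then have pq: "prime q" and qN: "q dvd N" by (auto simp: Q_def)
    have "q \<ge> 2" "q \<noteq> 2" "q \<noteq> 3" "q \<noteq> 4" using pq q prime_ge_2_nat by (auto simp: Q_def)
    moreover have "e q > 0" using pq qN N0 by (simp add: e_def prime_multiplicity_gt_zero_iff)
    moreover have "int q dvd D" using qN by (simp add: N_def flip: int_dvd_int_iff)
    ultimately show "prime q \<and> q \<ge> 5 \<and> e q > 0 \<and> int q dvd D" using pq by auto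
  qed (use D N in \<open>auto simp: Q_def mult.assoc\<close>)
qed

text \<open>The modulus is 8 * 9 times the primes of \<open>Q\<close>. Modulo 8, \<open>m\<close>
  determines its own parity and \<open>p\<close> modulo 8, hence the quadratic characters of -1 and
  2; modulo 9 it determines \<open>h\<close> modulo 3 and, when \<open>m\<close> is 1 modulo 3,
  \<open>cres 3\<close>.\<close>

theorem anomalous_progression:
  fixes D :: int
  assumes D0: "D \<noteq> 0"
    and nsq: "\<And>c. D \<noteq> c\<^sup>2" "\<And>c. D \<noteq> - 3 * c\<^sup>2"
    and ncube: "\<And>c. D \<noteq> c ^ 3"
    and n80: "\<And>c. D \<noteq> 80 * c ^ 6" "\<And>c. D \<noteq> - 27 * 80 * c ^ 6"
    and n7: "\<And>c. D \<noteq> 16 * (- 1) * 7 ^ 5 * c ^ 6" "\<And>c. D \<noteq> 16 * 27 * 7 ^ 5 * c ^ 6"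
  obtains M m0 :: nat where "M > 0" "coprime (3 * (int m0)\<^sup>2 + 3 * int m0 + 1) (3 * int M)"
    "\<And>p m. prime p \<Longrightarrow> int p = 3 * (int m)\<^sup>2 + 3 * int m + 1 \<Longrightarrow> m > 0 \<Longrightarrow> [m = m0] (mod M)
      \<Longrightarrow> \<not> int p dvd D \<Longrightarrow> (\<Sum>t\<in>{0..<int p}. Legendre (t ^ 3 + D) (int p)) = - 1"
proof -
  note choice = that
  obtain sg a b Q e where sg: "sg < 2" and Q: "finite Q"
    and Qp: "\<And>q. q \<in> Q \<Longrightarrow> prime q \<and> q \<ge> 5 \<and> e q > 0 \<and> int q dvd D"
    and D: "D = (- 1) ^ sg * 2 ^ a * 3 ^ b * (\<Prod>q\<in>Q. int q ^ e q)"
    by (rule int_prime_decomposition[OF D0]) (rule that, assumption+)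
  have sg01: "sg = 0 \<or> sg = 1" using sg by auto
  define f where "f = sg + b + (\<Sum>q\<in>Q. (q - 1) div 2 * e q)"
  \<comment> \<open>\<open>p\<close> will be 7 modulo 8 for odd \<open>f\<close> and 5 modulo 8 for
    even \<open>f\<close>. In the first case -1 already contributes the wanted sign, in the second 2
    does so when \<open>a\<close> is odd; only otherwise must the primes of \<open>Q\<close>
    contribute -1.\<close>
  define tau :: int where "tau = (if odd f \<or> odd a then 1 else - 1)"
  have pow: "(\<Prod>q\<in>Q. int q ^ e q) = (\<Prod>q\<in>Q. int q ^ (e q div k)) ^ k * (\<Prod>q\<in>Q. int q ^ (e q mod k))" for k
    by (rule prod_power_div_mod)
  have dm: "(x::int) ^ n = (x ^ (n div k)) ^ k * x ^ (n mod k)" for x n k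
    by (simp flip: power_mult power_add)
  \<comment> \<open>\<open>R k\<close> collects the k-th powers in \<open>D\<close>, so that the
    residues of the exponents modulo 2, 3 and 6 show when \<open>D\<close> has one of the excluded
    shapes.\<close>
  define R where "R = (\<lambda>k. 2 ^ (a div k) * 3 ^ (b div k) * (\<Prod>q\<in>Q. int q ^ (e q div k)))"
  have DR: "D = (- 1) ^ sg * 2 ^ (a mod k) * 3 ^ (b mod k) * (\<Prod>q\<in>Q. int q ^ (e q mod k)) * R k ^ k" for k
    unfolding D pow[of k] dm[of 2 a k] dm[of 3 b k] R_def by (simp add: power_mult_distrib mult_ac)
  have tau1: "tau = 1 \<or> tau = - 1 \<and> even a \<and> (\<exists>q\<in>Q. odd (e q))"
  proof (cases "odd f \<or> odd a")
    case False
    \<comment> \<open>Otherwise \<open>D\<close> is up to sign a square or 3 times a square, and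
      evenness of \<open>f\<close> ties the sign to the exponent of 3: \<open>D\<close> is a square
      or -3 times a square.\<close>
    have "\<exists>q\<in>Q. odd (e q)"
    proof (rule ccontr)
      assume "\<not> ?thesis"
      then have ev: "\<And>q. q \<in> Q \<Longrightarrow> even (e q)" by blast
      then have "even (\<Sum>q\<in>Q. (q - 1) div 2 * e q)" by (intro dvd_sum) auto
      then have sb: "even (sg + b)" using False unfolding f_def by simp
      have "(\<Prod>q\<in>Q. int q ^ (e q mod 2)) = 1" using ev by (intro prod.neutral) (auto simp: even_iff_mod_2_eq_zero)
      then have D2: "D = (- 1) ^ sg * 3 ^ (b mod 2) * R 2 ^ 2"
        using DR[of 2] False by (simp add: even_iff_mod_2_eq_zero)
      show False
      proof (cases "sg = 0")
        case True
        then have "D = R 2 ^ 2" using D2 sb by (simp add: even_iff_mod_2_eq_zero)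
        then show False using nsq(1) by blast
      next
        case False
        then have "sg = 1" using sg01 by blast
        then have "D = - 3 * R 2 ^ 2" using D2 sb by (simp add: odd_iff_mod_2_eq_one)
        then show False using nsq(2) by blast
      qed
    qed
    then show ?thesis using False by (simp add: tau_def)
  qed (simp add: tau_def)
  have cube: "\<not> (3 dvd a \<and> 3 dvd b \<and> (\<forall>q\<in>Q. 3 dvd e q))"
  proof
    assume c: "3 dvd a \<and> 3 dvd b \<and> (\<forall>q\<in>Q. 3 dvd e q)"
    then have "(\<Prod>q\<in>Q. int q ^ (e q mod 3)) = 1" by (intro prod.neutral) auto
    then have "D = (- 1) ^ sg * R 3 ^ 3" using DR[of 3] c by simp
    also have "\<dots> = ((- 1) ^ sg * R 3) ^ 3" using sg01 by (auto simp: power_mult_distrib)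
    finally show False using ncube by blast
  qed
  \<comment> \<open>Without such an \<open>r\<close>, \<open>D\<close> is a sixth power times 2^4
    times 5 or 7^5, times a sign and possibly 27. Evenness of \<open>f\<close> fixes that sign,
    which leads to the four shapes excluded by \<open>n80\<close> and \<open>n7\<close>.\<close>
  have exc: "\<exists>r\<in>Q - {q}. \<not> 6 dvd e r"
    if t: "tau = - 1" "a mod 6 = 4" "3 dvd b" "q \<in> Q" "q = 5 \<and> e q mod 6 = 1 \<or> q = 7 \<and> e q mod 6 = 5" for q
  proof (rule ccontr)
    assume "\<not> ?thesis"
    then have d6: "\<And>r. r \<in> Q - {q} \<Longrightarrow> 6 dvd e r" by blast
    have ev: "even f" using t(1) unfolding tau_def by (auto split: if_splits)
    have "(\<Sum>q\<in>Q. (q - 1) div 2 * e q) = (q - 1) div 2 * e q + (\<Sum>q\<in>Q - {q}. (q - 1) div 2 * e q)"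
      using Q t(4) by (rule sum.remove)
    moreover have "even (\<Sum>q\<in>Q - {q}. (q - 1) div 2 * e q)"
    proof (intro dvd_sum dvd_mult)
      fix r assume "r \<in> Q - {q}"
      then have "6 dvd e r" by (rule d6)
      then show "even (e r)" by presburger
    qed
    ultimately have fe: "even (sg + b + (q - 1) div 2 * e q)" using ev unfolding f_def by simp
    have "(\<Prod>r\<in>Q. int r ^ (e r mod 6)) = int q ^ (e q mod 6) * (\<Prod>r\<in>Q - {q}. int r ^ (e r mod 6))"
      using Q t(4) by (rule prod.remove)
    also have "(\<Prod>r\<in>Q - {q}. int r ^ (e r mod 6)) = 1" using d6 by (intro prod.neutral) auto
    finally have D6: "D = (- 1) ^ sg * 16 * 3 ^ (b mod 6) * int q ^ (e q mod 6) * R 6 ^ 6"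
      using DR[of 6] t(2) by simp
    have b6: "b mod 6 = (if even b then 0 else 3)" using t(3) by presburger
    define X Y :: int where "X = (- 1) ^ sg * 3 ^ (b mod 6)" and "Y = int q ^ (e q mod 6)"
    have DXY: "D = 16 * X * Y * R 6 ^ 6" unfolding X_def Y_def by (subst D6) (simp only: ac_simps)
    from t(5) show False
    proof
      assume q: "q = 5 \<and> e q mod 6 = 1"
      then have "even (sg + b)" using fe by simp
      then have "X = 1 \<or> X = - 27" using sg01 unfolding X_def b6 by (cases "even b") auto
      moreover have "Y = 5" unfolding Y_def using q by (metis of_nat_numeral power_one_right)
      ultimately have "D = 80 * R 6 ^ 6 \<or> D = - 27 * 80 * R 6 ^ 6" using DXY by auto
      then show False using n80 by blast
    next
      assume q: "q = 7 \<and> e q mod 6 = 5"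
      then have "e q mod 6 = 5" by blast
      then have "odd (e q)" by presburger
      then have "odd (sg + b)" using fe q by simp
      then have "X = - 1 \<or> X = 27" using sg01 unfolding X_def b6 by (cases "even b") auto
      moreover have "Y = 7 ^ 5" unfolding Y_def using q by (metis of_nat_numeral)
      ultimately have "D = 16 * (- 1) * 7 ^ 5 * R 6 ^ 6 \<or> D = 16 * 27 * 7 ^ 5 * R 6 ^ 6"
        using DXY by auto
      then show False using n7 by blast
    qed
  qed
  have Qp2: "prime q \<and> q \<ge> 5" if "q \<in> Q" for q using Qp[OF that] by blast
  have "\<exists>t2 m9 th s. (t2 = 1 \<or> t2 = 2) \<and> (3 dvd b \<or> m9 mod 3 = 1) \<and> m9 < 9 \<and>
    (\<forall>q\<in>Q. \<exists>m. local_class q m (th q) (s q)) \<and> (\<Prod>q\<in>Q. s q ^ e q) = tau \<and>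
    (\<forall>h c. [h = 2 * m9 + 1] (mod 3) \<longrightarrow> 3 dvd b \<or> [c = 2 + m9 div 3] (mod 3) \<longrightarrow>
      3 dvd (a + 2) * (t2 + h) + b * c + (\<Sum>q\<in>Q. e q * (th q + h * ((q\<^sup>2 - 1) div 3))) + h)"
  proof (rule selection[where Q = Q and tau = tau and a = a and b = b and e = e])
    show "finite Q" "tau = 1 \<or> tau = - 1 \<and> even a \<and> (\<exists>q\<in>Q. odd (e q))"
      "\<not> (3 dvd a \<and> 3 dvd b \<and> (\<forall>q\<in>Q. 3 dvd e q))" by fact+
    show "prime q \<and> q \<ge> 5" if "q \<in> Q" for q using that by (rule Qp2)
    show "\<exists>r\<in>Q - {q}. \<not> 6 dvd e r"
      if "tau = - 1" "a mod 6 = 4" "3 dvd b" "q \<in> Q" "q = 5 \<and> e q mod 6 = 1 \<or> q = 7 \<and> e q mod 6 = 5" for q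
      using that by (rule exc)
    fix t2 m9 th s
    assume "t2 = 1 \<or> t2 = 2" "3 dvd b \<or> m9 mod 3 = 1" "m9 < 9"
      "\<And>q. q \<in> Q \<Longrightarrow> \<exists>m. local_class q m (th q) (s q)" "(\<Prod>q\<in>Q. s q ^ e q) = tau"
      "\<And>h c. [h = 2 * m9 + 1] (mod 3) \<Longrightarrow> 3 dvd b \<or> [c = 2 + m9 div 3] (mod 3) \<Longrightarrow>
        3 dvd (a + 2) * (t2 + h) + b * c + (\<Sum>q\<in>Q. e q * (th q + h * ((q\<^sup>2 - 1) div 3))) + h"
    then show ?thesis by (intro exI[of _ t2] exI[of _ m9] exI[of _ th] exI[of _ s]) simp
  qed
  then obtain t2 m9 th s where sel: "t2 = 1 \<or> t2 = 2" "3 dvd b \<or> m9 mod 3 = 1" "m9 < 9"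
    and sel4: "\<forall>q\<in>Q. \<exists>m. local_class q m (th q) (s q)"
    and sel5: "(\<Prod>q\<in>Q. s q ^ e q) = tau"
    and sel6: "\<forall>h c. [h = 2 * m9 + 1] (mod 3) \<longrightarrow> 3 dvd b \<or> [c = 2 + m9 div 3] (mod 3) \<longrightarrow>
      3 dvd (a + 2) * (t2 + h) + b * c + (\<Sum>q\<in>Q. e q * (th q + h * ((q\<^sup>2 - 1) div 3))) + h"
    by (elim exE conjE) (rule that)
  obtain mq where mq: "\<And>q. q \<in> Q \<Longrightarrow> local_class q (mq q) (th q) (s q)" using bchoice[OF sel4] by blast
  \<comment> \<open>The values 6 and 1 make \<open>p\<close> equal to 7 modulo 8, the values 4 and 3
    make it 5; within each pair the parity realises \<open>t2\<close>.\<close>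
  define m8 :: nat where "m8 = (if odd f then if t2 = 2 then 6 else 1 else if t2 = 2 then 4 else 3)"
  define md where "md = (\<lambda>q::nat. if q = 2 then 8 else if q = 3 then 9 else q)"
  define u where "u = (\<lambda>q::nat. if q = 2 then m8 else if q = 3 then m9 else nat (mq q mod int q))"
  define A where "A = insert 2 (insert 3 Q)"
  have Qn: "2 \<notin> Q" "3 \<notin> Q" using Qp2 by fastforce+
  have finA: "finite A" using Q by (simp add: A_def)
  have prA: "prime q" if "q \<in> A" for q using that Qp2 by (auto simp: A_def)
  have mdp: "\<exists>k. md q = q ^ k" if "q \<in> A" for q
    using that Qn by (auto simp: md_def A_def intro: exI[of _ 3] exI[of _ 2] exI[of _ 1])
  have "\<exists>x. \<forall>i\<in>A. [x = u i] (mod md i)"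
  proof (rule chinese_remainder_nat[OF finA], intro ballI impI)
    fix i j assume ij: "i \<in> A" "j \<in> A" "i \<noteq> j"
    then have "coprime i j" using prA by (intro primes_coprime)
    then show "coprime (md i) (md j)" using mdp[OF ij(1)] mdp[OF ij(2)] by auto
  qed
  then obtain m0 where m0: "\<And>i. i \<in> A \<Longrightarrow> [m0 = u i] (mod md i)" by blast
  define M where "M = (\<Prod>i\<in>A. md i)"
  have mdM: "md i dvd M" if "i \<in> A" for i unfolding M_def using finA that by (rule dvd_prod_eqI[OF _ _ refl])
  have md0: "md i > 0" if "i \<in> A" for i using prA[OF that] prime_gt_0_nat by (auto simp: md_def)
  have mod_i: "[m = u i] (mod md i)" if "i \<in> A" "[m = m0] (mod M)" for m i
    using that cong_dvd_modulus_nat[OF that(2) mdM[OF that(1)]] m0 cong_trans by blast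
  have mod_q: "local_class q (int m) (th q) (s q)" if "q \<in> Q" "[m = m0] (mod M)" for m q
  proof (rule local_class_cong[OF _ _ _ mq[OF that(1)]])
    show "prime q" "q \<ge> 5" using Qp2[OF that(1)] by auto
    have q: "q \<noteq> 2" "q \<noteq> 3" "q \<in> A" "q > 0" using that(1) Qn \<open>q \<ge> 5\<close> by (auto simp: A_def)
    have "[m = nat (mq q mod int q)] (mod q)" using mod_i[OF q(3) that(2)] q by (simp add: md_def u_def)
    then have "[int m = int (nat (mq q mod int q))] (mod int q)" unfolding cong_int_iff .
    then have "[int m = mq q mod int q] (mod int q)" using q by simp
    then show "[mq q = int m] (mod int q)" by (simp add: cong_def)
  qed
  have mod_8: "m mod 8 = m8" if "[m = m0] (mod M)" for m
    using mod_i[of 2, OF _ that] by (auto simp: A_def md_def u_def cong_def m8_def)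
  have mod_9: "m mod 9 = m9" if "[m = m0] (mod M)" for m
    using mod_i[of 3, OF _ that] sel(3) by (auto simp: A_def md_def u_def cong_def)
  show thesis
  proof (rule choice)
    show "M > 0" unfolding M_def using md0 by (intro prod_pos) blast
    show "coprime (3 * (int m0)\<^sup>2 + 3 * int m0 + 1) (3 * int M)"
    proof (rule ccontr)
      assume "\<not> ?thesis"
      then have "nat (gcd (3 * (int m0)\<^sup>2 + 3 * int m0 + 1) (3 * int M)) \<noteq> 1"
        by (simp add: coprime_iff_gcd_eq_1)
      then obtain r where r: "prime r" "r dvd nat (gcd (3 * (int m0)\<^sup>2 + 3 * int m0 + 1) (3 * int M))"
        using prime_factor_nat by blast
      then have "int r dvd gcd (3 * (int m0)\<^sup>2 + 3 * int m0 + 1) (3 * int M)"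
        by (metis gcd_ge_0_int int_dvd_int_iff int_nat_eq)
      then have l: "int r dvd 3 * (int m0)\<^sup>2 + 3 * int m0 + 1" "int r dvd 3 * int M" by simp_all
      have "int r dvd int (3 * M)" using l(2) by simp
      then have "r dvd 3 * M" by (simp only: int_dvd_int_iff)
      then have "r dvd 3 \<or> r dvd M" using r(1) prime_dvd_multD by blast
      then have "r \<in> A"
      proof
        assume "r dvd 3"
        then show ?thesis using r(1) primes_dvd_imp_eq[of r 3] by (simp add: A_def)
      next
        assume "r dvd M"
        then obtain i where i: "i \<in> A" "r dvd md i" unfolding M_def using r(1) finA by (auto simp: prime_dvd_prod_iff)
        then have "r dvd i" using mdp[OF i(1)] r(1) prime_dvd_power by metis
        then show ?thesis using primes_dvd_imp_eq[of r i] r(1) prA[OF i(1)] i(1) by simp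
      qed
      moreover have "r \<noteq> 2"
      proof
        assume "r = 2"
        then have "even (3 * (int m0)\<^sup>2 + 3 * int m0 + 1)" using l r by simp
        then show False by simp
      qed
      moreover have "r \<noteq> 3"
      proof
        assume "r = 3"
        then have "3 dvd 3 * ((int m0)\<^sup>2 + int m0) + 1" using l r by (simp add: algebra_simps)
        then show False by presburger
      qed
      ultimately have rQ: "r \<in> Q" by (simp add: A_def)
      \<comment> \<open>A common prime factor in \<open>Q\<close> would make a sign
        \<open>s r\<close> zero, whereas the product of the signs is \<open>tau\<close>, which is 1
        or -1.\<close>
      have "Legendre (enorm (zeta (int m0))) (int r) = s r"
        using mod_q[OF rQ cong_refl] by (simp add: local_class_def)
      moreover have "Legendre (enorm (zeta (int m0))) (int r) = 0"
        using l r by (simp add: enorm_zeta Legendre_def cong_0_iff)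
      ultimately have "s r = 0" by simp
      then have "(\<Prod>q\<in>Q. s q ^ e q) = 0" using Q rQ Qp[OF rQ] by (auto simp: prod_zero_iff)
      then show False using sel5 tau1 by auto
    qed
    fix p m assume p: "prime p" and pm: "int p = 3 * (int m)\<^sup>2 + 3 * int m + 1" and m: "m > 0"
      and mm: "[m = m0] (mod M)" and pD: "\<not> int p dvd D"
    define h where "h = 2 * m + 1"
    interpret trace_one_prime p "int m" h
      using p pm m by unfold_locales (simp_all add: h_def add.commute)
    have QQ: "prime q \<and> q \<ge> 5 \<and> q \<noteq> p \<and> local_class q (int m) (th q) (s q)" if "q \<in> Q" for q
      using Qp[OF that] pD mod_q[OF that mm] by auto
    have t2: "(if even (int m) then 2 else 1) = t2"
    proof -
      have "even m \<longleftrightarrow> even m8" using mod_8[OF mm] by presburger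
      also have "\<dots> \<longleftrightarrow> t2 = 2" using sel(1) by (auto simp: m8_def)
      finally show ?thesis using sel(1) by auto
    qed
    define k9 where "k9 = m div 9"
    have m9k: "m = m9 + 3 * (3 * k9)" using mod_9[OF mm] mult_div_mod_eq[of 9 m] by (simp add: k9_def)
    have m3: "m mod 3 = m9 mod 3" "m div 3 = 3 * k9 + m9 div 3"
      unfolding m9k by (simp_all only: mod_mult_self2 div_mult_self2 zero_neq_numeral not_False_eq_True)
    have hm: "[h = 2 * m9 + 1] (mod 3)"
      unfolding h_def using m3(1) by (intro cong_add cong_mult cong_refl) (simp add: cong_def)
    have "\<exists>c. cres 3 ^ b = om ^ (b * c) \<and> (3 dvd b \<or> [c = 2 + m9 div 3] (mod 3))"
    proof (cases "3 dvd b")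
      case True
      then obtain k where k: "b = 3 * k" by blast
      have "cres 3 ^ b = om ^ (b * 0)"
        unfolding k power_mult by (simp add: chi_cube p_not_dvd_small)
      then show ?thesis using True by blast
    next
      case False
      then have "m mod 3 = 1" using sel(2) m3(1) by simp
      then have "m = 3 * (m div 3) + 1" using mult_div_mod_eq[of 3 m] by simp
      then have "int m = 3 * int (m div 3) + 1" by linarith
      then have "cres 3 = om ^ (2 + m div 3)" by (rule cres_3)
      then have "cres 3 ^ b = om ^ (b * (2 + m div 3))"
        by (simp only: power_mult[symmetric] mult.commute[of b])
      moreover have "[2 + m div 3 = 2 + m9 div 3] (mod 3)" unfolding m3(2) by (simp add: cong_def) presburger
      ultimately show ?thesis by blast
    qed
    then obtain c where c: "cres 3 ^ b = om ^ (b * c)" "3 dvd b \<or> [c = 2 + m9 div 3] (mod 3)" by blast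
    have "cres (4 * D) * om ^ h
        = om ^ ((a + 2) * (t2 + h) + b * c + (\<Sum>q\<in>Q. e q * (th q + h * ((q\<^sup>2 - 1) div 3))) + h)"
      using cres_4D[OF D Q QQ c(1)] unfolding t2 .
    also have "\<dots> = om ^ 0" unfolding om_power_eq_iff cong_0_iff using sel6 hm c(2) by blast
    finally have C: "cres (4 * D) * om ^ h = 1" by simp
    have LD: "Legendre D (int p) = L1 ^ f * Legendre 2 (int p) ^ a * tau"
      using Legendre_D[OF D Q QQ] sel5 by (simp add: f_def)
    have p8: "p mod 8 = (3 * m8\<^sup>2 + 3 * m8 + 1) mod 8"
    proof -
      have "p = 3 * m\<^sup>2 + 3 * m + 1" using pm by (metis (mono_tags, lifting) of_nat_1 of_nat_add of_nat_eq_iff of_nat_mult of_nat_numeral of_nat_power)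
      moreover have "[3 * m\<^sup>2 + 3 * m + 1 = 3 * m8\<^sup>2 + 3 * m8 + 1] (mod 8)"
        using mod_8[OF mm] by (intro cong_add cong_mult cong_pow cong_refl) (auto simp: cong_def)
      ultimately show ?thesis by (simp add: cong_def)
    qed
    have "Legendre D (int p) = - 1"
    proof (cases "odd f")
      case True
      then have p7: "p mod 8 = 7" using p8 sel(1) by (auto simp: m8_def)
      then have "odd ((p - 1) div 2)" by presburger
      then have "L1 = - 1" using Legendre_minus_one[OF p p_gt_2] by simp
      then show ?thesis using LD True Legendre_two_mod_8(1)[OF p p7] by (simp add: tau_def)
    next
      case False
      then have p5: "p mod 8 = 5" using p8 sel(1) by (auto simp: m8_def)
      then have "even ((p - 1) div 2)" by presburger
      then have "L1 = 1" using Legendre_minus_one[OF p p_gt_2] by simp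
      then show ?thesis using LD False Legendre_two_mod_8(2)[OF p p5] by (cases "odd a") (simp_all add: tau_def)
    qed
    then show "(\<Sum>t\<in>{0..<int p}. Legendre (t ^ 3 + D) (int p)) = - 1" using C by (rule anomalous)
  qed
qed

section \<open>Point counts and minimal models\<close>

lemma card_bij_filter:
  assumes "bij_betw f S S" "\<And>x. x \<in> S \<Longrightarrow> P x \<longleftrightarrow> P' (f x)"
  shows "card {x \<in> S. P x} = card {x \<in> S. P' x}"
proof (rule bij_betw_same_card)
  have "f ` {x \<in> S. P x} = {x \<in> S. P' x}"
  proof (intro equalityI subsetI)
    fix y assume y: "y \<in> {x \<in> S. P' x}"
    then have "y \<in> f ` S" using bij_betw_imp_surj_on[OF assms(1)] by simp
    then obtain x where "x \<in> S" "y = f x" by blast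
    then show "y \<in> f ` {x \<in> S. P x}" using y assms(2) by simp
  qed (use assms bij_betwE[OF assms(1)] in auto)
  moreover have "inj_on f {x \<in> S. P x}"
    using bij_betw_imp_inj_on[OF assms(1)] by (rule inj_on_subset) auto
  ultimately show "bij_betw f {x \<in> S. P x} {x \<in> S. P' x}" by (simp add: bij_betw_def)
qed

section \<open>Counting points on y^2 = x^3 + k modulo p\<close>

context
  fixes p :: nat
  assumes p: "prime p" and p5: "p \<ge> 5"
begin

lemma prime_int_p': "prime (int p)" using p by simp

lemma not_dvd_2_3_power: "\<not> int p dvd 2 ^ i * 3 ^ j"
proof
  assume "int p dvd 2 ^ i * 3 ^ j"
  then have "int p dvd 2 \<or> int p dvd 3"
    using prime_dvd_multD[OF prime_int_p'] prime_dvd_power[OF prime_int_p'] by blast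
  then show False using p5 by (auto dest!: zdvd_imp_le)
qed

lemma bij_betw_triangular:
  assumes a: "\<not> int p dvd a" and c: "\<not> int p dvd c"
  shows "bij_betw (\<lambda>(x, y). ((a * x + b) mod int p, (c * y + d * x + e) mod int p))
    ({0..<int p} \<times> {0..<int p}) ({0..<int p} \<times> {0..<int p})" (is "bij_betw ?f ?S ?S")
proof -
  have inj: "inj_on ?f ?S"
  proof (rule inj_onI, clarify)
    fix x y x' y' assume S: "x \<in> {0..<int p}" "y \<in> {0..<int p}" "x' \<in> {0..<int p}" "y' \<in> {0..<int p}"
      and e1: "(a * x + b) mod int p = (a * x' + b) mod int p"
      and e2: "(c * y + d * x + e) mod int p = (c * y' + d * x' + e) mod int p"
    have "int p dvd (a * x + b) - (a * x' + b)" using e1 by (simp only: mod_eq_dvd_iff)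
    then have "int p dvd a * (x - x')" by (simp add: algebra_simps)
    then have "int p dvd x - x'" using a prime_dvd_multD[OF prime_int_p'] by blast
    then have x: "x = x'" using S by (metis atLeastLessThan_iff mod_eq_dvd_iff mod_pos_pos_trivial)
    have "int p dvd (c * y + d * x + e) - (c * y' + d * x' + e)" using e2 by (simp only: mod_eq_dvd_iff)
    then have "int p dvd c * (y - y')" using x by (simp add: algebra_simps)
    then have "int p dvd y - y'" using c prime_dvd_multD[OF prime_int_p'] by blast
    then show "x = x' \<and> y = y'"
      using x S by (metis atLeastLessThan_iff mod_eq_dvd_iff mod_pos_pos_trivial)
  qed
  have "?f ` ?S \<subseteq> ?S" using p5 by auto
  then have "?f ` ?S = ?S" using inj by (intro endo_inj_surj) auto
  then show ?thesis using inj by (simp add: bij_betw_def)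
qed

definition short_count :: "int \<Rightarrow> nat" where
  "short_count k = card {(x, y) \<in> {0..<int p} \<times> {0..<int p}. [y\<^sup>2 = x ^ 3 + k] (mod int p)}"

text \<open>The isomorphism (x, y) -> (t^2 x, t^3 y) between the two curves.\<close>

lemma short_count_scale:
  assumes t: "\<not> int p dvd t" shows "short_count (k * t ^ 6) = short_count k"
proof -
  have t23: "\<not> int p dvd t\<^sup>2" "\<not> int p dvd t ^ 3" using t prime_dvd_power[OF prime_int_p'] by blast+
  have t6: "\<not> int p dvd t ^ 6" using t prime_dvd_power[OF prime_int_p'] by blast
  let ?f = "\<lambda>(x, y). ((t\<^sup>2 * x + 0) mod int p, (t ^ 3 * y + 0 * x + 0) mod int p)"
  have "short_count k = card {P \<in> {0..<int p} \<times> {0..<int p}. case P of (x, y) \<Rightarrow> [y\<^sup>2 = x ^ 3 + k] (mod int p)}"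
    unfolding short_count_def by (rule arg_cong[where f = card]) auto
  also have "\<dots> = card {P \<in> {0..<int p} \<times> {0..<int p}. case P of (x, y) \<Rightarrow> [y\<^sup>2 = x ^ 3 + k * t ^ 6] (mod int p)}"
  proof (rule card_bij_filter[OF bij_betw_triangular[OF t23, of 0 0 0]])
    fix P :: "int \<times> int"
    obtain x y where P: "P = (x, y)" by (cases P)
    have "[((t ^ 3 * y + 0 * x + 0) mod int p)\<^sup>2 = (t ^ 3 * y)\<^sup>2] (mod int p)"
      "[((t\<^sup>2 * x + 0) mod int p) ^ 3 + k * t ^ 6 = (t\<^sup>2 * x) ^ 3 + k * t ^ 6] (mod int p)"
      by (intro cong_add cong_pow cong_refl; simp add: cong_def)+
    then have "[((t ^ 3 * y + 0 * x + 0) mod int p)\<^sup>2 = ((t\<^sup>2 * x + 0) mod int p) ^ 3 + k * t ^ 6] (mod int p)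
      \<longleftrightarrow> [(t ^ 3 * y)\<^sup>2 = (t\<^sup>2 * x) ^ 3 + k * t ^ 6] (mod int p)"
      unfolding cong_def by simp
    also have "\<dots> \<longleftrightarrow> [t ^ 6 * y\<^sup>2 = t ^ 6 * (x ^ 3 + k)] (mod int p)"
      by (simp add: power_mult_distrib algebra_simps flip: power_mult)
    also have "\<dots> \<longleftrightarrow> [y\<^sup>2 = x ^ 3 + k] (mod int p)"
    proof -
      have "coprime (t ^ 6) (int p)" using prime_imp_coprime[OF prime_int_p' t6] by (simp add: coprime_commute)
      then show ?thesis by (rule cong_mult_lcancel)
    qed
    finally show "(case P of (x, y) \<Rightarrow> [y\<^sup>2 = x ^ 3 + k] (mod int p))
      = (case ?f P of (x, y) \<Rightarrow> [y\<^sup>2 = x ^ 3 + k * t ^ 6] (mod int p))"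
      unfolding P prod.case ..
  qed
  also have "\<dots> = short_count (k * t ^ 6)"
    unfolding short_count_def by (rule arg_cong[where f = card]) auto
  finally show ?thesis ..
qed

lemma card_square_roots:
  "int (card {y \<in> {0..<int p}. [y\<^sup>2 = a] (mod int p)}) = 1 + Legendre a (int p)"
proof (cases "[a = 0] (mod int p)")
  case True
  have "{y \<in> {0..<int p}. [y\<^sup>2 = a] (mod int p)} = {0}"
  proof (intro equalityI subsetI)
    fix y assume y: "y \<in> {y \<in> {0..<int p}. [y\<^sup>2 = a] (mod int p)}"
    then have "[y\<^sup>2 = 0] (mod int p)" using True cong_trans by blast
    then have "int p dvd y" using prime_dvd_power[OF prime_int_p'] by (simp add: cong_0_iff)
    then show "y \<in> {0}" using y by (cases "y = 0") (auto simp: zdvd_not_zless)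
  qed (use True p5 in \<open>auto simp: cong_sym_eq\<close>)
  then show ?thesis using True by (simp add: Legendre_def)
next
  case False
  show ?thesis
  proof (cases "QuadRes (int p) a")
    case True
    then obtain z0 where z0: "[z0\<^sup>2 = a] (mod int p)" unfolding QuadRes_def by blast
    define z where "z = z0 mod int p"
    have z: "[z\<^sup>2 = a] (mod int p)" "0 \<le> z" "z < int p"
      using z0 p5 by (auto simp: z_def cong_def power_mod)
    have z00: "z \<noteq> 0" using z(1) False by (auto simp: cong_sym_eq)
    have "{y \<in> {0..<int p}. [y\<^sup>2 = a] (mod int p)} = {z, int p - z}"
    proof (intro equalityI subsetI)
      fix y assume y: "y \<in> {y \<in> {0..<int p}. [y\<^sup>2 = a] (mod int p)}"
      then have "[y\<^sup>2 = z\<^sup>2] (mod int p)" using z(1) cong_sym cong_trans by blast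
      then have "int p dvd (y - z) * (y + z)" by (simp add: cong_iff_dvd_diff power2_eq_square algebra_simps)
      then have "int p dvd y - z \<or> int p dvd y + z" using prime_dvd_multD[OF prime_int_p'] by blast
      then show "y \<in> {z, int p - z}"
      proof
        assume "int p dvd y - z"
        then show ?thesis using y z by (metis (no_types, lifting) atLeastLessThan_iff insertI1 mem_Collect_eq mod_eq_dvd_iff mod_pos_pos_trivial)
      next
        assume "int p dvd y + z"
        then obtain k where k: "y + z = int p * k" by blast
        have "0 < int p * k" "int p * k < int p * 2" using y z z00 unfolding k[symmetric] by auto
        then have "0 < k" "k < 2" using p5 by (simp_all add: zero_less_mult_iff)
        then have "k = 1" by simp
        then show ?thesis using k by simp
      qed
    next
      fix y assume "y \<in> {z, int p - z}"
      moreover have "[(int p - z)\<^sup>2 = z\<^sup>2] (mod int p)"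
        by (simp add: cong_iff_dvd_diff power2_eq_square algebra_simps)
      ultimately show "y \<in> {y \<in> {0..<int p}. [y\<^sup>2 = a] (mod int p)}"
        using z z00 by (auto intro: cong_trans)
    qed
    moreover have "z \<noteq> int p - z"
    proof
      assume "z = int p - z"
      then have "int p = 2 * z" by simp
      then have "even p" by presburger
      then show False using p p5 prime_odd_nat by force
    qed
    ultimately show ?thesis using True False by (simp add: Legendre_def)
  next
    case nq: False
    then have "{y \<in> {0..<int p}. [y\<^sup>2 = a] (mod int p)} = {}" by (auto simp: QuadRes_def)
    then have "card {y \<in> {0..<int p}. [y\<^sup>2 = a] (mod int p)} = 0" by (simp only: card.empty)
    then show ?thesis using nq False by (simp only: Legendre_def) simp
  qed
qed

lemma short_count_Legendre:
  "int (short_count k) = int p + (\<Sum>t\<in>{0..<int p}. Legendre (t ^ 3 + k) (int p))"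
proof -
  have "{(x, y) \<in> {0..<int p} \<times> {0..<int p}. [y\<^sup>2 = x ^ 3 + k] (mod int p)}
      = (SIGMA x:{0..<int p}. {y \<in> {0..<int p}. [y\<^sup>2 = x ^ 3 + k] (mod int p)})"
    by auto
  moreover have "card (SIGMA x:{0..<int p}. {y \<in> {0..<int p}. [y\<^sup>2 = x ^ 3 + k] (mod int p)})
      = (\<Sum>x\<in>{0..<int p}. card {y \<in> {0..<int p}. [y\<^sup>2 = x ^ 3 + k] (mod int p)})"
    by (rule card_SigmaI) (auto intro: finite_subset[of _ "{0..<int p}"])
  ultimately have "int (short_count k) = (\<Sum>x\<in>{0..<int p}. int (card {y \<in> {0..<int p}. [y\<^sup>2 = x ^ 3 + k] (mod int p)}))"
    unfolding short_count_def by (simp only: of_nat_sum)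
  then show ?thesis unfolding card_square_roots by (simp add: sum.distrib)
qed

end

text \<open>The standard invariants c4 = b2^2 - 24 b4 and c6 = -b2^3 + 36 b2 b4 - 216 b6. Every
  model of y^2 = x^3 + D has c4 = 0, so its point count away from 2 and 3 depends only on
  c6.\<close>

definition wc4 :: "'a::comm_ring_1 weierstrass \<Rightarrow> 'a" where
  "wc4 W = ((wa1 W)\<^sup>2 + 4 * wa2 W)\<^sup>2 - 24 * (2 * wa4 W + wa1 W * wa3 W)"

definition wc6 :: "'a::comm_ring_1 weierstrass \<Rightarrow> 'a" where
  "wc6 W = - (((wa1 W)\<^sup>2 + 4 * wa2 W) ^ 3)
     + 36 * ((wa1 W)\<^sup>2 + 4 * wa2 W) * (2 * wa4 W + wa1 W * wa3 W)
     - 216 * ((wa3 W)\<^sup>2 + 4 * wa6 W)"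

lemma wdisc_wc4_wc6: "1728 * wdisc W = wc4 W ^ 3 - wc6 W ^ 2"
  for W :: "int weierstrass"
proof -
  define b2 b4 b6 b8 where "b2 = (wa1 W)\<^sup>2 + 4 * wa2 W" and "b4 = 2 * wa4 W + wa1 W * wa3 W"
    and "b6 = (wa3 W)\<^sup>2 + 4 * wa6 W"
    and "b8 = (wa1 W)\<^sup>2 * wa6 W + 4 * wa2 W * wa6 W - wa1 W * wa3 W * wa4 W
       + wa2 W * (wa3 W)\<^sup>2 - (wa4 W)\<^sup>2"
  have b8: "4 * b8 = b2 * b6 - b4\<^sup>2"
    unfolding b2_def b4_def b6_def b8_def by (simp add: power2_eq_square algebra_simps)
  have "wdisc W = - (b2\<^sup>2 * b8) - 8 * b4 ^ 3 - 27 * b6\<^sup>2 + 9 * b2 * b4 * b6"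
    unfolding wdisc_def Let_def b2_def b4_def b6_def b8_def by simp
  then have "1728 * wdisc W = 432 * (- (b2\<^sup>2 * (4 * b8)) - 32 * b4 ^ 3 - 108 * b6\<^sup>2 + 36 * b2 * b4 * b6)"
    by simp
  also have "\<dots> = (b2\<^sup>2 - 24 * b4) ^ 3 - (- (b2 ^ 3) + 36 * b2 * b4 - 216 * b6) ^ 2"
    unfolding b8 by (simp add: power2_eq_square power3_eq_cube algebra_simps)
  finally show ?thesis unfolding wc4_def wc6_def b2_def b4_def b6_def .
qed

lemma of_int_wc4: "wc4 (map_weierstrass of_int W) = (of_int (wc4 W) :: rat)"
  by (cases W) (simp add: wc4_def)

lemma of_int_wc6: "wc6 (map_weierstrass of_int W) = (of_int (wc6 W) :: rat)"
  by (cases W) (simp add: wc6_def)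

lemma change_vars_short:
  fixes A r s t u :: rat
  assumes "u \<noteq> 0"
  defines "W \<equiv> change_vars u r s t (Weierstrass 0 0 0 0 A)"
  shows "wc4 W = 0" "u ^ 6 * wc6 W = - 864 * A"
proof -
  have b2: "(wa1 W)\<^sup>2 + 4 * wa2 W = 12 * r / u\<^sup>2"
    using assms(1) by (simp add: W_def change_vars_def power2_eq_square field_simps)
  have b4: "2 * wa4 W + wa1 W * wa3 W = 6 * r\<^sup>2 / u ^ 4"
    using assms(1) by (simp add: W_def change_vars_def power2_eq_square field_simps eval_nat_numeral)
  have b6: "(wa3 W)\<^sup>2 + 4 * wa6 W = 4 * (A + r ^ 3) / u ^ 6"
    using assms(1) by (simp add: W_def change_vars_def power2_eq_square field_simps eval_nat_numeral)
  show "wc4 W = 0" unfolding wc4_def b2 b4 using assms(1)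
    by (simp add: field_simps eval_nat_numeral)
  show "u ^ 6 * wc6 W = - 864 * A" unfolding wc6_def b2 b4 b6 using assms(1)
    by (simp add: field_simps eval_nat_numeral)
qed

text \<open>The curve y^2 = x^3 + A has c6 = -864 A, and a change of variables divides c6 by u^6;
  \<open>al / be\<close> is u/c in lowest terms.\<close>

lemma integral_model_short:
  assumes "integral_model (Weierstrass 0 0 0 0 (of_int (k * c ^ 6))) W" "k \<noteq> 0" "c \<noteq> 0"
  obtains al be :: int where "coprime al be" "be \<noteq> 0" "wc4 W = 0" "al ^ 6 * wc6 W = - 864 * k * be ^ 6"
proof -
  obtain u r s t where u: "u \<noteq> 0"
    and W: "map_weierstrass of_int W = change_vars u r s t (Weierstrass 0 0 0 0 (of_int (k * c ^ 6) :: rat))"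
    using assms(1) unfolding integral_model_def by blast
  have c4: "(of_int (wc4 W) :: rat) = 0" and c6: "u ^ 6 * of_int (wc6 W) = - 864 * rat_of_int (k * c ^ 6)"
    using change_vars_short[OF u, of r s t "of_int (k * c ^ 6)"] unfolding W[symmetric] of_int_wc4 of_int_wc6 by simp_all
  obtain al be where q: "quotient_of (u / of_int c) = (al, be)" by (cases "quotient_of (u / of_int c)")
  have cop: "coprime al be" and be: "be > 0" and eq: "u / of_int c = of_int al / of_int be"
    using q quotient_of_coprime quotient_of_denom_pos quotient_of_div by blast+
  have ub: "u * of_int be = of_int al * of_int c"
    using eq be assms(3) by (simp add: field_simps)
  have "(of_int al * of_int c) ^ 6 * of_int (wc6 W) = (u ^ 6 * of_int (wc6 W)) * of_int be ^ 6"
    unfolding ub[symmetric] by (simp add: power_mult_distrib)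
  also have "\<dots> = - 864 * of_int (k * c ^ 6) * of_int be ^ 6" unfolding c6 ..
  finally have "(of_int ((al * c) ^ 6 * wc6 W) :: rat) = of_int (- 864 * (k * c ^ 6) * be ^ 6)" by simp
  then have "(al * c) ^ 6 * wc6 W = - 864 * (k * c ^ 6) * be ^ 6" by (simp only: of_int_eq_iff)
  then have "c ^ 6 * (al ^ 6 * wc6 W) = c ^ 6 * (- 864 * k * be ^ 6)" by (simp add: power_mult_distrib ac_simps)
  moreover have "c ^ 6 \<noteq> 0" using assms(3) by simp
  ultimately have "al ^ 6 * wc6 W = - 864 * k * be ^ 6" by (simp only: mult_cancel_left) simp
  then show thesis using that cop be c4 by simp
qed

text \<open>The substitution X = 36 x + 3 b2, Y = 108 (2 y + a1 x + a3) leads to Y^2 = X^3 - 27 c4 X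
  - 54 c6. It multiplies the equation by 46656 = 6^6, a unit modulo \<open>p\<close>.\<close>

lemma card_affine_points_mod:
  assumes p: "prime p" "p \<ge> 5" and c4: "wc4 W = 0"
  shows "card (affine_points_mod p W) = short_count p (- 54 * wc6 W)"
proof -
  let ?R = "{0..<int p}"
  define b2 where "b2 = (wa1 W)\<^sup>2 + 4 * wa2 W"
  have n36: "\<not> int p dvd 36" "\<not> int p dvd 216" "\<not> int p dvd 46656"
    using not_dvd_2_3_power[OF p, of 2 2] not_dvd_2_3_power[OF p, of 3 3] not_dvd_2_3_power[OF p, of 6 6] by simp_all
  have "card (affine_points_mod p W) = card {P \<in> ?R \<times> ?R. case P of (x, y) \<Rightarrow>
      [y\<^sup>2 + wa1 W * x * y + wa3 W * y = x ^ 3 + wa2 W * x\<^sup>2 + wa4 W * x + wa6 W] (mod int p)}"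
    unfolding affine_points_mod_def by (rule arg_cong[where f = card]) auto
  also have "\<dots> = card {P \<in> ?R \<times> ?R. case P of (x, y) \<Rightarrow> [y\<^sup>2 = x ^ 3 + - 54 * wc6 W] (mod int p)}"
  proof (rule card_bij_filter[OF bij_betw_triangular[OF p n36(1,2), of "3 * b2" "108 * wa1 W" "108 * wa3 W"]])
    fix P :: "int \<times> int"
    obtain x y where P: "P = (x, y)" by (cases P)
    define X where "X = 36 * x + 3 * b2"
    define Y where "Y = 216 * y + 108 * wa1 W * x + 108 * wa3 W"
    have "46656 * (y\<^sup>2 + wa1 W * x * y + wa3 W * y - (x ^ 3 + wa2 W * x\<^sup>2 + wa4 W * x + wa6 W))
        = Y\<^sup>2 - (X ^ 3 + - 54 * wc6 W) + (972 * x + 81 * b2) * wc4 W"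
      unfolding X_def Y_def b2_def wc4_def wc6_def
      by (simp add: power2_eq_square power3_eq_cube algebra_simps)
    then have *: "46656 * (y\<^sup>2 + wa1 W * x * y + wa3 W * y - (x ^ 3 + wa2 W * x\<^sup>2 + wa4 W * x + wa6 W))
        = Y\<^sup>2 - (X ^ 3 + - 54 * wc6 W)" using c4 by simp
    have "[y\<^sup>2 + wa1 W * x * y + wa3 W * y = x ^ 3 + wa2 W * x\<^sup>2 + wa4 W * x + wa6 W] (mod int p)
      \<longleftrightarrow> int p dvd 46656 * (y\<^sup>2 + wa1 W * x * y + wa3 W * y - (x ^ 3 + wa2 W * x\<^sup>2 + wa4 W * x + wa6 W))"
      unfolding cong_iff_dvd_diff using n36(3) prime_dvd_multD[OF prime_int_p'[OF p]] by (meson dvd_mult)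
    also have "\<dots> \<longleftrightarrow> [Y\<^sup>2 = X ^ 3 + - 54 * wc6 W] (mod int p)" unfolding * cong_iff_dvd_diff ..
    also have "\<dots> \<longleftrightarrow> [(Y mod int p)\<^sup>2 = (X mod int p) ^ 3 + - 54 * wc6 W] (mod int p)"
    proof -
      have "[(Y mod int p)\<^sup>2 = Y\<^sup>2] (mod int p)"
        "[(X mod int p) ^ 3 + - 54 * wc6 W = X ^ 3 + - 54 * wc6 W] (mod int p)"
        by (intro cong_add cong_pow cong_refl; simp add: cong_def)+
      then show ?thesis unfolding cong_def by simp
    qed
    finally show "(case P of (x, y) \<Rightarrow>
        [y\<^sup>2 + wa1 W * x * y + wa3 W * y = x ^ 3 + wa2 W * x\<^sup>2 + wa4 W * x + wa6 W] (mod int p))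
      = (case (case P of (x, y) \<Rightarrow> ((36 * x + 3 * b2) mod int p, (216 * y + 108 * wa1 W * x + 108 * wa3 W) mod int p)) of
         (x, y) \<Rightarrow> [y\<^sup>2 = x ^ 3 + - 54 * wc6 W] (mod int p))"
      unfolding P prod.case X_def Y_def .
  qed
  also have "\<dots> = short_count p (- 54 * wc6 W)"
    unfolding short_count_def[OF p] by (rule arg_cong[where f = card]) auto
  finally show ?thesis .
qed

text \<open>The discriminant -432 k^2 of y^2 = x^3 + k is prime to \<open>p\<close>, so any minimal
  choice has discriminant prime to \<open>p\<close>, even when \<open>p\<close> divides
  \<open>c\<close>. Its c6 is k times a sixth power prime to \<open>p\<close>, up to the constants
  of \<open>card_affine_points_mod\<close>, so it has as many points as y^2 = x^3 + k.\<close>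

theorem minimal_model_short:
  assumes p: "prime p" "p \<ge> 5" and k: "\<not> int p dvd k" and c: "c \<noteq> 0"
  defines "E \<equiv> Weierstrass 0 0 0 0 (of_int (k * c ^ 6))"
  shows "good_reduction E p"
    "trace_frob E p = - (\<Sum>t\<in>{0..<int p}. Legendre (t ^ 3 + k) (int p))"
proof -
  have k0: "k \<noteq> 0" using k by auto
  define W0 where "W0 = (Weierstrass 0 0 0 0 k :: int weierstrass)"
  have "integral_model E W0"
    unfolding integral_model_def E_def W0_def using c
    by (intro exI[of _ "of_int c"] exI[of _ 0]) (simp add: change_vars_def)
  moreover have "multiplicity (int p) (wdisc W0) = 0"
  proof (rule not_dvd_imp_multiplicity_0)
    have "wdisc W0 = - (2 ^ 4 * 3 ^ 3 * k\<^sup>2)" by (simp add: W0_def wdisc_def power_mult_distrib)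
    moreover have "\<not> int p dvd 2 ^ 4 * 3 ^ 3 * k\<^sup>2"
      using not_dvd_2_3_power[OF p, of 4 3] k prime_dvd_multD[OF prime_int_p'[OF p]]
        prime_dvd_power[OF prime_int_p'[OF p]] by blast
    ultimately show "\<not> int p dvd wdisc W0" by (metis dvd_minus_iff)
  qed
  ultimately have W: "integral_model E (minimal_model E p)"
      "multiplicity (int p) (wdisc (minimal_model E p)) = 0"
    using arg_min_nat_lemma[of "integral_model E" W0 "\<lambda>W. multiplicity (int p) (wdisc W)"]
    unfolding minimal_model_def by auto
  define W1 where "W1 = minimal_model E p"
  obtain al be where ab: "coprime al be" "be \<noteq> 0" "wc4 W1 = 0" "al ^ 6 * wc6 W1 = - 864 * k * be ^ 6"
    using integral_model_short[OF W(1)[unfolded E_def] k0 c] unfolding W1_def E_def by metis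
  have d: "1728 * wdisc W1 = - (wc6 W1 ^ 2)" using wdisc_wc4_wc6[of W1] ab(3) by simp
  \<comment> \<open>\<open>multiplicity\<close> is 0 at 0 as well, so the discriminant has to be
    shown nonzero before its multiplicity says anything.\<close>
  have "wc6 W1 \<noteq> 0" using ab(2,4) k0 by auto
  then have "wdisc W1 \<noteq> 0" using d by auto
  moreover have "\<not> is_unit (int p)" using p by (simp add: prime_nat_iff)
  ultimately have nd: "\<not> int p dvd wdisc W1"
    using W(2) unfolding W1_def by (simp add: multiplicity_eq_zero_iff)
  then show "good_reduction E p" unfolding good_reduction_def W1_def .
  note pd = prime_dvd_multD[OF prime_int_p'[OF p]] prime_dvd_power[OF prime_int_p'[OF p]]
  have "\<not> int p dvd wc6 W1"
  proof
    assume "int p dvd wc6 W1"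
    then have "int p dvd 2 ^ 6 * 3 ^ 3 * wdisc W1" using d by (simp add: power2_eq_square)
    then show False using nd not_dvd_2_3_power[OF p, of 6 3] pd by blast
  qed
  then have c6: "\<not> int p dvd wc6 W1" .
  have n864: "\<not> int p dvd - 864"
    using not_dvd_2_3_power[OF p, of 5 3] by (simp add: dvd_minus_iff[of _ 864])
  have nal: "\<not> int p dvd al"
  proof
    assume a: "int p dvd al"
    then have "int p dvd al ^ 6 * wc6 W1" by (intro dvd_mult2 dvd_trans[OF a dvd_power]) simp
    then have "int p dvd be" using ab(4) n864 k pd by metis
    then show False using a ab(1) p by (metis coprime_common_divisor prime_int_p' not_prime_unit)
  qed
  have nbe: "\<not> int p dvd be"
  proof
    assume b: "int p dvd be"
    then have "int p dvd - 864 * k * be ^ 6" by (intro dvd_mult dvd_trans[OF b dvd_power]) simp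
    then have "int p dvd al" using ab(4) c6 pd by metis
    then show False using nal by blast
  qed
  have n6: "\<not> int p dvd 6 * be" using nbe not_dvd_2_3_power[OF p, of 1 1] pd by auto
  have "card (affine_points_mod p W1) = short_count p (- 54 * wc6 W1)"
    by (rule card_affine_points_mod[OF p ab(3)])
  also have "\<dots> = short_count p (- 54 * wc6 W1 * al ^ 6)" by (rule short_count_scale[OF p nal, symmetric])
  also have "- 54 * wc6 W1 * al ^ 6 = k * (6 * be) ^ 6"
    using ab(4) by (simp add: power_mult_distrib ac_simps)
  also have "short_count p (k * (6 * be) ^ 6) = short_count p k" by (rule short_count_scale[OF p n6])
  finally have "card (affine_points_mod p (minimal_model E p)) = short_count p k" unfolding W1_def .
  then show "trace_frob E p = - (\<Sum>t\<in>{0..<int p}. Legendre (t ^ 3 + k) (int p))"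
    unfolding trace_frob_def num_points_def using short_count_Legendre[OF p, of k] by simp
qed

section \<open>Products of two primes\<close>

lemma L_coeff_prime: "prime p \<Longrightarrow> L_coeff E p = trace_frob E p"
  by (simp add: L_coeff_def prime_prime_factors)

lemma multiplicity_prime_times_prime:
  fixes p q :: "'a :: factorial_semiring"
  assumes "prime p" "prime q" "p \<noteq> q" shows "multiplicity p (p * q) = 1"
proof -
  have "\<not> p dvd q" using assms primes_dvd_imp_eq by blast
  then have "multiplicity p q = 0" by (rule not_dvd_imp_multiplicity_0)
  then show ?thesis
    using assms by (subst prime_elem_multiplicity_mult_distrib) (auto simp: prime_gt_0_nat)
qed

lemma L_coeff_two_primes:
  assumes "prime p" "prime q" "p \<noteq> q"
  shows "L_coeff E (p * q) = trace_frob E p * trace_frob E q"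
proof -
  have "prime_factors (p * q) = {p, q}"
    using assms by (subst prime_factors_product) (auto simp: prime_prime_factors)
  moreover have "multiplicity p (p * q) = 1" "multiplicity q (p * q) = 1"
    using multiplicity_prime_times_prime[of p q] multiplicity_prime_times_prime[of q p] assms
    by (simp_all add: mult.commute)
  ultimately show ?thesis using assms(3) by (simp add: L_coeff_def)
qed

text \<open>The condition on orders holds in either case of \<open>tr\<close>: if a_n = 1, the order
  of a_n - 1 = 0 is infinite; otherwise both traces differ from 1 modulo their primes, and the
  required order is 1 - 1 = 0.\<close>

lemma elliptic_korselt_I_two_primes:
  assumes pq: "prime p" "prime q" "p \<noteq> q"
    and good: "good_reduction E p" "good_reduction E q"
    and dvd: "int p + 1 - trace_frob E p dvd int (p * q) + 1 - trace_frob E p * trace_frob E q"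
      "int q + 1 - trace_frob E q dvd int (p * q) + 1 - trace_frob E p * trace_frob E q"
    and tr: "trace_frob E p * trace_frob E q = 1 \<or>
      \<not> [trace_frob E p = 1] (mod int p) \<and> \<not> [trace_frob E q = 1] (mod int q)"
  shows "elliptic_korselt_I E (p * q)"
  unfolding elliptic_korselt_I_def
proof (intro conjI allI impI)
  show "p * q > 0" using pq by (simp add: prime_gt_0_nat)
  have "prime_factors (p * q) = {p, q}"
    using pq by (subst prime_factors_product) (auto simp: prime_prime_factors)
  then show "2 \<le> card (prime_factors (p * q))" using pq(3) by simp
  fix r assume r: "prime r \<and> r dvd p * q"
  then have "r dvd p \<or> r dvd q" using prime_dvd_multD[of r p q] by blast
  then have rpq: "r = p \<or> r = q" using r pq primes_dvd_imp_eq by blast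
  show "good_reduction E r" using rpq good by blast
  show "int r + 1 - L_coeff E r dvd int (p * q) + 1 - L_coeff E (p * q)"
    using rpq dvd pq by (auto simp: L_coeff_prime L_coeff_two_primes)
  have "multiplicity (int p) (int p * int q) = 1" "multiplicity (int q) (int q * int p) = 1"
    using multiplicity_prime_times_prime[of "int p" "int q"] multiplicity_prime_times_prime[of "int q" "int p"] pq
    by simp_all
  then have o: "ord_at r (int (p * q)) = 1"
    using rpq pq by (auto simp: ord_at_def one_enat_def mult.commute)
  show "ord_at r (L_coeff E (p * q) - 1) \<ge>
      ord_at r (int (p * q)) - (if [L_coeff E r = 1] (mod int r) then 0 else 1)"
  proof (cases "trace_frob E p * trace_frob E q = 1")
    case True
    then show ?thesis by (simp add: L_coeff_two_primes pq ord_at_def)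
  next
    case False
    then have "\<not> [L_coeff E r = 1] (mod int r)" using tr rpq pq by (auto simp: L_coeff_prime)
    then show ?thesis unfolding o by simp
  qed
qed

lemma infinite_two_primes:
  assumes "infinite S" "prime q" "\<And>p. p \<in> S \<Longrightarrow> elliptic_korselt_I E (q * p)"
  shows "infinite {n. elliptic_korselt_I E n}"
proof -
  have "inj_on (\<lambda>p. q * p) S" using prime_gt_0_nat[OF assms(2)] by (intro inj_onI) simp
  then have "infinite ((\<lambda>p. q * p) ` S)" using assms(1) by (simp add: finite_image_iff)
  moreover have "(\<lambda>p. q * p) ` S \<subseteq> {n. elliptic_korselt_I E n}" using assms(3) by blast
  ultimately show ?thesis using infinite_super by blast
qed

section \<open>From the conjecture to infinitely many Korselt numbers\<close>

lemma infinite_above: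
  fixes S :: "nat set" assumes "infinite S" shows "infinite {p \<in> S. p > B}"
proof -
  have "S \<subseteq> {p \<in> S. p > B} \<union> {..B}" by auto
  then show ?thesis using assms finite_subset by (metis finite_Un finite_atMost)
qed

lemma infinite_korselt_anomalous:
  fixes D :: int
  assumes HL: "hardy_littlewood_conjecture"
    and D0: "D \<noteq> 0" and M: "M > 0" and cop: "coprime (3 * (int m0)\<^sup>2 + 3 * int m0 + 1) (3 * int M)"
    and an: "\<And>p m. prime p \<Longrightarrow> int p = 3 * (int m)\<^sup>2 + 3 * int m + 1 \<Longrightarrow> m > 0 \<Longrightarrow> [m = m0] (mod M)
      \<Longrightarrow> \<not> int p dvd D \<Longrightarrow> (\<Sum>t\<in>{0..<int p}. Legendre (t ^ 3 + D) (int p)) = - 1"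
  shows "infinite {n. elliptic_korselt_I (Weierstrass 0 0 0 0 (of_int D)) n}"
proof -
  let ?E = "Weierstrass 0 0 0 0 (of_int D) :: rat weierstrass"
  \<comment> \<open>The coefficients of 3 m^2 + 3 m + 1 at m = m0 + M k as a polynomial in k; its
    discriminant is -3 M^2.\<close>
  define a b c where "a = 3 * (int M)\<^sup>2" and "b = 3 * int M * (2 * int m0 + 1)"
    and "c = 3 * (int m0)\<^sup>2 + 3 * int m0 + 1"
  have "a > 0" using M by (simp add: a_def)
  moreover have "Gcd {a, b, c} = 1"
  proof -
    have "coprime c (3 * int M * int M)" using cop unfolding c_def by simp
    then have "coprime a c" by (simp add: a_def power2_eq_square coprime_commute mult.assoc)
    moreover have "Gcd {a, b, c} = gcd b (gcd a c)" by (simp add: gcd.left_commute)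
    ultimately show ?thesis by simp
  qed
  moreover have "odd c" by (simp add: c_def)
  moreover have "\<not> (\<exists>k. b\<^sup>2 - 4 * a * c = k\<^sup>2)"
  proof -
    have "b\<^sup>2 - 4 * a * c = - (3 * (int M)\<^sup>2)"
      by (simp add: a_def b_def c_def power2_eq_square algebra_simps)
    also have "\<dots> < 0" using M by simp
    finally have "b\<^sup>2 - 4 * a * c < 0" .
    then show ?thesis by (metis not_less zero_le_power2)
  qed
  ultimately have inf: "infinite (quadratic_primes a b c)"
    using HL unfolding hardy_littlewood_conjecture_def by blast
  define S where "S = {p \<in> quadratic_primes a b c. p > nat \<bar>D\<bar> + 5}"
  have S: "infinite S" unfolding S_def using inf by (rule infinite_above)
  have SP: "prime p \<and> good_reduction ?E p \<and> trace_frob ?E p = 1" if pS: "p \<in> S" for p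
  proof -
    from pS obtain k where p: "prime p" "p > nat \<bar>D\<bar> + 5" and k: "int p = a * (int k)\<^sup>2 + b * int k + c"
      unfolding S_def quadratic_primes_def by blast
    define m where "m = m0 + M * k"
    have pm: "int p = 3 * (int m)\<^sup>2 + 3 * int m + 1"
      unfolding k by (simp add: m_def a_def b_def c_def power2_eq_square algebra_simps)
    have "m \<noteq> 0"
    proof
      assume "m = 0"
      then show False using pm p by simp
    qed
    then have m: "m > 0" by simp
    have mm: "[m = m0] (mod M)" by (simp add: m_def cong_def)
    have nd: "\<not> int p dvd D" using p(2) D0 by (auto dest!: dvd_imp_le_int)
    have sum: "(\<Sum>t\<in>{0..<int p}. Legendre (t ^ 3 + D) (int p)) = - 1" by (rule an[OF p(1) pm m mm nd])
    have p5: "p \<ge> 5" using p(2) by simp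
    show ?thesis
      using minimal_model_short[OF p(1) p5 nd, of 1] p(1) sum by simp
  qed
  obtain q where q: "q \<in> S" using S by (metis finite.emptyI ex_in_conv)
  have "infinite (S - {q})" using S by simp
  then show ?thesis
  proof (rule infinite_two_primes)
    show "prime q" using SP[OF q] by blast
    fix p assume "p \<in> S - {q}"
    then have "p \<in> S" "q \<noteq> p" by auto
    then show "elliptic_korselt_I ?E (q * p)"
      using SP[OF q] SP[of p] by (intro elliptic_korselt_I_two_primes) auto
  qed
qed

lemma residues_13: "{0..<13::int} = {0, 1, 2, 3, 4, 5, 6, 7, 8, 9, 10, 11, 12}"
proof (rule Set.set_eqI)
  fix x :: int
  show "x \<in> {0..<13} \<longleftrightarrow> x \<in> {0, 1, 2, 3, 4, 5, 6, 7, 8, 9, 10, 11, 12}"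
    unfolding atLeastLessThan_iff insert_iff empty_iff by presburger
qed

lemma Legendre_13: "Legendre x 13 = (if x mod 13 = 0 then 0 else if x mod 13 \<in> {1, 3, 4, 9, 10, 12} then 1 else - 1)"
proof -
  have sq: "y\<^sup>2 mod 13 \<in> {0, 1, 3, 4, 9, 10, 12}" for y :: int
  proof -
    have "y mod 13 \<in> {0..<13}" by simp
    then have "(y mod 13)\<^sup>2 mod 13 \<in> {0, 1, 3, 4, 9, 10, 12}"
      unfolding residues_13 by auto
    then show ?thesis by (simp add: power_mod)
  qed
  have "QuadRes 13 x \<longleftrightarrow> x mod 13 \<in> {0, 1, 3, 4, 9, 10, 12}"
  proof
    assume "QuadRes 13 x"
    then obtain y where "y\<^sup>2 mod 13 = x mod 13" unfolding QuadRes_def cong_def by blast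
    then show "x mod 13 \<in> {0, 1, 3, 4, 9, 10, 12}" using sq[of y] by simp
  next
    assume "x mod 13 \<in> {0, 1, 3, 4, 9, 10, 12}"
    then have "\<exists>y\<in>{0, 1, 4, 2, 3, 6, 5}. (y::int)\<^sup>2 mod 13 = x mod 13" by auto
    then show "QuadRes 13 x" unfolding QuadRes_def cong_def by blast
  qed
  then show ?thesis by (auto simp: Legendre_def cong_0_iff dvd_eq_mod_eq_0)
qed

lemma infinite_korselt_exceptional:
  fixes D s c :: int
  assumes HL: "hardy_littlewood_conjecture"
    and s: "s = - 1 \<or> s = 27" and D: "D = 16 * s * 7 ^ 5 * c ^ 6" and c: "c \<noteq> 0"
  shows "infinite {n. elliptic_korselt_I (Weierstrass 0 0 0 0 (of_int D)) n}"
proof -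
  let ?E = "Weierstrass 0 0 0 0 (of_int D) :: rat weierstrass"
  define k where "k = 16 * s * 7 ^ 5"
  have Dk: "D = k * c ^ 6" by (simp add: D k_def)
  have k: "k = - 268912 \<or> k = 7260624" using s by (auto simp: k_def)
  have nd13: "\<not> int 13 dvd k" using k by auto
  have "(\<Sum>t\<in>{0..<int 13}. Legendre (t ^ 3 + k) (int 13)) = - 7"
    using k by (elim disjE) (simp_all add: Legendre_13 residues_13)
  then have E13: "good_reduction ?E 13" "trace_frob ?E 13 = 7"
    using minimal_model_short[OF _ _ nd13 c] unfolding Dk by simp_all
  have "\<not> (\<exists>z::int. 0\<^sup>2 - 4 * 5292 * 1 = z\<^sup>2)"
  proof
    assume "\<exists>z::int. 0\<^sup>2 - 4 * 5292 * 1 = z\<^sup>2"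
    then obtain z :: int where "z\<^sup>2 = - 21168" by auto
    then show False using zero_le_power2[of z] by simp
  qed
  \<comment> \<open>5292 = 3 * 42^2.\<close>
  then have "infinite (quadratic_primes 5292 0 1)"
    using HL[unfolded hardy_littlewood_conjecture_def, rule_format, of 5292 0 1] by simp
  \<comment> \<open>7260624 = 16 * 27 * 7^5 is the larger of the two values of |k|, so these primes
    do not divide \<open>k\<close>.\<close>
  then have inf: "infinite {p \<in> quadratic_primes 5292 0 1. p > 7260624}" (is "infinite ?S")
    by (rule infinite_above)
  show ?thesis
  proof (rule infinite_two_primes[OF inf])
    show "prime (13::nat)" by simp
    fix p assume "p \<in> ?S"
    then obtain m where pp: "prime p" "p > 7260624" and m: "int p = 5292 * (int m)\<^sup>2 + 1"
      unfolding quadratic_primes_def by auto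
    have "m > 0" using pp m by (cases m) auto
    then interpret trace_two_prime p "int m"
      using pp m by unfold_locales (simp_all add: power_mult_distrib)
    have ndp: "\<not> int p dvd k"
    proof
      assume "int p dvd k"
      then have "int p dvd 268912 \<or> int p dvd 7260624" using k by auto
      then have "int p \<le> 7260624" using zdvd_imp_le[of "int p" 268912] zdvd_imp_le[of "int p" 7260624] by auto
      then show False using pp(2) by simp
    qed
    have "(\<Sum>t\<in>{0..<int p}. Legendre (t ^ 3 + k) (int p)) = - 2"
      using pp by (intro sum_Legendre_trace_two[OF s, of 1]) (auto simp: k_def prime_nat_iff)
    then have Ep: "good_reduction ?E p" "trace_frob ?E p = 2"
      using minimal_model_short[OF pp(1) _ ndp c] pp(2) unfolding Dk by simp_all
    show "elliptic_korselt_I ?E (13 * p)"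
    proof (rule elliptic_korselt_I_two_primes)
      \<comment> \<open>With traces 7 and 2 the right side is 13 (p - 1). The divisors are 7, which
        divides p - 1, and p - 1 itself.\<close>
      show "int 13 + 1 - trace_frob ?E 13 dvd int (13 * p) + 1 - trace_frob ?E 13 * trace_frob ?E p"
        unfolding E13 Ep by (simp add: m)
      show "int p + 1 - trace_frob ?E p dvd int (13 * p) + 1 - trace_frob ?E 13 * trace_frob ?E p"
      proof -
        have "int (13 * p) + 1 - 7 * 2 = 13 * (int p + 1 - 2)" by simp
        then show ?thesis unfolding E13 Ep by (metis dvd_triv_right)
      qed
      show "trace_frob ?E 13 * trace_frob ?E p = 1 \<or>
        \<not> [trace_frob ?E 13 = 1] (mod int 13) \<and> \<not> [trace_frob ?E p = 1] (mod int p)"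
        unfolding E13 Ep using pp(2) by (auto simp: cong_def)
    qed (use pp E13 Ep in auto)
  qed
qed

lemma of_int_csqrt_Q_sqrt_minus3: "of_int x + of_int y * csqrt (- 3) \<in> Q_sqrt_minus3"
proof -
  have "of_int x + of_int y * csqrt (- 3) = of_rat (of_int x) + of_rat (of_int y) * csqrt (- 3)" by simp
  then show ?thesis unfolding Q_sqrt_minus3_def by blast
qed

lemma of_int_csqrt_Eisenstein: "of_int x + of_int y * csqrt (- 3) \<in> Eisenstein_integers"
proof -
  have "of_int x + of_int y * csqrt (- 3) = of_int (x - y) + of_int (2 * y) * ((1 + csqrt (- 3)) / 2)"
    by (simp add: algebra_simps)
  then show ?thesis unfolding Eisenstein_integers_def by blast
qed

theorem corollary4p1:
  fixes D :: int
  assumes hardy_littlewood_conjecture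
    and "\<not> (\<exists>z \<in> Q_sqrt_minus3. of_int D = z\<^sup>2)"
    and "\<not> (\<exists>z \<in> Q_sqrt_minus3. of_int D = z ^ 3)"
    and "\<forall>d \<in> Eisenstein_integers. of_int D \<noteq> 80 * d ^ 6"
  shows "infinite {n. elliptic_korselt_I (Weierstrass 0 0 0 0 (of_int D)) n}"
proof -
  \<comment> \<open>Elements c sqrt(-3) have square -3 c^2 and sixth power -27 c^6; they account for
    the second shape in \<open>sq\<close> and in \<open>n80\<close>.\<close>
  have s2: "(of_int c * csqrt (- 3)) ^ 2 = of_int (- 3 * c\<^sup>2)" for c
    by (simp only: power_mult_distrib power2_csqrt) simp
  have sq: "D \<noteq> c\<^sup>2" "D \<noteq> - 3 * c\<^sup>2" for c
    using assms(2) of_int_csqrt_Q_sqrt_minus3[of c 0] of_int_csqrt_Q_sqrt_minus3[of 0 c] s2[of c] by auto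
  have cube: "D \<noteq> c ^ 3" for c
    using assms(3) of_int_csqrt_Q_sqrt_minus3[of c 0] by auto
  have "(of_int c * csqrt (- 3)) ^ 6 = ((of_int c * csqrt (- 3)) ^ 2) ^ 3" for c :: int
    by (simp flip: power_mult)
  then have s6: "80 * (of_int c * csqrt (- 3)) ^ 6 = of_int (- 27 * 80 * c ^ 6)" for c
    unfolding s2 by (simp add: power_mult_distrib flip: power_mult)
  have n80: "D \<noteq> 80 * c ^ 6" "D \<noteq> - 27 * 80 * c ^ 6" for c
  proof -
    show "D \<noteq> 80 * c ^ 6" using assms(4) of_int_csqrt_Eisenstein[of c 0] by auto
    have "of_int D \<noteq> 80 * (of_int c * csqrt (- 3)) ^ 6" using assms(4) of_int_csqrt_Eisenstein[of 0 c] by simp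
    then show "D \<noteq> - 27 * 80 * c ^ 6" unfolding s6 by (metis of_int_eq_iff)
  qed
  have D0: "D \<noteq> 0" using sq(1)[of 0] by simp
  show ?thesis
  \<comment> \<open>s = 27 is the twin of s = -1 under the factor -27, just as -27 * 80 is the twin
    of 80; this family satisfies the hypotheses and needs the other construction.\<close>
  proof (cases "\<exists>s c. (s = - 1 \<or> s = 27) \<and> D = 16 * s * 7 ^ 5 * c ^ 6")
    case True
    then obtain s c where sc: "s = - 1 \<or> s = 27" "D = 16 * s * 7 ^ 5 * c ^ 6" by blast
    then have "c \<noteq> 0" using D0 by auto
    then show ?thesis by (rule infinite_korselt_exceptional[OF assms(1) sc])
  next
    case False
    then have n7: "D \<noteq> 16 * (- 1) * 7 ^ 5 * c ^ 6" "D \<noteq> 16 * 27 * 7 ^ 5 * c ^ 6" for c by blast+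
    show ?thesis
      using D0 sq cube n80 n7
    proof (rule anomalous_progression)
      fix M m0
      assume "M > 0" "coprime (3 * (int m0)\<^sup>2 + 3 * int m0 + 1) (3 * int M)"
        "\<And>p m. prime p \<Longrightarrow> int p = 3 * (int m)\<^sup>2 + 3 * int m + 1 \<Longrightarrow> m > 0 \<Longrightarrow> [m = m0] (mod M)
          \<Longrightarrow> \<not> int p dvd D \<Longrightarrow> (\<Sum>t\<in>{0..<int p}. Legendre (t ^ 3 + D) (int p)) = - 1"
      then show ?thesis by (rule infinite_korselt_anomalous[OF assms(1) D0])
    qed
  qed
qed

end
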